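(* Let $(X,T,\mu,d)$ be a metric measure-preserving system with $X$ a compact Riemannian manifold, let $(M_k)_{k\ge1}$ be a sequence in $[0,1]$, and let $r_k(x)$ and $E_k$ be defined as in the context. Suppose that $(X,T,\mu,d)$ satisfies the four assumptions ($3$-fold decorrelation, short return times, Frostman property, thin annuli) listed in the context, and that there is $C>0$ such that $M_k\le C(\log k)^{-(2+N)/\delta}$ for all $k\ge2$, where $N,\delta>0$ are the constants appearing in the short return times assumption. Then for every $\varepsilon>0$, for $\mu$-a.e. $x\in X$, \[ \sum_{k=1}^{n}\mathbf{1}_{B(x,r_k(x))}(T^kx)=\Phi(n)+O\bigl(\Phi(n)^{1/2}(\log\Phi(n))^{3/2+\varepsilon}\bigr)\qquad(n\to\infty), \] where $\Phi(n)=\sum_{k=1}^{n}\mu\bigl(B(x,r_k(x))\bigr)$.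
   Context: A metric measure-preserving system $(X,T,\mu,d)$: $(X,d)$ is a metric space, $T\colon X\to X$ is measurable, $\mu$ is a Borel probability measure with $\mu(T^{-1}A)=\mu(A)$ for all $\mu$-measurable $A$. $B(x,r)$ is the open ball of radius $r$ around $x$; $\mathbf{1}_E$ is the indicator function of $E$. For a Lipschitz function $f$, $\|f\|_{\mathrm{Lip}}=\|f\|_\infty+[f]_1$ with $[f]_1=\sup_{x\ne y} d(f(x),f(y))/d(x,y)$. Radii and sets: $r_k(x)=\inf\{r\ge0:\mu(B(x,r))\ge M_k\}$, so that (when such a ball exists) $B(x,r_k(x))$ is the open ball around $x$ with $\mu(B(x,r_k(x)))=M_k$; under the Frostman and thin annuli assumptions the paper takes $r_k$ to be well defined on $\operatorname{supp}\mu$, hence $\mu$-a.e., so $\Phi(n)=\sum_{k=1}^nM_k$. Put $E_k=\{x\in X: T^kx\in B(x,r_k(x))\}$. Assumptions: ($3$-fold decorrelation) There exist $C,\tau>0$ and $\sigma\in(0,1]$ such that for all non-negative Lipschitz functions $\varphi_1,\varphi_2,\varphi_3\colon X\to[0,\infty)$, \[ \Bigl|\int_X\varphi_1\,(\varphi_2\circ T^k)\,(\varphi_3\circ T^{k+l})\,d\mu-\int_X\varphi_1\,d\mu\int_X\varphi_2\,d\mu\int_X\varphi_3\,d\mu\Bigr|\le C\|\varphi_1\|_{\mathrm{Lip}}\|\varphi_2\|_{\mathrm{Lip}}\|\varphi_3\|_{\mathrm{Lip}}\,e^{-\tau\min\{k,l\}} \] for all integers $k,l>0$, and \[ \Bigl|\int_X\varphi_1\,(\varphi_2\circ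 T^k)\,(\varphi_3\circ T^{k+l})\,d\mu-\int_X\varphi_1\,(\varphi_2\circ T^k)\,d\mu\int_X\varphi_3\,d\mu\Bigr|\le C\|\varphi_1\|_{\mathrm{Lip}}\|\varphi_2\|_{\mathrm{Lip}}\|\varphi_3\|_{\mathrm{Lip}}\,e^{-\tau l} \] for all integers $k,l>0$ with $k\le\sigma l$. (Short return times) There exist constants $C,\delta,N>0$ and a summable function $\psi\colon\mathbb{N}\to[0,\infty)$ such that $\mu(E_k\cap E_{k+l})\le C\mu(E_k)^{1+\delta}(\log k)^N+\mu(E_k)\psi(l)$ for all positive integers $k,l$. (Frostman property) There exist $C,s>0$ such that $\mu(B(x,r))\le Cr^s$ for all $x\in X$ and all sufficiently small $r$. (Thin annuli) There exist $C,\alpha_0,r_0>0$ such that $\mu(B(x,r+\varepsilon)\setminus B(x,r))\le C\varepsilon^{\alpha_0}$ for all $0<\varepsilon\le r\le r_0$ and all $x\in X$. The implied constant in $O(\cdot)$ may depend on $x$ and $\varepsilon$. Convention: if $\Phi(n)$ stays bounded, the conclusion is read as saying that the difference of the two sums is bounded in $n$ for $\mu$-a.e. $x$. *)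

theory Defs
  imports "HOL-Probability.Probability" "HOL-Library.Landau_Symbols"
begin

text \<open>
  Smoothness of maps between Euclidean spaces. The definition is meant for open sets \<open>U\<close>:
  it refers to the derivative at a point in the full space.
\<close>

primrec Ck_on ::
  "nat \<Rightarrow> 'e::euclidean_space set \<Rightarrow> ('e \<Rightarrow> 'f::euclidean_space) \<Rightarrow> bool" where
  "Ck_on 0 U f \<longleftrightarrow> continuous_on U f"
| "Ck_on (Suc n) U f \<longleftrightarrow>
     f differentiable_on U \<and> (\<forall>v. Ck_on n U (\<lambda>x. frechet_derivative f (at x) v))"

definition smooth_on ::
  "'e::euclidean_space set \<Rightarrow> ('e \<Rightarrow> 'f::euclidean_space) \<Rightarrow> bool" where
  "smooth_on U f \<longleftrightarrow> (\<forall>n. Ck_on n U f)"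

text \<open>
  A chart is a pair \<open>(U, \<phi>)\<close> of its domain and its coordinate map; the values of
  \<open>\<phi>\<close> outside \<open>U\<close> are irrelevant. Manifolds have no boundary, and their dimension is that
  of the Euclidean space \<open>'e\<close>.
\<close>

type_synonym ('a, 'e) chart = "'a set \<times> ('a \<Rightarrow> 'e)"

definition smooth_atlas ::
  "('a::topological_space, 'e::euclidean_space) chart set \<Rightarrow> bool" where
  "smooth_atlas \<A> \<longleftrightarrow>
     (\<Union>(U, \<phi>)\<in>\<A>. U) = UNIV \<and>
     (\<forall>(U, \<phi>)\<in>\<A>. open U \<and> open (\<phi> ` U) \<and> homeomorphism U (\<phi> ` U) \<phi> (inv_into U \<phi>)) \<and>
     (\<forall>(U, \<phi>)\<in>\<A>. \<forall>(V, \<psi>)\<in>\<A>. smooth_on (\<phi> ` (U \<inter> V)) (\<psi> \<circ> inv_into U \<phi>))"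

text \<open>
  A Riemannian metric is given by its coordinate expressions: \<open>g (U, \<phi>) x v w\<close> is the inner
  product of the tangent vectors at \<open>x \<in> U\<close> whose coordinates in the chart \<open>(U, \<phi>)\<close> are
  \<open>v\<close> and \<open>w\<close>.
\<close>

definition riemannian_metric ::
  "('a::topological_space, 'e::euclidean_space) chart set
     \<Rightarrow> (('a, 'e) chart \<Rightarrow> 'a \<Rightarrow> 'e \<Rightarrow> 'e \<Rightarrow> real) \<Rightarrow> bool" where
  "riemannian_metric \<A> g \<longleftrightarrow>
     (\<forall>(U, \<phi>)\<in>\<A>. \<forall>x\<in>U.
        bilinear (g (U, \<phi>) x) \<and>
        (\<forall>v w. g (U, \<phi>) x v w = g (U, \<phi>) x w v) \<and>
        (\<forall>v. v \<noteq> 0 \<longrightarrow> g (U, \<phi>) x v v > 0)) \<and>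
     (\<forall>(U, \<phi>)\<in>\<A>. \<forall>v w. smooth_on (\<phi> ` U) (\<lambda>p. g (U, \<phi>) (inv_into U \<phi> p) v w)) \<and>
     (\<forall>(U, \<phi>)\<in>\<A>. \<forall>(V, \<psi>)\<in>\<A>. \<forall>x\<in>U \<inter> V. \<forall>v w.
        g (U, \<phi>) x v w =
        g (V, \<psi>) x (frechet_derivative (\<psi> \<circ> inv_into U \<phi>) (at (\<phi> x)) v)
                 (frechet_derivative (\<psi> \<circ> inv_into U \<phi>) (at (\<phi> x)) w))"

definition C1_curve ::
  "('a::topological_space, 'e::euclidean_space) chart set
     \<Rightarrow> real \<Rightarrow> real \<Rightarrow> (real \<Rightarrow> 'a) \<Rightarrow> bool" where
  "C1_curve \<A> a b \<gamma> \<longleftrightarrow>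
     continuous_on {a..b} \<gamma> \<and>
     (\<forall>(U, \<phi>)\<in>\<A>. \<exists>D. continuous_on {t\<in>{a..b}. \<gamma> t \<in> U} D \<and>
        (\<forall>t\<in>{a..b}. \<gamma> t \<in> U \<longrightarrow>
           ((\<phi> \<circ> \<gamma>) has_vector_derivative D t) (at t within {a..b})))"

text \<open>
  The derivative of a piecewise \<open>C\<^sup>1\<close> curve has one-sided limits at the break points \<open>S\<close>. The
  library's \<open>piecewise_C1_differentiable_on\<close> does not ask for this and allows curves
  of infinite length.
\<close>

definition piecewise_C1_curve ::
  "('a::topological_space, 'e::euclidean_space) chart set \<Rightarrow> (real \<Rightarrow> 'a) \<Rightarrow> bool" where
  "piecewise_C1_curve \<A> \<gamma> \<longleftrightarrow>
     (\<exists>S. finite S \<and> {0, 1} \<subseteq> S \<and> S \<subseteq> {0..1} \<and>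
        (\<forall>a\<in>S. \<forall>b\<in>S. a < b \<and> {a<..<b} \<inter> S = {} \<longrightarrow> C1_curve \<A> a b \<gamma>))"

text \<open>
  The speed does not depend on the chart that is chosen at \<open>\<gamma> t\<close>. It has no meaning at the
  break points, which do not contribute to the integral.
\<close>

definition chart_at :: "('a, 'e) chart set \<Rightarrow> 'a \<Rightarrow> ('a, 'e) chart" where
  "chart_at \<A> x = (SOME c. c \<in> \<A> \<and> x \<in> fst c)"

definition curve_speed ::
  "('a, 'e::euclidean_space) chart set \<Rightarrow> (('a, 'e) chart \<Rightarrow> 'a \<Rightarrow> 'e \<Rightarrow> 'e \<Rightarrow> real)
     \<Rightarrow> (real \<Rightarrow> 'a) \<Rightarrow> real \<Rightarrow> real" where
  "curve_speed \<A> g \<gamma> t =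
     (let c = chart_at \<A> (\<gamma> t);
          v = vector_derivative (snd c \<circ> \<gamma>) (at t within {0..1})
      in sqrt (g c (\<gamma> t) v v))"

definition curve_length ::
  "('a, 'e::euclidean_space) chart set \<Rightarrow> (('a, 'e) chart \<Rightarrow> 'a \<Rightarrow> 'e \<Rightarrow> 'e \<Rightarrow> real)
     \<Rightarrow> (real \<Rightarrow> 'a) \<Rightarrow> real" where
  "curve_length \<A> g \<gamma> = integral {0..1} (curve_speed \<A> g \<gamma>)"

definition curves_between ::
  "('a::topological_space, 'e::euclidean_space) chart set \<Rightarrow> 'a \<Rightarrow> 'a \<Rightarrow> (real \<Rightarrow> 'a) set" where
  "curves_between \<A> x y = {\<gamma>. piecewise_C1_curve \<A> \<gamma> \<and> \<gamma> 0 = x \<and> \<gamma> 1 = y}"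

text \<open>
  The manifold is the whole type \<open>'a\<close>, and its topology is the metric topology. If it is
  connected, then \<open>dist\<close> is the Riemannian distance. In general \<open>dist\<close> is the Riemannian
  distance on each connected component, and the distances between different components
  (where the Riemannian distance is infinite) are unconstrained.
\<close>

definition compact_riemannian_manifold ::
  "('a::metric_space, 'e::euclidean_space) chart set
     \<Rightarrow> (('a, 'e) chart \<Rightarrow> 'a \<Rightarrow> 'e \<Rightarrow> 'e \<Rightarrow> real) \<Rightarrow> bool" where
  "compact_riemannian_manifold \<A> g \<longleftrightarrow>
     compact (UNIV :: 'a set) \<and> smooth_atlas \<A> \<and> riemannian_metric \<A> g \<and>
     (\<forall>x y. curves_between \<A> x y \<noteq> {} \<longrightarrow>
        dist x y = (INF \<gamma>\<in>curves_between \<A> x y. curve_length \<A> g \<gamma>))"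

definition metric_mps :: "'a::metric_space measure \<Rightarrow> ('a \<Rightarrow> 'a) \<Rightarrow> bool" where
  "metric_mps \<mu> T \<longleftrightarrow>
     prob_space \<mu> \<and> sets \<mu> = sets borel \<and> T \<in> measurable \<mu> \<mu> \<and>
     (\<forall>A\<in>sets \<mu>. measure \<mu> (T -` A) = measure \<mu> A)"

text \<open>
  The ball of this radius has measure at most \<open>M k\<close>. Equality can fail if a sphere around \<open>x\<close> has
  positive measure, so \<open>expected_count\<close> below sums the measures of the balls, not the numbers \<open>M k\<close>.
\<close>

definition hit_radius ::
  "'a::metric_space measure \<Rightarrow> (nat \<Rightarrow> real) \<Rightarrow> nat \<Rightarrow> 'a \<Rightarrow> real" where
  "hit_radius \<mu> M k x = Inf {r. 0 \<le> r \<and> M k \<le> measure \<mu> (ball x r)}"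

definition return_set ::
  "'a::metric_space measure \<Rightarrow> ('a \<Rightarrow> 'a) \<Rightarrow> (nat \<Rightarrow> real) \<Rightarrow> nat \<Rightarrow> 'a set" where
  "return_set \<mu> T M k = {x. (T ^^ k) x \<in> ball x (hit_radius \<mu> M k x)}"

definition return_count ::
  "'a::metric_space measure \<Rightarrow> ('a \<Rightarrow> 'a) \<Rightarrow> (nat \<Rightarrow> real) \<Rightarrow> 'a \<Rightarrow> nat \<Rightarrow> real" where
  "return_count \<mu> T M x n =
     (\<Sum>k=1..n. indicator (ball x (hit_radius \<mu> M k x)) ((T ^^ k) x))"

definition expected_count ::
  "'a::metric_space measure \<Rightarrow> (nat \<Rightarrow> real) \<Rightarrow> 'a \<Rightarrow> nat \<Rightarrow> real" where
  "expected_count \<mu> M x n = (\<Sum>k=1..n. measure \<mu> (ball x (hit_radius \<mu> M k x)))"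

definition lipschitz_fun :: "('a::metric_space \<Rightarrow> real) \<Rightarrow> bool" where
  "lipschitz_fun f \<longleftrightarrow> (\<exists>L. L-lipschitz_on UNIV f)"

text \<open>The element \<open>0\<close> only matters for a one-point space, where the supremum is empty.\<close>

definition lip_seminorm :: "('a::metric_space \<Rightarrow> real) \<Rightarrow> real" where
  "lip_seminorm f = Sup (insert 0 {dist (f x) (f y) / dist x y | x y. x \<noteq> y})"

definition lip_norm :: "('a::metric_space \<Rightarrow> real) \<Rightarrow> real" where
  "lip_norm f = (SUP x. \<bar>f x\<bar>) + lip_seminorm f"

definition threefold_decorrelation :: "'a::metric_space measure \<Rightarrow> ('a \<Rightarrow> 'a) \<Rightarrow> bool" where
  "threefold_decorrelation \<mu> T \<longleftrightarrow>
     (\<exists>C>0. \<exists>\<tau>>0. \<exists>\<sigma>\<in>{0<..1}. \<forall>\<phi>1 \<phi>2 \<phi>3.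
        (\<forall>\<phi>\<in>{\<phi>1, \<phi>2, \<phi>3}. lipschitz_fun \<phi> \<and> (\<forall>x. 0 \<le> \<phi> x)) \<longrightarrow>
        (\<forall>k>0. \<forall>l>0.
           \<bar>(\<integral>x. \<phi>1 x * \<phi>2 ((T ^^ k) x) * \<phi>3 ((T ^^ (k + l)) x) \<partial>\<mu>)
              - (\<integral>x. \<phi>1 x \<partial>\<mu>) * (\<integral>x. \<phi>2 x \<partial>\<mu>) * (\<integral>x. \<phi>3 x \<partial>\<mu>)\<bar>
           \<le> C * lip_norm \<phi>1 * lip_norm \<phi>2 * lip_norm \<phi>3 * exp (- \<tau> * real (min k l))) \<and>
        (\<forall>k>0. \<forall>l>0. real k \<le> \<sigma> * real l \<longrightarrow>
           \<bar>(\<integral>x. \<phi>1 x * \<phi>2 ((T ^^ k) x) * \<phi>3 ((T ^^ (k + l)) x) \<partial>\<mu>)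
              - (\<integral>x. \<phi>1 x * \<phi>2 ((T ^^ k) x) \<partial>\<mu>) * (\<integral>x. \<phi>3 x \<partial>\<mu>)\<bar>
           \<le> C * lip_norm \<phi>1 * lip_norm \<phi>2 * lip_norm \<phi>3 * exp (- \<tau> * real l)))"

text \<open>The constants \<open>\<delta>\<close> and \<open>N\<close> are parameters because the decay of \<open>M\<close> refers to them.\<close>

definition short_return_times ::
  "'a::metric_space measure \<Rightarrow> ('a \<Rightarrow> 'a) \<Rightarrow> (nat \<Rightarrow> real) \<Rightarrow> real \<Rightarrow> real \<Rightarrow> bool" where
  "short_return_times \<mu> T M \<delta> N \<longleftrightarrow>
     \<delta> > 0 \<and> N > 0 \<and>
     (\<exists>C>0. \<exists>\<psi> :: nat \<Rightarrow> real. (\<forall>l. 0 \<le> \<psi> l) \<and> summable \<psi> \<and>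
        (\<forall>k>0. \<forall>l>0.
           measure \<mu> (return_set \<mu> T M k \<inter> return_set \<mu> T M (k + l))
           \<le> C * measure \<mu> (return_set \<mu> T M k) powr (1 + \<delta>) * ln (real k) powr N
              + measure \<mu> (return_set \<mu> T M k) * \<psi> l))"

definition frostman :: "'a::metric_space measure \<Rightarrow> bool" where
  "frostman \<mu> \<longleftrightarrow>
     (\<exists>C>0. \<exists>s>0. \<exists>\<rho>>0. \<forall>x r. 0 < r \<and> r < \<rho> \<longrightarrow> measure \<mu> (ball x r) \<le> C * r powr s)"

definition thin_annuli :: "'a::metric_space measure \<Rightarrow> bool" where
  "thin_annuli \<mu> \<longleftrightarrow>
     (\<exists>C>0. \<exists>\<alpha>>0. \<exists>r0>0. \<forall>x r \<epsilon>. 0 < \<epsilon> \<and> \<epsilon> \<le> r \<and> r \<le> r0 \<longrightarrow>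
        measure \<mu> (ball x (r + \<epsilon>) - ball x r) \<le> C * \<epsilon> powr \<alpha>)"

end

theory Submission
  imports Defs "HOL-Real_Asymp.Real_Asymp"
begin

text \<open>
  Write \<open>E\<^sub>k\<close> for the set of points that return at time \<open>k\<close>. The theorem is a strong law for the
  indicators of these dependent events. It comes from a second moment bound on all blocks of times,
  \<open>\<integral> (\<Sum>\<^bsub>i<k\<le>n\<^esub> (1\<^bsub>E\<^sub>k\<^esub> - M\<^sub>k))\<^sup>2 \<le> K \<Sum>\<^bsub>i<k\<le>n\<^esub> \<phi>\<^sub>k\<close> with \<open>\<phi>\<^sub>k = M\<^sub>k + 1/k\<^sup>2\<close>
  (\<open>centered_indicator_second_moment\<close>), by the dyadic chaining argument of Gal and Koksma
  (\<open>quantitative_borel_cantelli\<close>). The summable term \<open>1/k\<^sup>2\<close> changes the normalisation only by a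
  bounded amount, and it leaves room for errors that are small compared with \<open>1/k\<^sup>2\<close> but not with
  \<open>M\<^sub>k\<close>. If \<open>\<Sum> M\<^sub>k\<close> converges, the first Borel-Cantelli lemma gives the claim.

  For the covariance of \<open>E\<^sub>k\<close> and \<open>E\<^bsub>k+l\<^esub>\<close> there are two regimes (\<open>recurrence_covariance_bound\<close>).
  If \<open>l\<close> is at most a constant times \<open>ln k\<close>, the short return times are used. There the decay of
  \<open>M\<close> gives \<open>\<mu>(E\<^sub>k)\<^sup>\<delta> (ln k)\<^sup>N = O((ln k)\<^sup>-\<^sup>2) = O(l\<^sup>-\<^sup>2)\<close>, so that the contribution of all such \<open>l\<close> is
  \<open>O(\<mu>(E\<^sub>k))\<close>. For larger \<open>l\<close> the bound
  \<open>\<mu>(E\<^sub>k \<inter> E\<^bsub>k+l\<^esub>) \<le> M\<^sub>k M\<^bsub>k+l\<^esub> + B exp(-\<eta> k) M\<^bsub>k+l\<^esub> + B exp(-\<eta> l)\<close> (\<open>hit_pair_decay\<close>) is used, where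
  \<open>exp(-\<eta> l) \<le> k\<^sup>-\<^sup>2 exp(-\<eta> l / 2)\<close>.

  This last bound is where the dynamics enters. The condition \<open>dist x (T\<^sup>k x) < r(x)\<close> does not
  separate the variables \<open>x\<close> and \<open>T\<^sup>k x\<close>. A partition of unity at scale \<open>\<rho>\<close> confines \<open>x\<close> to a ball of
  radius \<open>2\<rho>\<close>, where \<open>r\<close> is almost constant since it is \<open>1\<close>-Lipschitz, and a Lipschitz ramp around the
  centre of that ball replaces the indicator of \<open>ball x (r x)\<close>. Each of the resulting products is
  covered by the decorrelation assumption. The cost is polynomial in \<open>1/\<rho>\<close>: the number of balls, by
  \<open>compact_riemannian_manifold_covering\<close>, and the Lipschitz norms. The gain is a power of \<open>\<rho>\<close>: the
  measure of thin annuli (\<open>annulus_measure_le\<close>). With \<open>\<rho> = exp(-\<theta> t)\<close> for small \<open>\<theta>\<close> all errors decay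
  exponentially in the time gap \<open>t\<close>. If \<open>k\<close> is much smaller than \<open>l\<close>, full decorrelation would leave an
  error \<open>exp(-\<tau> k)\<close>, which is not summable over \<open>l\<close>. In that case only the last factor is split off,
  at the scale of \<open>l\<close>, and the pair at times \<open>0\<close> and \<open>k\<close> is treated afterwards at the coarser scale of \<open>k\<close>.
\<close>

section \<open>Covering numbers of compact Riemannian manifolds\<close>

text \<open>
  A cubical grid of mesh proportional to \<open>\<rho>\<close> in Euclidean space pulls back to a cover of \<open>V\<close>: points in
  the same cell are \<open>\<rho>\<close>-close, so one point from each nonempty cell will do.
\<close>

lemma euclidean_chart_covering:
  fixes f :: "'a::metric_space \<Rightarrow> 'e::euclidean_space"
  assumes bd: "\<And>x. x \<in> V \<Longrightarrow> norm (f x) \<le> e" and "0 \<le> L"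
    and lip: "\<And>x y. x \<in> V \<Longrightarrow> y \<in> V \<Longrightarrow> dist x y \<le> L * norm (f x - f y)"
  shows "\<exists>K>0. \<forall>\<rho>\<in>{0<..1}. \<exists>F. finite F \<and> V \<subseteq> (\<Union>c\<in>F. ball c \<rho>)
           \<and> real (card F) \<le> K * (1 / \<rho>) ^ DIM('e)"
proof (cases "V = {}")
  case True
  then show ?thesis
    by (intro exI[of _ 1]) (auto intro!: exI[of _ "{}"])
next
  case False
  then have e0: "0 \<le> e" using bd norm_ge_zero order_trans by blast
  define D where "D = DIM('e)"
  define a where "a = 2 * L * real D + 1"
  have a: "a \<ge> 1" using \<open>0 \<le> L\<close> by (simp add: a_def)
  define K where "K = (2 * (e * a) + 5) ^ D"
  have "\<exists>F. finite F \<and> V \<subseteq> (\<Union>c\<in>F. ball c \<rho>) \<and> real (card F) \<le> K * (1 / \<rho>) ^ D"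
    if \<rho>: "0 < \<rho>" "\<rho> \<le> 1" for \<rho>
  proof -
    define h where "h = \<rho> / a"
    have h: "h > 0" using \<rho> a by (simp add: h_def)
    \<comment> \<open>the cell of the grid of mesh \<open>h\<close> that contains \<open>f x\<close>\<close>
    define z where "z x = (\<lambda>b\<in>(Basis::'e set). \<lfloor>(f x \<bullet> b) / h\<rfloor>)" for x
    define m where "m = \<lceil>e / h\<rceil> + 1"
    have zm: "z x \<in> (Basis::'e set) \<rightarrow>\<^sub>E {-m..m}" if "x \<in> V" for x
    proof (rule PiE_I)
      fix b :: 'e assume b: "b \<in> Basis"
      have "\<bar>f x \<bullet> b\<bar> \<le> e"
        using Basis_le_norm[OF b, of "f x"] bd[OF that] by linarith
      then have "\<bar>(f x \<bullet> b) / h\<bar> \<le> e / h" using h by (simp add: divide_right_mono)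
      then have "- (e / h) \<le> (f x \<bullet> b) / h" "(f x \<bullet> b) / h \<le> e / h" by linarith+
      then have "- m \<le> \<lfloor>(f x \<bullet> b) / h\<rfloor>" "\<lfloor>(f x \<bullet> b) / h\<rfloor> \<le> m"
        unfolding m_def by linarith+
      then show "z x b \<in> {-m..m}" using b by (simp add: z_def)
    qed (auto simp: z_def)
    have close: "dist x y < \<rho>" if "x \<in> V" "y \<in> V" "z x = z y" for x y
    proof -
      have c: "\<bar>(f x - f y) \<bullet> b\<bar> \<le> h" if b: "b \<in> Basis" for b
      proof -
        have "\<lfloor>(f x \<bullet> b) / h\<rfloor> = \<lfloor>(f y \<bullet> b) / h\<rfloor>"
          using fun_cong[OF \<open>z x = z y\<close>, of b] b by (simp add: z_def)
        then have "\<bar>(f x \<bullet> b) / h - (f y \<bullet> b) / h\<bar> \<le> 1" by linarith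
        then show ?thesis using h
          by (simp add: inner_diff_left diff_divide_distrib[symmetric] pos_divide_le_eq)
      qed
      have "norm (f x - f y) \<le> (\<Sum>b\<in>Basis. \<bar>(f x - f y) \<bullet> b\<bar>)" by (rule norm_le_l1)
      also have "\<dots> \<le> real D * h" using sum_bounded_above[OF c] by (simp add: D_def)
      finally have "dist x y \<le> L * (real D * h)"
        using lip[OF that(1,2)] mult_left_mono[OF _ \<open>0 \<le> L\<close>] by force
      also have "\<dots> < a * h"
      proof -
        have "0 \<le> L * real D" using \<open>0 \<le> L\<close> by simp
        then have "L * real D < a" by (simp add: a_def)
        then have "L * real D * h < a * h" using h by (intro mult_strict_right_mono)
        then show ?thesis by (simp add: mult.assoc)
      qed
      also have "a * h = \<rho>" using a by (simp add: h_def)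
      finally show ?thesis .
    qed
    define F where "F = (\<lambda>w. SOME x. x \<in> V \<and> z x = w) ` (z ` V)"
    have fz: "finite (z ` V)" and cz: "card (z ` V) \<le> card ((Basis::'e set) \<rightarrow>\<^sub>E {-m..m})"
      using zm by (auto intro!: finite_subset[of "z ` V" "(Basis::'e set) \<rightarrow>\<^sub>E {-m..m}"]
        card_mono finite_PiE)
    have "0 \<le> e / h" using e0 h by simp
    then have mpos: "m \<ge> 0" unfolding m_def by linarith
    have "real (card F) \<le> real (card ((Basis::'e set) \<rightarrow>\<^sub>E {-m..m}))"
      using card_image_le[OF fz, of "\<lambda>w. SOME x. x \<in> V \<and> z x = w"] cz
      unfolding F_def by linarith
    also have "\<dots> = (2 * real_of_int m + 1) ^ D"
      using mpos by (simp add: card_PiE D_def)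
    also have "\<dots> \<le> ((2 * (e * a) + 5) / \<rho>) ^ D"
    proof (rule power_mono)
      have "real_of_int m \<le> e / h + 2" unfolding m_def by linarith
      also have "e / h = e * a / \<rho>" by (simp add: h_def)
      finally have "2 * real_of_int m + 1 \<le> 2 * (e * a / \<rho>) + 5" by simp
      also have "\<dots> \<le> 2 * (e * a / \<rho>) + 5 / \<rho>" using \<rho> by (simp add: field_simps)
      finally show "2 * real_of_int m + 1 \<le> (2 * (e * a) + 5) / \<rho>" by (simp add: add_divide_distrib)
    qed (use mpos in simp)
    also have "\<dots> = K * (1 / \<rho>) ^ D" by (simp add: K_def power_divide)
    finally have card: "real (card F) \<le> K * (1 / \<rho>) ^ D" .
    have "V \<subseteq> (\<Union>c\<in>F. ball c \<rho>)"
    proof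
      fix x assume x: "x \<in> V"
      let ?c = "SOME y. y \<in> V \<and> z y = z x"
      have "?c \<in> V \<and> z ?c = z x" by (rule someI[of _ x]) (use x in simp)
      then have "dist ?c x < \<rho>" using close x by blast
      then show "x \<in> (\<Union>c\<in>F. ball c \<rho>)" using x by (auto simp: F_def)
    qed
    then show ?thesis using card fz F_def by blast
  qed
  moreover have "K > 0" using e0 a by (simp add: K_def add_nonneg_pos)
  ultimately show ?thesis unfolding D_def by (intro exI[of _ K]) auto
qed

lemma smooth_on_imp_continuous_on: "smooth_on U f \<Longrightarrow> continuous_on U f"
  by (metis smooth_on_def Ck_on.simps(1))

lemma smooth_onD:
  assumes "smooth_on U f"
  shows "f differentiable_on U" "continuous_on U (\<lambda>x. frechet_derivative f (at x) v)"
proof -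
  have "Ck_on (Suc 0) U f" using assms unfolding smooth_on_def by blast
  then show "f differentiable_on U" "continuous_on U (\<lambda>x. frechet_derivative f (at x) v)"
    by simp_all
qed

lemma chart_at:
  assumes "smooth_atlas \<A>"
  shows "chart_at \<A> x \<in> \<A> \<and> x \<in> fst (chart_at \<A> x)"
proof -
  have "x \<in> (\<Union>(U, \<phi>)\<in>\<A>. U)" using assms by (simp add: smooth_atlas_def)
  then obtain c where "c \<in> \<A>" "x \<in> fst c" by (auto simp: case_prod_unfold)
  then show ?thesis
    using someI[of "\<lambda>c. c \<in> \<A> \<and> x \<in> fst c" c] by (simp add: chart_at_def)
qed

lemma riemannian_metric_pos:
  assumes "riemannian_metric \<A> g" "(U, \<phi>) \<in> \<A>" "x \<in> U"
  shows "bilinear (g (U, \<phi>) x)" "v \<noteq> 0 \<Longrightarrow> g (U, \<phi>) x v v > 0"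
proof -
  have "\<forall>(U, \<phi>)\<in>\<A>. \<forall>x\<in>U. bilinear (g (U, \<phi>) x) \<and>
        (\<forall>v w. g (U, \<phi>) x v w = g (U, \<phi>) x w v) \<and> (\<forall>v. v \<noteq> 0 \<longrightarrow> g (U, \<phi>) x v v > 0)"
    using assms(1) unfolding riemannian_metric_def by (rule conjunct1)
  from bspec[OF this assms(2)]
  show "bilinear (g (U, \<phi>) x)" "v \<noteq> 0 \<Longrightarrow> g (U, \<phi>) x v v > 0" using assms(3) by simp_all
qed

lemma riemannian_metric_smooth:
  assumes "riemannian_metric \<A> g" "(U, \<phi>) \<in> \<A>"
  shows "smooth_on (\<phi> ` U) (\<lambda>p. g (U, \<phi>) (inv_into U \<phi> p) v w)"
proof -
  have "\<forall>(U, \<phi>)\<in>\<A>. \<forall>v w. smooth_on (\<phi> ` U) (\<lambda>p. g (U, \<phi>) (inv_into U \<phi> p) v w)"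
    using assms(1) unfolding riemannian_metric_def by (elim conjE)
  from bspec[OF this assms(2)] show ?thesis by simp
qed

lemma riemannian_metric_transform:
  assumes "riemannian_metric \<A> g" "(U, \<phi>) \<in> \<A>" "(V, \<psi>) \<in> \<A>" "x \<in> U" "x \<in> V"
  shows "g (U, \<phi>) x v w =
        g (V, \<psi>) x (frechet_derivative (\<psi> \<circ> inv_into U \<phi>) (at (\<phi> x)) v)
                 (frechet_derivative (\<psi> \<circ> inv_into U \<phi>) (at (\<phi> x)) w)"
proof -
  have "\<forall>(U, \<phi>)\<in>\<A>. \<forall>(V, \<psi>)\<in>\<A>. \<forall>x\<in>U \<inter> V. \<forall>v w.
        g (U, \<phi>) x v w =
        g (V, \<psi>) x (frechet_derivative (\<psi> \<circ> inv_into U \<phi>) (at (\<phi> x)) v)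
                 (frechet_derivative (\<psi> \<circ> inv_into U \<phi>) (at (\<phi> x)) w)"
    using assms(1) unfolding riemannian_metric_def by (elim conjE)
  from bspec[OF this assms(2)]
  have "\<forall>(V, \<psi>)\<in>\<A>. \<forall>x\<in>U \<inter> V. \<forall>v w.
        g (U, \<phi>) x v w =
        g (V, \<psi>) x (frechet_derivative (\<psi> \<circ> inv_into U \<phi>) (at (\<phi> x)) v)
                 (frechet_derivative (\<psi> \<circ> inv_into U \<phi>) (at (\<phi> x)) w)" by simp
  from bspec[OF this assms(3)] show ?thesis using assms(4,5) by simp
qed

lemma smooth_atlas_chart:
  assumes "smooth_atlas \<A>" "(U, \<phi>) \<in> \<A>"
  shows "open U" "open (\<phi> ` U)" "homeomorphism U (\<phi> ` U) \<phi> (inv_into U \<phi>)"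
proof -
  have "\<forall>(U, \<phi>)\<in>\<A>. open U \<and> open (\<phi> ` U) \<and> homeomorphism U (\<phi> ` U) \<phi> (inv_into U \<phi>)"
    using assms(1) unfolding smooth_atlas_def by (elim conjE)
  from bspec[OF this assms(2)]
  show "open U" "open (\<phi> ` U)" "homeomorphism U (\<phi> ` U) \<phi> (inv_into U \<phi>)" by simp_all
qed

lemma smooth_atlas_transition:
  assumes "smooth_atlas \<A>" "(U, \<phi>) \<in> \<A>" "(V, \<psi>) \<in> \<A>"
  shows "open (\<phi> ` (U \<inter> V))" "smooth_on (\<phi> ` (U \<inter> V)) (\<psi> \<circ> inv_into U \<phi>)"
proof -
  have "\<forall>(U, \<phi>)\<in>\<A>. \<forall>(V, \<psi>)\<in>\<A>. smooth_on (\<phi> ` (U \<inter> V)) (\<psi> \<circ> inv_into U \<phi>)"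
    using assms(1) unfolding smooth_atlas_def by (elim conjE)
  from bspec[OF this assms(2)]
  have "\<forall>(V, \<psi>)\<in>\<A>. smooth_on (\<phi> ` (U \<inter> V)) (\<psi> \<circ> inv_into U \<phi>)" by simp
  from bspec[OF this assms(3)]
  show "smooth_on (\<phi> ` (U \<inter> V)) (\<psi> \<circ> inv_into U \<phi>)" by simp
  have "openin (top_of_set U) (U \<inter> V)"
    using smooth_atlas_chart(1)[OF assms(1,3)] by (simp add: openin_open_Int)
  from homeomorphism_imp_open_map[OF smooth_atlas_chart(3)[OF assms(1,2)] this]
  show "open (\<phi> ` (U \<inter> V))"
    using smooth_atlas_chart(2)[OF assms(1,2)] openin_open_trans by blast
qed

text \<open>
  This makes the infimum over curves bounded below. A curve whose speed is not integrable has length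
  \<open>0\<close> by the convention for integrals, which is harmless because only upper bounds for lengths are used.
\<close>

lemma curve_length_nonneg:
  assumes "smooth_atlas \<A>" "riemannian_metric \<A> g"
  shows "0 \<le> curve_length \<A> g \<gamma>"
proof -
  have "0 \<le> curve_speed \<A> g \<gamma> t" for t
  proof -
    let ?c = "chart_at \<A> (\<gamma> t)"
    have c: "?c \<in> \<A>" "\<gamma> t \<in> fst ?c"
      using chart_at[OF assms(1)] by blast+
    have b: "bilinear (g ?c (\<gamma> t))" and p: "\<And>v. v \<noteq> 0 \<Longrightarrow> g ?c (\<gamma> t) v v > 0"
      using riemannian_metric_pos[OF assms(2), of "fst ?c" "snd ?c"] c by simp_all
    have "0 \<le> g ?c (\<gamma> t) v v" for v
      using p[of v] bilinear_lzero[OF b, of 0] by (cases "v = 0") auto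
    then show ?thesis by (simp add: curve_speed_def Let_def)
  qed
  then show ?thesis unfolding curve_length_def
    by (cases "curve_speed \<A> g \<gamma> integrable_on {0..1}")
       (auto intro!: integral_nonneg simp: not_integrable_integral)
qed

lemma bilinear_quadratic_bound:
  fixes B :: "'e::euclidean_space \<Rightarrow> 'e \<Rightarrow> real"
  assumes "bilinear B"
  shows "B v v \<le> (\<Sum>b\<in>Basis. \<Sum>b'\<in>Basis. \<bar>B b b'\<bar>) * (norm v)\<^sup>2"
proof -
  have "B v v = B (\<Sum>b\<in>Basis. (v \<bullet> b) *\<^sub>R b) (\<Sum>b\<in>Basis. (v \<bullet> b) *\<^sub>R b)"
    by (simp add: euclidean_representation)
  also have "\<dots> = (\<Sum>b\<in>Basis. \<Sum>b'\<in>Basis. ((v \<bullet> b) * (v \<bullet> b')) * B b b')"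
    unfolding bilinear_sum[OF assms] sum.cartesian_product
    by (intro sum.cong) (auto simp: bilinear_lmul[OF assms] bilinear_rmul[OF assms])
  also have "\<dots> \<le> (\<Sum>b\<in>Basis. \<Sum>b'\<in>Basis. \<bar>B b b'\<bar> * (norm v)\<^sup>2)"
  proof (intro sum_mono)
    fix b b' :: 'e assume "b \<in> Basis" "b' \<in> Basis"
    then have "\<bar>v \<bullet> b\<bar> * \<bar>v \<bullet> b'\<bar> \<le> norm v * norm v"
      by (intro mult_mono Basis_le_norm) auto
    then have "\<bar>v \<bullet> b\<bar> * \<bar>v \<bullet> b'\<bar> * \<bar>B b b'\<bar> \<le> norm v * norm v * \<bar>B b b'\<bar>"
      by (rule mult_right_mono) simp
    moreover have "((v \<bullet> b) * (v \<bullet> b')) * B b b' \<le> \<bar>v \<bullet> b\<bar> * \<bar>v \<bullet> b'\<bar> * \<bar>B b b'\<bar>"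
      by (metis abs_ge_self abs_mult)
    ultimately show "((v \<bullet> b) * (v \<bullet> b')) * B b b' \<le> \<bar>B b b'\<bar> * (norm v)\<^sup>2"
      by (simp add: power2_eq_square mult.commute)
  qed
  finally show ?thesis by (simp add: sum_distrib_right)
qed

lemma riemannian_dist_le:
  assumes M: "compact_riemannian_manifold \<A> g" and c: "\<gamma> \<in> curves_between \<A> x y"
    and len: "curve_length \<A> g \<gamma> \<le> l"
  shows "dist x y \<le> l"
proof -
  have sm: "smooth_atlas \<A>" "riemannian_metric \<A> g"
    and d: "dist x y = (INF \<gamma>\<in>curves_between \<A> x y. curve_length \<A> g \<gamma>)"
    using M c unfolding compact_riemannian_manifold_def by blast+
  note d
  also have "\<dots> \<le> curve_length \<A> g \<gamma>"
    using c curve_length_nonneg[OF sm] by (intro cINF_lower bdd_belowI2[of _ 0]) auto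
  finally show ?thesis using len by simp
qed

text \<open>
  In each chart the velocity of a coordinate segment is the image of \<open>b - a\<close> under the derivative of
  the transition map. This is the transformation law of tangent vectors, so the speed of the curve can
  be computed in the chart that defines it.
\<close>

lemma chart_segment:
  fixes a b :: "'e::euclidean_space"
  assumes A: "smooth_atlas \<A>" and UA: "(U, \<phi>) \<in> \<A>" and VA: "(V, \<psi>) \<in> \<A>"
    and seg: "closed_segment a b \<subseteq> \<phi> ` U"
  defines "\<gamma> \<equiv> inv_into U \<phi> \<circ> (\<lambda>t. a + t *\<^sub>R (b - a))"
  assumes t: "t \<in> {0..1}" "\<gamma> t \<in> V"
  shows "((\<psi> \<circ> \<gamma>) has_vector_derivative
      frechet_derivative (\<psi> \<circ> inv_into U \<phi>) (at (\<phi> (\<gamma> t))) (b - a)) (at t within {0..1})"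
    and "\<gamma> t \<in> U" and "\<phi> (\<gamma> t) = a + t *\<^sub>R (b - a)"
proof -
  have "a + t *\<^sub>R (b - a) \<in> closed_segment a b"
    using t(1) by (auto simp: closed_segment_def algebra_simps intro!: exI[of _ t])
  then have im: "a + t *\<^sub>R (b - a) \<in> \<phi> ` U" using seg by blast
  show U: "\<gamma> t \<in> U" unfolding \<gamma>_def using im by (simp add: inv_into_into)
  show eq: "\<phi> (\<gamma> t) = a + t *\<^sub>R (b - a)"
    unfolding \<gamma>_def using im by (simp add: f_inv_into_f)
  have "\<phi> (\<gamma> t) \<in> \<phi> ` (U \<inter> V)" using U t(2) by blast
  then have "(\<psi> \<circ> inv_into U \<phi>) differentiable (at (\<phi> (\<gamma> t)))"
    using smooth_onD(1)[OF smooth_atlas_transition(2)[OF A UA VA]]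
      smooth_atlas_transition(1)[OF A UA VA] differentiable_on_eq_differentiable_at by blast
  then have d: "((\<psi> \<circ> inv_into U \<phi>) has_derivative
      frechet_derivative (\<psi> \<circ> inv_into U \<phi>) (at (\<phi> (\<gamma> t)))) (at (\<phi> (\<gamma> t)))"
    by (simp add: frechet_derivative_works)
  have l: "((\<lambda>t. a + t *\<^sub>R (b - a)) has_vector_derivative (b - a)) (at t within {0..1})"
    by (auto intro!: derivative_eq_intros)
  show "((\<psi> \<circ> \<gamma>) has_vector_derivative
      frechet_derivative (\<psi> \<circ> inv_into U \<phi>) (at (\<phi> (\<gamma> t))) (b - a)) (at t within {0..1})"
    using vector_derivative_diff_chain_within[OF l has_derivative_at_withinI[OF d[unfolded eq]]]
    unfolding eq unfolding \<gamma>_def by (simp only: o_assoc)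
qed

text \<open>
  The preimage of a straight segment is an admissible curve, and its speed is at most \<open>L\<close> times the
  length of the segment.
\<close>

lemma chart_dist_le:
  fixes a b :: "'e::euclidean_space"
  assumes M: "compact_riemannian_manifold \<A> g" and UA: "(U, \<phi>) \<in> \<A>"
    and seg: "closed_segment a b \<subseteq> \<phi> ` U" and L: "0 \<le> L"
    and bd: "\<And>z v. z \<in> closed_segment a b \<Longrightarrow> g (U, \<phi>) (inv_into U \<phi> z) v v \<le> L\<^sup>2 * (norm v)\<^sup>2"
  shows "dist (inv_into U \<phi> a) (inv_into U \<phi> b) \<le> L * norm (b - a)"
proof -
  have A: "smooth_atlas \<A>" and R: "riemannian_metric \<A> g"
    using M unfolding compact_riemannian_manifold_def by blast+
  define \<gamma> where "\<gamma> = inv_into U \<phi> \<circ> (\<lambda>t. a + t *\<^sub>R (b - a))"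
  define l where "l = (\<lambda>t. a + t *\<^sub>R (b - a))"
  have lseg: "l t \<in> closed_segment a b" if "t \<in> {0..1}" for t
    using that by (auto simp: closed_segment_def algebra_simps l_def intro!: exI[of _ t])
  have conti: "continuous_on (\<phi> ` U) (inv_into U \<phi>)"
    using smooth_atlas_chart(3)[OF A UA] by (simp add: homeomorphism_def)
  have contl: "continuous_on S l" for S unfolding l_def by (intro continuous_intros)
  have "C1_curve \<A> 0 1 \<gamma>"
    unfolding C1_curve_def
  proof (intro conjI ballI)
    have "l ` {0..1} \<subseteq> \<phi> ` U" using lseg seg by blast
    then have "continuous_on (l ` {0..1}) (inv_into U \<phi>)"
      using conti continuous_on_subset by blast
    from continuous_on_compose[OF contl this]
    show "continuous_on {0..1} \<gamma>" by (simp add: \<gamma>_def l_def)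
  next
    fix c assume "c \<in> \<A>"
    obtain V \<psi> where c: "c = (V, \<psi>)" by (cases c)
    have VA: "(V, \<psi>) \<in> \<A>" using \<open>c \<in> \<A>\<close> c by simp
    let ?D = "\<lambda>t. frechet_derivative (\<psi> \<circ> inv_into U \<phi>) (at (l t)) (b - a)"
    have "\<exists>D. continuous_on {t \<in> {0..1}. \<gamma> t \<in> V} D \<and>
        (\<forall>t\<in>{0..1}. \<gamma> t \<in> V \<longrightarrow> ((\<psi> \<circ> \<gamma>) has_vector_derivative D t) (at t within {0..1}))"
    proof (intro exI[of _ ?D] conjI ballI impI)
      have "l t \<in> \<phi> ` (U \<inter> V)" if "t \<in> {0..1}" "\<gamma> t \<in> V" for t
      proof (rule image_eqI[of _ \<phi> "\<gamma> t"])
        note s = chart_segment(2,3)[OF A UA VA seg that(1), folded \<gamma>_def, OF that(2)]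
        show "l t = \<phi> (\<gamma> t)" using s(2) by (simp add: l_def)
        show "\<gamma> t \<in> U \<inter> V" using s(1) that(2) by simp
      qed
      then have "l ` {t \<in> {0..1}. \<gamma> t \<in> V} \<subseteq> \<phi> ` (U \<inter> V)" by blast
      then have "continuous_on (l ` {t \<in> {0..1}. \<gamma> t \<in> V})
          (\<lambda>z. frechet_derivative (\<psi> \<circ> inv_into U \<phi>) (at z) (b - a))"
        using smooth_onD(2)[OF smooth_atlas_transition(2)[OF A UA VA]] continuous_on_subset
        by blast
      from continuous_on_compose[OF contl this]
      show "continuous_on {t \<in> {0..1}. \<gamma> t \<in> V} ?D" by (simp add: o_def)
    next
      fix t :: real assume t: "t \<in> {0..1}" "\<gamma> t \<in> V"
      show "((\<psi> \<circ> \<gamma>) has_vector_derivative ?D t) (at t within {0..1})"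
        using chart_segment(1)[OF A UA VA seg t(1), folded \<gamma>_def, OF t(2)]
          chart_segment(3)[OF A UA VA seg t(1), folded \<gamma>_def, OF t(2)]
        by (simp add: l_def)
    qed
    then show "case c of (U, \<phi>) \<Rightarrow> \<exists>D. continuous_on {t \<in> {0..1}. \<gamma> t \<in> U} D \<and>
        (\<forall>t\<in>{0..1}. \<gamma> t \<in> U \<longrightarrow> ((\<phi> \<circ> \<gamma>) has_vector_derivative D t) (at t within {0..1}))"
      by (simp add: c)
  qed
  then have "\<gamma> \<in> curves_between \<A> (inv_into U \<phi> a) (inv_into U \<phi> b)"
    unfolding curves_between_def piecewise_C1_curve_def
    by (auto simp: \<gamma>_def intro!: exI[of _ "{0, 1}"])
  moreover have "curve_length \<A> g \<gamma> \<le> L * norm (b - a)"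
  proof -
    have speed: "curve_speed \<A> g \<gamma> t \<le> L * norm (b - a)" if t: "t \<in> {0..1}" for t
    proof -
      obtain V \<psi> where c: "chart_at \<A> (\<gamma> t) = (V, \<psi>)" by fastforce
      have VA: "(V, \<psi>) \<in> \<A>" and tV: "\<gamma> t \<in> V" using chart_at[OF A, of "\<gamma> t"] c by auto
      note s = chart_segment[OF A UA VA seg t, folded \<gamma>_def, OF tV]
      have "vector_derivative (\<psi> \<circ> \<gamma>) (at t within {0..1})
          = frechet_derivative (\<psi> \<circ> inv_into U \<phi>) (at (\<phi> (\<gamma> t))) (b - a)"
        using vector_derivative_within_closed_interval[OF zero_less_one t s(1)] .
      then have "curve_speed \<A> g \<gamma> t = sqrt (g (U, \<phi>) (\<gamma> t) (b - a) (b - a))"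
        using riemannian_metric_transform[OF R UA VA s(2) tV, of "b - a" "b - a"]
        by (simp add: curve_speed_def Let_def c)
      also have "\<dots> \<le> sqrt (L\<^sup>2 * (norm (b - a))\<^sup>2)"
        using bd[OF lseg[OF t], of "b - a"] by (simp add: \<gamma>_def l_def)
      also have "\<dots> = L * norm (b - a)" using L by (simp add: real_sqrt_mult)
      finally show ?thesis .
    qed
    show ?thesis
    proof (cases "curve_speed \<A> g \<gamma> integrable_on {0..1}")
      case True
      have "integral {0..1} (curve_speed \<A> g \<gamma>) \<le> integral {0..1} (\<lambda>t::real. L * norm (b - a))"
        using True speed by (intro integral_le) auto
      then show ?thesis by (simp add: curve_length_def)
    next
      case False
      then show ?thesis using L by (simp add: curve_length_def not_integrable_integral)
    qed
  qed
  ultimately show ?thesis using riemannian_dist_le[OF M] by blast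
qed

text \<open>
  Around each point the metric tensor is bounded on a compact coordinate ball, so the inverse chart is
  Lipschitz there and the grid argument applies. Finitely many such neighbourhoods suffice.
\<close>

lemma compact_riemannian_manifold_covering:
  fixes \<A> :: "('a::metric_space, 'e::euclidean_space) chart set"
  assumes M: "compact_riemannian_manifold \<A> g"
  shows "\<exists>K>0. \<forall>\<rho>\<in>{0<..1}. \<exists>F::'a set. finite F \<and> (\<Union>c\<in>F. ball c \<rho>) = UNIV
           \<and> real (card F) \<le> K * (1 / \<rho>) ^ DIM('e)"
proof -
  have A: "smooth_atlas \<A>" and R: "riemannian_metric \<A> g" and cpt: "compact (UNIV :: 'a set)"
    using M unfolding compact_riemannian_manifold_def by blast+
  have loc: "\<exists>V. open V \<and> p \<in> V \<and> (\<exists>K>0. \<forall>\<rho>\<in>{0<..1}. \<exists>F. finite F \<and> V \<subseteq> (\<Union>c\<in>F. ball c \<rho>)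
           \<and> real (card F) \<le> K * (1 / \<rho>) ^ DIM('e))" for p :: 'a
  proof -
    obtain U \<phi> where UA: "(U, \<phi>) \<in> \<A>" and pU: "p \<in> U"
      using chart_at[OF A, of p] by (metis prod.collapse)
    note ch = smooth_atlas_chart[OF A UA]
    obtain e where e: "e > 0" "cball (\<phi> p) e \<subseteq> \<phi> ` U"
      using ch(2) pU open_contains_cball by blast
    have inj: "inv_into U \<phi> (\<phi> x) = x" if "x \<in> U" for x
      using ch(3) that by (simp add: homeomorphism_def)
    define V where "V = {x \<in> U. \<phi> x \<in> ball (\<phi> p) e}"
    have "continuous_on U \<phi>" using ch(3) by (simp add: homeomorphism_def)
    then have "openin (top_of_set U) (U \<inter> \<phi> -` ball (\<phi> p) e)"
      by (rule continuous_openin_preimage_gen) simp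
    moreover have "U \<inter> \<phi> -` ball (\<phi> p) e = V" by (auto simp: V_def)
    ultimately have oV: "open V" using ch(1) openin_open_trans by metis
    have pV: "p \<in> V" using pU e by (simp add: V_def)
    define G where "G z = (\<Sum>b\<in>Basis. \<Sum>b'\<in>Basis. \<bar>g (U, \<phi>) (inv_into U \<phi> z) b b'\<bar>)" for z
    have "continuous_on (\<phi> ` U) G" unfolding G_def
      by (intro continuous_intros
          smooth_on_imp_continuous_on[OF riemannian_metric_smooth[OF R UA]])
    then have "continuous_on (cball (\<phi> p) e) G" using e(2) continuous_on_subset by blast
    then have "bounded (G ` cball (\<phi> p) e)"
      by (intro compact_imp_bounded compact_continuous_image compact_cball)
    then obtain B where B: "\<And>z. z \<in> cball (\<phi> p) e \<Longrightarrow> \<bar>G z\<bar> \<le> B"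
      unfolding bounded_iff by (metis imageI real_norm_def)
    have B0: "0 \<le> B" using B[of "\<phi> p"] e by auto
    have bd: "g (U, \<phi>) (inv_into U \<phi> z) v v \<le> (sqrt B)\<^sup>2 * (norm v)\<^sup>2"
      if z: "z \<in> cball (\<phi> p) e" for z v
    proof -
      have "inv_into U \<phi> z \<in> U" using z e by (meson inv_into_into subsetD)
      then have "g (U, \<phi>) (inv_into U \<phi> z) v v \<le> G z * (norm v)\<^sup>2"
        unfolding G_def by (intro bilinear_quadratic_bound riemannian_metric_pos(1)[OF R UA])
      also have "\<dots> \<le> B * (norm v)\<^sup>2" using B[OF z] by (intro mult_right_mono) auto
      finally show ?thesis using B0 by simp
    qed
    have lip: "dist x y \<le> sqrt B * norm (\<phi> x - \<phi> y)" if "x \<in> V" "y \<in> V" for x y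
    proof -
      have "closed_segment (\<phi> y) (\<phi> x) \<subseteq> cball (\<phi> p) e"
        using that by (intro closed_segment_subset) (auto simp: V_def)
      then have "dist (inv_into U \<phi> (\<phi> y)) (inv_into U \<phi> (\<phi> x)) \<le> sqrt B * norm (\<phi> x - \<phi> y)"
        using e(2) bd B0 by (intro chart_dist_le[OF M UA]) auto
      then show ?thesis using that by (simp add: inj V_def dist_commute)
    qed
    have "norm (\<phi> x) \<le> norm (\<phi> p) + e" if "x \<in> V" for x
      using that norm_triangle_ineq2[of "\<phi> x" "\<phi> p"]
      by (simp add: V_def dist_norm norm_minus_commute)
    from euclidean_chart_covering[OF this _ lip, of V] B0
    show ?thesis using oV pV by auto
  qed
  define few where "few K V \<longleftrightarrow> K > 0 \<and> (\<forall>\<rho>\<in>{0<..1}. \<exists>F. finite F \<and> V \<subseteq> (\<Union>c\<in>F. ball c \<rho>)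
           \<and> real (card F) \<le> K * (1 / \<rho>) ^ DIM('e))" for K and V :: "'a set"
  have "\<forall>p. \<exists>V. open V \<and> p \<in> V \<and> (\<exists>K. few K V)" using loc unfolding few_def by blast
  then obtain V where V: "\<And>p. open (V p)" "\<And>p::'a. p \<in> V p" "\<And>p. \<exists>K. few K (V p)"
    by (auto dest!: choice)
  then have "\<forall>p. \<exists>K. few K (V p)" by blast
  then obtain K where "\<And>p. few (K p) (V p)" by (auto dest!: choice)
  then have K: "\<And>p. K p > 0"
    "\<And>p \<rho>. \<rho> \<in> {0<..1} \<Longrightarrow> \<exists>F. finite F \<and> V p \<subseteq> (\<Union>c\<in>F. ball c \<rho>)
           \<and> real (card F) \<le> K p * (1 / \<rho>) ^ DIM('e)"
    unfolding few_def by auto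
  obtain P where P: "finite P" "UNIV \<subseteq> (\<Union>p\<in>P. V p)"
    using compactE_image[OF cpt, of UNIV V] V(1,2) by (metis UNIV_I UN_I subsetI)
  have "\<exists>F::'a set. finite F \<and> (\<Union>c\<in>F. ball c \<rho>) = UNIV \<and> real (card F) \<le> (\<Sum>p\<in>P. K p) * (1 / \<rho>) ^ DIM('e)"
    if \<rho>: "\<rho> \<in> {0<..1}" for \<rho>
  proof -
    obtain F where F: "\<And>p. finite (F p)" "\<And>p. V p \<subseteq> (\<Union>c\<in>F p. ball c \<rho>)"
      "\<And>p. real (card (F p)) \<le> K p * (1 / \<rho>) ^ DIM('e)"
      using choice[of "\<lambda>p F. finite F \<and> V p \<subseteq> (\<Union>c\<in>F. ball c \<rho>)
           \<and> real (card F) \<le> K p * (1 / \<rho>) ^ DIM('e)"] K(2)[OF \<rho>] by blast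
    have "real (card (\<Union>p\<in>P. F p)) \<le> (\<Sum>p\<in>P. real (card (F p)))"
      using card_UN_le[OF P(1), of F] by (metis of_nat_le_iff of_nat_sum)
    also have "\<dots> \<le> (\<Sum>p\<in>P. K p) * (1 / \<rho>) ^ DIM('e)"
      unfolding sum_distrib_right by (intro sum_mono F)
    moreover have "(\<Union>c\<in>(\<Union>p\<in>P. F p). ball c \<rho>) = UNIV" using P(2) F(2) by blast
    ultimately show ?thesis using P(1) F(1) by (intro exI[of _ "\<Union>p\<in>P. F p"]) auto
  qed
  moreover have "(\<Sum>p\<in>P. K p) > 0"
    using P K(1) by (intro sum_pos) auto
  ultimately show ?thesis by (intro exI[of _ "\<Sum>p\<in>P. K p"]) auto
qed

section \<open>Lipschitz cut-offs and partitions of unity\<close>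

text \<open>
  A Lipschitz version of the indicator of \<open>ball c t\<close>: it is \<open>1\<close> on the closed ball of radius \<open>t\<close> and
  vanishes at distance \<open>t + \<rho>\<close> or more.
\<close>

definition ramp :: "real \<Rightarrow> 'a::metric_space \<Rightarrow> real \<Rightarrow> 'a \<Rightarrow> real" where
  "ramp \<rho> c t y = max 0 (min 1 ((t + \<rho> - dist c y) / \<rho>))"

lemma ramp_bounds: "0 \<le> ramp \<rho> c t y" "ramp \<rho> c t y \<le> 1"
  by (auto simp: ramp_def)

lemma ramp_eq_1: "0 < \<rho> \<Longrightarrow> dist c y \<le> t \<Longrightarrow> ramp \<rho> c t y = 1"
  by (simp add: ramp_def min_def max_def field_simps)

lemma ramp_eq_0: "0 < \<rho> \<Longrightarrow> t + \<rho> \<le> dist c y \<Longrightarrow> ramp \<rho> c t y = 0"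
  by (simp add: ramp_def min_def max_def field_simps divide_le_0_iff)

lemma ramp_lipschitz:
  assumes "0 < \<rho>"
  shows "(1 / \<rho>)-lipschitz_on UNIV (ramp \<rho> c t)"
proof (rule lipschitz_onI)
  fix x y :: 'a
  have "\<bar>ramp \<rho> c t x - ramp \<rho> c t y\<bar> \<le> \<bar>(t + \<rho> - dist c x) / \<rho> - (t + \<rho> - dist c y) / \<rho>\<bar>"
    unfolding ramp_def by (simp add: min_def max_def)
  also have "\<dots> = \<bar>dist c y - dist c x\<bar> / \<rho>"
    using assms by (simp add: diff_divide_distrib[symmetric] abs_minus_commute)
  also have "\<dots> \<le> dist x y / \<rho>"
    using assms abs_dist_diff_le[of c y x] abs_dist_diff_le[of y c x]
    by (intro divide_right_mono) (auto simp: dist_commute abs_le_iff dist_triangle2 dist_triangle3 algebra_simps intro: dist_triangle)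
  finally show "dist (ramp \<rho> c t x) (ramp \<rho> c t y) \<le> 1 / \<rho> * dist x y"
    by (simp add: dist_real_def)
qed (use assms in simp)

text \<open>
  The functions are the successive increments of the running maximum of the ramps around the centres.
  A maximum of ramps is as Lipschitz as one of them, so the increments have the constant \<open>2 / \<rho>\<close>
  however many centres there are, and no quotient has to be estimated. An increment vanishes where its
  own ramp does.
\<close>

lemma lipschitz_partition_of_unity:
  fixes F :: "'a::metric_space set"
  assumes "finite F" and \<rho>: "0 < \<rho>" and cover: "(\<Union>c\<in>F. ball c \<rho>) = UNIV"
  obtains \<phi> :: "'a \<Rightarrow> 'a \<Rightarrow> real" where
    "\<And>c. c \<in> F \<Longrightarrow> (2 / \<rho>)-lipschitz_on UNIV (\<phi> c)"
    "\<And>c x. c \<in> F \<Longrightarrow> 0 \<le> \<phi> c x"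
    "\<And>c x. c \<in> F \<Longrightarrow> \<phi> c x \<noteq> 0 \<Longrightarrow> dist c x < 2 * \<rho>"
    "\<And>x. (\<Sum>c\<in>F. \<phi> c x) = 1"
proof -
  have "\<exists>\<phi> :: 'a \<Rightarrow> 'a \<Rightarrow> real. (\<forall>c\<in>G. (2 / \<rho>)-lipschitz_on UNIV (\<phi> c) \<and>
      (\<forall>x. 0 \<le> \<phi> c x \<and> (\<phi> c x \<noteq> 0 \<longrightarrow> dist c x < 2 * \<rho>))) \<and>
      (1 / \<rho>)-lipschitz_on UNIV (\<lambda>x. \<Sum>c\<in>G. \<phi> c x) \<and>
      (\<forall>x. (\<Sum>c\<in>G. \<phi> c x) \<le> 1 \<and> (\<forall>c\<in>G. ramp \<rho> c \<rho> x \<le> (\<Sum>c\<in>G. \<phi> c x)))"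
    if "finite G" for G
    using that
  proof induction
    case empty
    show ?case using \<rho> by (auto intro!: lipschitz_onI)
  next
    case (insert a G)
    then obtain \<phi> :: "'a \<Rightarrow> 'a \<Rightarrow> real" where
      p: "\<And>c. c \<in> G \<Longrightarrow> (2 / \<rho>)-lipschitz_on UNIV (\<phi> c)"
        "\<And>c x. c \<in> G \<Longrightarrow> 0 \<le> \<phi> c x" "\<And>c x. c \<in> G \<Longrightarrow> \<phi> c x \<noteq> 0 \<Longrightarrow> dist c x < 2 * \<rho>"
      and s: "(1 / \<rho>)-lipschitz_on UNIV (\<lambda>x. \<Sum>c\<in>G. \<phi> c x)"
        "\<And>x. (\<Sum>c\<in>G. \<phi> c x) \<le> 1" "\<And>c x. c \<in> G \<Longrightarrow> ramp \<rho> c \<rho> x \<le> (\<Sum>c\<in>G. \<phi> c x)"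
      by blast
    define s where "s = (\<lambda>x. \<Sum>c\<in>G. \<phi> c x)"
    define s' where "s' = (\<lambda>x. max (s x) (ramp \<rho> a \<rho> x))"
    define \<phi>' where "\<phi>' = \<phi>(a := \<lambda>x. s' x - s x)"
    have sum': "(\<Sum>c\<in>insert a G. \<phi>' c x) = s' x" for x
    proof -
      have "(\<Sum>c\<in>G. \<phi>' c x) = s x"
        unfolding s_def \<phi>'_def using insert.hyps by (intro sum.cong) auto
      then show ?thesis using insert.hyps by (simp add: \<phi>'_def)
    qed
    have L: "(1 / \<rho>)-lipschitz_on UNIV s" using s(1) by (simp add: s_def)
    have L': "(1 / \<rho>)-lipschitz_on UNIV s'"
    proof (rule lipschitz_onI)
      fix x y :: 'a
      have "\<bar>s x - s y\<bar> \<le> 1 / \<rho> * dist x y"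
        "\<bar>ramp \<rho> a \<rho> x - ramp \<rho> a \<rho> y\<bar> \<le> 1 / \<rho> * dist x y"
        using lipschitz_onD[OF L] lipschitz_onD[OF ramp_lipschitz[OF \<rho>]]
        by (simp_all add: dist_real_def)
      then show "dist (s' x) (s' y) \<le> 1 / \<rho> * dist x y"
        unfolding s'_def dist_real_def by linarith
    qed (use \<rho> in simp)
    have "(2 / \<rho>)-lipschitz_on UNIV (\<lambda>x. s' x - s x)"
      using lipschitz_on_diff[OF L' L] by simp
    moreover have "dist a x < 2 * \<rho>" if "s' x \<noteq> s x" for x
    proof (rule ccontr)
      assume "\<not> dist a x < 2 * \<rho>"
      then have "ramp \<rho> a \<rho> x = 0" by (intro ramp_eq_0[OF \<rho>]) simp
      moreover have "0 \<le> s x" unfolding s_def using p(2) by (intro sum_nonneg)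
      ultimately show False using that by (simp add: s'_def)
    qed
    moreover have "s' x \<le> 1" "s x \<le> s' x" "ramp \<rho> a \<rho> x \<le> s' x" for x
      using s(2)[of x] ramp_bounds(2)[of \<rho> a \<rho> x] by (auto simp: s_def s'_def)
    moreover have "ramp \<rho> c \<rho> x \<le> s' x" if "c \<in> G" for c x
      using s(3)[OF that, of x] by (simp add: s_def s'_def)
    moreover have "\<phi>' a = (\<lambda>x. s' x - s x)" "\<And>c. c \<in> G \<Longrightarrow> \<phi>' c = \<phi> c"
      using insert.hyps(2) by (auto simp: \<phi>'_def)
    ultimately show ?case
      using p L' by (intro exI[of _ \<phi>']) (auto simp: sum' simp del: sum.insert)
  qed
  from this[OF assms(1)] obtain \<phi> :: "'a \<Rightarrow> 'a \<Rightarrow> real" where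
    p: "\<And>c. c \<in> F \<Longrightarrow> (2 / \<rho>)-lipschitz_on UNIV (\<phi> c)"
      "\<And>c x. c \<in> F \<Longrightarrow> 0 \<le> \<phi> c x" "\<And>c x. c \<in> F \<Longrightarrow> \<phi> c x \<noteq> 0 \<Longrightarrow> dist c x < 2 * \<rho>"
    and s: "\<And>x. (\<Sum>c\<in>F. \<phi> c x) \<le> 1" "\<And>c x. c \<in> F \<Longrightarrow> ramp \<rho> c \<rho> x \<le> (\<Sum>c\<in>F. \<phi> c x)"
    by blast
  have "(\<Sum>c\<in>F. \<phi> c x) = 1" for x
  proof -
    have "x \<in> (\<Union>c\<in>F. ball c \<rho>)" using cover by simp
    then obtain c where "c \<in> F" "dist c x < \<rho>" by auto
    then have "1 \<le> (\<Sum>c\<in>F. \<phi> c x)"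
      using s(2)[of c x] ramp_eq_1[OF \<rho>, of c x \<rho>] by simp
    then show ?thesis using s(1)[of x] by simp
  qed
  then show thesis using p that by blast
qed

lemma lip_norm_bounds:
  fixes f :: "'a::metric_space \<Rightarrow> real"
  assumes lip: "L-lipschitz_on UNIV f" and bd: "\<And>x. 0 \<le> f x" "\<And>x. f x \<le> b"
  shows "0 \<le> lip_norm f" "lip_norm f \<le> b + L"
proof -
  have L: "0 \<le> L" using lip lipschitz_on_nonneg by blast
  let ?Q = "insert 0 {dist (f x) (f y) / dist x y | x y. x \<noteq> y}"
  have Q: "q \<le> L" if "q \<in> ?Q" for q
    using that lipschitz_onD[OF lip] L by (auto simp: pos_divide_le_eq)
  have s: "lip_seminorm f \<le> L" unfolding lip_seminorm_def
    using Q by (intro cSup_least) auto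
  have s0: "0 \<le> lip_seminorm f" unfolding lip_seminorm_def
    using Q by (intro cSup_upper bdd_aboveI[of _ L]) auto
  have "(SUP x. \<bar>f x\<bar>) \<le> b" using bd by (intro cSUP_least) auto
  then show "lip_norm f \<le> b + L" using s by (simp add: lip_norm_def)
  have "bdd_above (range (\<lambda>x. \<bar>f x\<bar>))" using bd by (intro bdd_aboveI[of _ b]) auto
  then have "\<bar>f undefined\<bar> \<le> (SUP x. \<bar>f x\<bar>)" by (intro cSUP_upper) auto
  then have "0 \<le> (SUP x. \<bar>f x\<bar>)" by linarith
  then show "0 \<le> lip_norm f" using s0 by (simp add: lip_norm_def)
qed

section \<open>Decorrelation for returns to balls of variable radius\<close>

text \<open>
  The distance of two measurable maps need not be Borel in a general metric space. With a countable
  dense set the condition splits into countably many conditions on the distances to fixed points.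
\<close>

lemma measurable_dist_less:
  fixes f g :: "'a \<Rightarrow> 'b::metric_space" and D :: "'b set" and r :: "'a \<Rightarrow> real"
  assumes f: "f \<in> borel_measurable M" and g: "g \<in> borel_measurable M"
    and r: "r \<in> borel_measurable M"
    and D: "countable D" "\<And>x e. 0 < e \<Longrightarrow> \<exists>a\<in>D. dist x a < e"
  shows "{x \<in> space M. dist (f x) (g x) < r x} \<in> sets M"
proof -
  have eq: "{x \<in> space M. dist (f x) (g x) < r x} =
      (\<Union>a\<in>D. \<Union>q\<in>\<rat>. {x \<in> space M. dist a (f x) < q} \<inter> {x \<in> space M. dist a (g x) + q < r x})"
    (is "?L = ?R")
  proof (intro equalityI subsetI)
    fix x assume x: "x \<in> ?L"
    define e where "e = (r x - dist (f x) (g x)) / 3"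
    have e: "0 < e" and re: "r x = dist (f x) (g x) + 3 * e" using x unfolding e_def by (simp, argo)
    obtain a where a: "a \<in> D" "dist (f x) a < e" using D(2)[OF e] by blast
    obtain q where q: "q \<in> \<rat>" "dist (f x) a < q" "q < e" using Rats_dense_in_real[OF a(2)] by blast
    have "dist a (g x) \<le> dist (f x) a + dist (f x) (g x)" by (rule dist_triangle3)
    then have "dist a (g x) + q < r x" using a q e re by linarith
    moreover have "dist a (f x) < q" using q by (simp add: dist_commute)
    ultimately have "x \<in> {x \<in> space M. dist a (f x) < q} \<inter> {x \<in> space M. dist a (g x) + q < r x}"
      using x by simp
    then show "x \<in> ?R" by (intro UN_I[OF a(1)] UN_I[OF q(1)])
  next
    fix x assume "x \<in> ?R"
    then obtain a q where *: "x \<in> space M" "dist a (f x) < q" "dist a (g x) + q < r x"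
      by (elim UN_E IntE CollectE conjE)
    moreover have "dist (f x) (g x) \<le> dist a (f x) + dist a (g x)" by (rule dist_triangle3)
    ultimately show "x \<in> ?L" by simp
  qed
  show ?thesis unfolding eq
  proof (rule sets.countable_UN''[OF D(1)])
    fix a assume "a \<in> D"
    have d: "(\<lambda>y. dist a y) \<in> borel_measurable borel"
      by (intro borel_measurable_continuous_onI continuous_intros)
    show "(\<Union>q\<in>\<rat>. {x \<in> space M. dist a (f x) < q} \<inter> {x \<in> space M. dist a (g x) + q < r x}) \<in> sets M"
    proof (rule sets.countable_UN''[OF countable_rat])
      fix q :: real
      have "{x \<in> space M. dist a (f x) < q} \<in> sets M"
        by (rule borel_measurable_less[OF measurable_compose[OF f d] borel_measurable_const])
      moreover have "{x \<in> space M. dist a (g x) + q < r x} \<in> sets M"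
        by (rule borel_measurable_less[OF borel_measurable_add[OF measurable_compose[OF g d] borel_measurable_const] r])
      ultimately show "{x \<in> space M. dist a (f x) < q} \<inter> {x \<in> space M. dist a (g x) + q < r x} \<in> sets M"
        by (rule sets.Int)
    qed
  qed
qed

text \<open>
  The decorrelation inequalities with explicit constants, and polynomial covering numbers. The numbers
  \<open>A\<close>, \<open>\<beta>\<close> and \<open>\<eta>0\<close> are the constants in the annulus estimates for the radius functions below.
\<close>

locale decorrelated_system = prob_space \<mu> for \<mu> :: "'a::metric_space measure" +
  fixes T :: "'a \<Rightarrow> 'a" and C \<tau> \<sigma> K A \<beta> \<eta>0 :: real and d :: nat
  assumes sets_borel: "sets \<mu> = sets borel" and T: "T \<in> measurable \<mu> \<mu>"
    and constants: "0 < C" "0 < \<tau>" "0 < \<sigma>" "\<sigma> \<le> 1" "0 < K" "0 < A" "0 < \<beta>" "0 < \<eta>0" "\<eta>0 \<le> 1"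
    and decorrelation: "\<And>\<phi>1 \<phi>2 \<phi>3 k l. \<lbrakk>lipschitz_fun \<phi>1; lipschitz_fun \<phi>2; lipschitz_fun \<phi>3;
          \<And>x. 0 \<le> \<phi>1 x; \<And>x. 0 \<le> \<phi>2 x; \<And>x. 0 \<le> \<phi>3 x; 0 < k; 0 < l\<rbrakk> \<Longrightarrow>
        \<bar>(\<integral>x. \<phi>1 x * \<phi>2 ((T ^^ k) x) * \<phi>3 ((T ^^ (k + l)) x) \<partial>\<mu>)
              - (\<integral>x. \<phi>1 x \<partial>\<mu>) * (\<integral>x. \<phi>2 x \<partial>\<mu>) * (\<integral>x. \<phi>3 x \<partial>\<mu>)\<bar>
           \<le> C * lip_norm \<phi>1 * lip_norm \<phi>2 * lip_norm \<phi>3 * exp (- \<tau> * real (min k l))"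
    and decorrelation_far: "\<And>\<phi>1 \<phi>2 \<phi>3 k l. \<lbrakk>lipschitz_fun \<phi>1; lipschitz_fun \<phi>2; lipschitz_fun \<phi>3;
          \<And>x. 0 \<le> \<phi>1 x; \<And>x. 0 \<le> \<phi>2 x; \<And>x. 0 \<le> \<phi>3 x; 0 < k; 0 < l; real k \<le> \<sigma> * real l\<rbrakk> \<Longrightarrow>
        \<bar>(\<integral>x. \<phi>1 x * \<phi>2 ((T ^^ k) x) * \<phi>3 ((T ^^ (k + l)) x) \<partial>\<mu>)
              - (\<integral>x. \<phi>1 x * \<phi>2 ((T ^^ k) x) \<partial>\<mu>) * (\<integral>x. \<phi>3 x \<partial>\<mu>)\<bar>
           \<le> C * lip_norm \<phi>1 * lip_norm \<phi>2 * lip_norm \<phi>3 * exp (- \<tau> * real l)"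
    and covering: "\<And>\<rho>. 0 < \<rho> \<Longrightarrow> \<rho> \<le> 1 \<Longrightarrow> \<exists>F::'a set. finite F \<and> (\<Union>c\<in>F. ball c \<rho>) = UNIV
           \<and> real (card F) \<le> K * (1 / \<rho>) ^ d"
begin

lemma space_UNIV [simp]: "space \<mu> = UNIV"
  using sets_eq_imp_space_eq[OF sets_borel] by simp

lemma measure_UNIV [simp]: "measure \<mu> UNIV = 1"
  using prob_space by simp

lemma T_iterate [measurable]: "(T ^^ k) \<in> measurable \<mu> \<mu>"
  by (rule measurable_compose_n[OF T])

lemma T_iterate_borel: "(T ^^ k) \<in> borel_measurable \<mu>"
  using T_iterate measurable_cong_sets[OF refl sets_borel] by blast

lemma lipschitz_measurable: "L-lipschitz_on UNIV f \<Longrightarrow> f \<in> borel_measurable \<mu>"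
  for f :: "'a \<Rightarrow> real"
  using borel_measurable_continuous_onI[OF lipschitz_on_continuous_on]
    measurable_cong_sets[OF sets_borel refl] by blast

lemma ball_measurable [measurable]: "ball x s \<in> sets \<mu>"
  by (simp add: sets_borel)

lemma bounded_integrable:
  "f \<in> borel_measurable \<mu> \<Longrightarrow> (\<And>x. 0 \<le> f x) \<Longrightarrow> (\<And>x. f x \<le> b) \<Longrightarrow> integrable \<mu> f" for f :: "'a \<Rightarrow> real"
  by (intro integrable_const_bound[of _ b]) auto

lemma indicator_integrable: "S \<in> sets \<mu> \<Longrightarrow> integrable \<mu> (indicator S :: 'a \<Rightarrow> real)"
  by (intro bounded_integrable[where b=1]) (auto simp: indicator_def)

lemma countable_dense: obtains D :: "'a set" where "countable D" "\<And>x e. 0 < e \<Longrightarrow> \<exists>a\<in>D. dist x a < e"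
proof -
  have "\<forall>n. \<exists>F::'a set. finite F \<and> (\<Union>c\<in>F. ball c (inverse (real (Suc n)))) = UNIV"
  proof
    fix n
    have "0 < inverse (real (Suc n))" "inverse (real (Suc n)) \<le> 1" by (auto simp: field_simps)
    from covering[OF this]
    show "\<exists>F::'a set. finite F \<and> (\<Union>c\<in>F. ball c (inverse (real (Suc n)))) = UNIV" by blast
  qed
  from choice[OF this] obtain F :: "nat \<Rightarrow> 'a set" where F: "\<And>n. finite (F n)"
    "\<And>n. (\<Union>c\<in>F n. ball c (inverse (real (Suc n)))) = UNIV" by blast
  show thesis
  proof (rule that[of "\<Union>n. F n"])
    show "countable (\<Union>n. F n)" using F(1) by (simp add: countable_finite)
    fix x :: 'a and e :: real assume "0 < e"
    then obtain n where n: "inverse (real (Suc n)) < e" using reals_Archimedean by blast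
    have "x \<in> (\<Union>c\<in>F n. ball c (inverse (real (Suc n))))" using F(2) by simp
    then obtain c where "c \<in> F n" "dist c x < inverse (real (Suc n))" by auto
    then show "\<exists>a\<in>\<Union>n. F n. dist x a < e" using n by (auto simp: dist_commute intro!: bexI[of _ c])
  qed
qed

definition lip1 :: "('a \<Rightarrow> real) \<Rightarrow> bool" where
  "lip1 r \<longleftrightarrow> (\<forall>x y. r x \<le> r y + dist x y)"

definition hit :: "('a \<Rightarrow> real) \<Rightarrow> nat \<Rightarrow> 'a set" where
  "hit r k = {x. dist x ((T ^^ k) x) < r x}"

lemma lip1_add: "lip1 r \<Longrightarrow> lip1 (\<lambda>x. r x + s)"
  by (simp add: lip1_def)

lemma lip1_measurable: assumes "lip1 r" shows "r \<in> borel_measurable \<mu>"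
proof (rule lipschitz_measurable)
  show "1-lipschitz_on UNIV r"
  proof (rule lipschitz_onI)
    fix x y
    show "dist (r x) (r y) \<le> 1 * dist x y"
      using assms[unfolded lip1_def, rule_format, of x y] assms[unfolded lip1_def, rule_format, of y x]
      by (simp add: dist_real_def dist_commute)
  qed simp
qed

lemma hit_measurable [measurable]:
  assumes "lip1 r" shows "hit r k \<in> sets \<mu>"
proof -
  obtain D :: "'a set" where D: "countable D" "\<And>x e. 0 < e \<Longrightarrow> \<exists>a\<in>D. dist x a < e"
    using countable_dense by blast
  have "(\<lambda>x. x) \<in> borel_measurable \<mu>"
    by (rule measurable_ident_sets[OF sets_borel])
  from measurable_dist_less[OF this T_iterate_borel lip1_measurable[OF assms] D]
  show ?thesis by (simp add: hit_def)
qed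

text \<open>
  The radius function \<open>r\<close> cuts out balls of measure about \<open>m\<close>, in the robust form that survives a
  change of the radius by \<open>\<eta>\<close>.
\<close>

definition target :: "('a \<Rightarrow> real) \<Rightarrow> real \<Rightarrow> bool" where
  "target r m \<longleftrightarrow> 0 \<le> m \<and> m \<le> 1 \<and> lip1 r \<and>
     (AE x in \<mu>. \<forall>\<eta>. 0 < \<eta> \<and> \<eta> \<le> \<eta>0 \<longrightarrow>
        measure \<mu> (ball x (r x + \<eta>)) \<le> m + A * \<eta> powr \<beta> \<and>
        m - A * \<eta> powr \<beta> \<le> measure \<mu> (ball x (r x - \<eta>)))"

text \<open>
  Moving the centre from \<open>x\<close> to \<open>c\<close> costs \<open>2\<rho>\<close> in the distance and \<open>2\<rho>\<close> in the radius, and the ramp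
  itself has width \<open>\<rho>\<close>. Hence the shift by \<open>5\<rho>\<close> in one direction and by \<open>4\<rho>\<close> in the other.
\<close>

lemma ramp_local:
  assumes "lip1 r" "0 < \<rho>" "dist c x < 2 * \<rho>"
  shows "ramp \<rho> c (r c + u) y \<noteq> 0 \<Longrightarrow> dist x y < r x + u + 5 * \<rho>"
    and "dist x y < r x + u - 4 * \<rho> \<Longrightarrow> ramp \<rho> c (r c + u) y = 1"
proof -
  have r: "r c \<le> r x + dist c x" "r x \<le> r c + dist c x"
    using assms(1)[unfolded lip1_def, rule_format, of c x] assms(1)[unfolded lip1_def, rule_format, of x c]
    by (simp_all add: dist_commute)
  have t: "dist x y \<le> dist c x + dist c y" "dist c y \<le> dist c x + dist x y"
    using dist_triangle3[of x y c] dist_triangle[of c y x] by (simp_all add: dist_commute)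
  show "dist x y < r x + u + 5 * \<rho>" if "ramp \<rho> c (r c + u) y \<noteq> 0"
  proof -
    have "dist c y < r c + u + \<rho>" using ramp_eq_0[OF assms(2)] that by force
    then show ?thesis using r t assms(3) by linarith
  qed
  show "ramp \<rho> c (r c + u) y = 1" if "dist x y < r x + u - 4 * \<rho>"
    using r t assms(3) that by (intro ramp_eq_1[OF assms(2)]) linarith
qed

definition partition_at :: "real \<Rightarrow> 'a set \<Rightarrow> ('a \<Rightarrow> 'a \<Rightarrow> real) \<Rightarrow> bool" where
  "partition_at \<rho> F \<phi> \<longleftrightarrow> 0 < \<rho> \<and> \<rho> \<le> 1 \<and> finite F \<and> real (card F) \<le> K * (1 / \<rho>) ^ d \<and>
     (\<forall>c\<in>F. (2 / \<rho>)-lipschitz_on UNIV (\<phi> c) \<and>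
        (\<forall>x. 0 \<le> \<phi> c x \<and> \<phi> c x \<le> 1 \<and> (\<phi> c x \<noteq> 0 \<longrightarrow> dist c x < 2 * \<rho>))) \<and>
     (\<forall>x. (\<Sum>c\<in>F. \<phi> c x) = 1)"

lemma partition_exists:
  assumes "0 < \<rho>" "\<rho> \<le> 1"
  obtains F \<phi> where "partition_at \<rho> F \<phi>"
proof -
  obtain F :: "'a set" where F: "finite F" "(\<Union>c\<in>F. ball c \<rho>) = UNIV"
      "real (card F) \<le> K * (1 / \<rho>) ^ d"
    using covering[OF assms] by blast
  obtain \<phi> :: "'a \<Rightarrow> 'a \<Rightarrow> real" where p:
    "\<And>c. c \<in> F \<Longrightarrow> (2 / \<rho>)-lipschitz_on UNIV (\<phi> c)"
    "\<And>c x. c \<in> F \<Longrightarrow> 0 \<le> \<phi> c x"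
    "\<And>c x. c \<in> F \<Longrightarrow> \<phi> c x \<noteq> 0 \<Longrightarrow> dist c x < 2 * \<rho>"
    "\<And>x. (\<Sum>c\<in>F. \<phi> c x) = 1"
    using lipschitz_partition_of_unity[OF F(1) assms(1) F(2)] by blast
  have "\<phi> c x \<le> 1" if "c \<in> F" for c x
    using member_le_sum[OF that, of "\<lambda>c. \<phi> c x"] p(2,4) F(1) by auto
  then have "partition_at \<rho> F \<phi>"
    unfolding partition_at_def using p F assms by auto
  then show thesis by (rule that)
qed

lemma partition_measurable:
  "partition_at \<rho> F \<phi> \<Longrightarrow> c \<in> F \<Longrightarrow> \<phi> c \<in> borel_measurable \<mu>"
  by (auto simp: partition_at_def intro: lipschitz_measurable)

lemma ramp_measurable: "0 < \<rho> \<Longrightarrow> ramp \<rho> c t \<in> borel_measurable \<mu>"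
  by (rule lipschitz_measurable[OF ramp_lipschitz])

lemma ramp_iterate_measurable: "0 < \<rho> \<Longrightarrow> (\<lambda>x. ramp \<rho> c t ((T ^^ k) x)) \<in> borel_measurable \<mu>"
  using measurable_compose[OF T_iterate ramp_measurable] by simp

lemma product_integrable:
  assumes P: "partition_at \<rho> F \<phi>" "c \<in> F"
  shows "integrable \<mu> (\<phi> c)" "integrable \<mu> (ramp \<rho> a t)"
    and "integrable \<mu> (\<lambda>x. \<phi> c x * ramp \<rho> a t ((T ^^ k) x))"
    and "integrable \<mu> (\<lambda>x. \<phi> c x * ramp \<rho> a t ((T ^^ k) x) * ramp \<rho> b t' ((T ^^ n) x))"
proof -
  have \<rho>: "0 < \<rho>" and \<phi>: "\<And>x. 0 \<le> \<phi> c x" "\<And>x. \<phi> c x \<le> 1"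
    using P by (auto simp: partition_at_def)
  note [measurable] = partition_measurable[OF P] ramp_iterate_measurable[OF \<rho>] ramp_measurable[OF \<rho>]
  show "integrable \<mu> (\<phi> c)" "integrable \<mu> (ramp \<rho> a t)"
    using \<phi> ramp_bounds by (auto intro!: bounded_integrable[where b=1] ramp_measurable \<rho> partition_measurable[OF P])
  show "integrable \<mu> (\<lambda>x. \<phi> c x * ramp \<rho> a t ((T ^^ k) x))"
    using \<phi> ramp_bounds by (intro bounded_integrable[where b=1]) (auto intro!: mult_le_one mult_nonneg_nonneg)
  show "integrable \<mu> (\<lambda>x. \<phi> c x * ramp \<rho> a t ((T ^^ k) x) * ramp \<rho> b t' ((T ^^ n) x))"
    using \<phi> ramp_bounds by (intro bounded_integrable[where b=1]) (auto intro!: mult_le_one mult_nonneg_nonneg)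
qed

text \<open>
  The sum is the integral of a convex combination of the numbers \<open>q c\<close>, in which only those \<open>c\<close> with
  \<open>\<phi> c x \<noteq> 0\<close> enter at the point \<open>x\<close>.
\<close>

lemma partition_average_le:
  assumes P: "partition_at \<rho> F \<phi>" and q: "AE x in \<mu>. \<forall>c\<in>F. \<phi> c x \<noteq> 0 \<longrightarrow> q c \<le> b"
  shows "(\<Sum>c\<in>F. (\<integral>x. \<phi> c x \<partial>\<mu>) * q c) \<le> b"
proof -
  have "(\<Sum>c\<in>F. (\<integral>x. \<phi> c x \<partial>\<mu>) * q c) = (\<integral>x. (\<Sum>c\<in>F. \<phi> c x * q c) \<partial>\<mu>)"
    by (subst Bochner_Integration.integral_sum) (auto intro!: integrable_mult_left product_integrable(1)[OF P])
  also have "\<dots> \<le> (\<integral>x. b \<partial>\<mu>)"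
  proof (rule integral_mono_AE)
    show "integrable \<mu> (\<lambda>x. \<Sum>c\<in>F. \<phi> c x * q c)"
      by (intro Bochner_Integration.integrable_sum integrable_mult_left product_integrable(1)[OF P])
    show "AE x in \<mu>. (\<Sum>c\<in>F. \<phi> c x * q c) \<le> b"
      using q
    proof eventually_elim
      fix x assume q: "\<forall>c\<in>F. \<phi> c x \<noteq> 0 \<longrightarrow> q c \<le> b"
      have "(\<Sum>c\<in>F. \<phi> c x * q c) \<le> (\<Sum>c\<in>F. \<phi> c x * b)"
      proof (rule sum_mono)
        fix c assume c: "c \<in> F"
        have "0 \<le> \<phi> c x" using P c by (auto simp: partition_at_def)
        then show "\<phi> c x * q c \<le> \<phi> c x * b"
          using q c by (cases "\<phi> c x = 0") (auto intro!: mult_left_mono)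
      qed
      also have "\<dots> = b" using P by (simp add: partition_at_def sum_distrib_right[symmetric])
      finally show "(\<Sum>c\<in>F. \<phi> c x * q c) \<le> b" .
    qed
  qed simp
  finally show ?thesis by (simp add: prob_space)
qed

text \<open>
  The Lipschitz norms are at most \<open>3/\<rho>\<close>, \<open>2/\<rho>\<close> and \<open>2/\<rho>\<close>, which gives the factor \<open>12\<close>. The two-fold
  statement is the three-fold one with a constant third function.
\<close>

lemma partition_decorrelation:
  assumes P: "partition_at \<rho> F \<phi>" and c: "c \<in> F" and k: "0 < k" and l: "0 < l"
    and G: "G = ramp \<rho> a t" and H: "H = ramp \<rho> b t'"
  shows "\<bar>(\<integral>x. \<phi> c x * G ((T ^^ k) x) \<partial>\<mu>) - (\<integral>x. \<phi> c x \<partial>\<mu>) * (\<integral>x. G x \<partial>\<mu>)\<bar>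
          \<le> 12 * C * (1 / \<rho>) ^ 3 * exp (- \<tau> * real k)"
    and "\<bar>(\<integral>x. \<phi> c x * G ((T ^^ k) x) * H ((T ^^ (k + l)) x) \<partial>\<mu>)
          - (\<integral>x. \<phi> c x \<partial>\<mu>) * (\<integral>x. G x \<partial>\<mu>) * (\<integral>x. H x \<partial>\<mu>)\<bar>
          \<le> 12 * C * (1 / \<rho>) ^ 3 * exp (- \<tau> * real (min k l))"
    and "real k \<le> \<sigma> * real l \<Longrightarrow>
         \<bar>(\<integral>x. \<phi> c x * G ((T ^^ k) x) * H ((T ^^ (k + l)) x) \<partial>\<mu>)
          - (\<integral>x. \<phi> c x * G ((T ^^ k) x) \<partial>\<mu>) * (\<integral>x. H x \<partial>\<mu>)\<bar>
          \<le> 12 * C * (1 / \<rho>) ^ 3 * exp (- \<tau> * real l)"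
proof -
  have \<rho>: "0 < \<rho>" "\<rho> \<le> 1" and \<phi>: "\<And>x. 0 \<le> \<phi> c x" "\<And>x. \<phi> c x \<le> 1" "(2 / \<rho>)-lipschitz_on UNIV (\<phi> c)"
    using P c by (auto simp: partition_at_def)
  have one: "1 \<le> 1 / \<rho>" using \<rho> by simp
  have GL: "(1 / \<rho>)-lipschitz_on UNIV G" and HL: "(1 / \<rho>)-lipschitz_on UNIV H"
    using ramp_lipschitz[OF \<rho>(1)] by (auto simp: G H)
  have IL: "0-lipschitz_on UNIV (\<lambda>x::'a. 1::real)" by (auto intro!: lipschitz_onI)
  have n\<phi>: "0 \<le> lip_norm (\<phi> c)" "lip_norm (\<phi> c) \<le> 3 * (1 / \<rho>)"
    using lip_norm_bounds[OF \<phi>(3) \<phi>(1,2)] one by simp_all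
  have nG: "0 \<le> lip_norm G" "lip_norm G \<le> 2 * (1 / \<rho>)"
    using lip_norm_bounds[OF GL, of 1] one by (simp_all add: G ramp_bounds)
  have nH: "0 \<le> lip_norm H" "lip_norm H \<le> 2 * (1 / \<rho>)"
    using lip_norm_bounds[OF HL, of 1] one by (simp_all add: H ramp_bounds)
  have nI: "0 \<le> lip_norm (\<lambda>x::'a. 1)" "lip_norm (\<lambda>x::'a. 1) \<le> 2 * (1 / \<rho>)"
    using lip_norm_bounds[OF IL, of 1] one by simp_all
  have prod: "C * lip_norm (\<phi> c) * lip_norm G * lip_norm J * exp z \<le> 12 * C * (1 / \<rho>) ^ 3 * exp z"
    if J: "0 \<le> lip_norm J" "lip_norm J \<le> 2 * (1 / \<rho>)" for J :: "'a \<Rightarrow> real" and z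
  proof -
    have "C * lip_norm (\<phi> c) * lip_norm G * lip_norm J * exp z
        \<le> C * (3 * (1 / \<rho>)) * (2 * (1 / \<rho>)) * (2 * (1 / \<rho>)) * exp z"
      using constants(1) n\<phi> nG J \<rho> by (intro mult_mono mult_nonneg_nonneg) auto
    also have "\<dots> = 12 * C * (1 / \<rho>) ^ 3 * exp z" by (simp add: power3_eq_cube)
    finally show ?thesis .
  qed
  have l\<phi>: "lipschitz_fun (\<phi> c)" "lipschitz_fun G" "lipschitz_fun H" "lipschitz_fun (\<lambda>x::'a. 1)"
    using \<phi>(3) GL HL IL unfolding lipschitz_fun_def by blast+
  have pos: "\<And>x. 0 \<le> G x" "\<And>x. 0 \<le> H x" using ramp_bounds by (auto simp: G H)
  show "\<bar>(\<integral>x. \<phi> c x * G ((T ^^ k) x) \<partial>\<mu>) - (\<integral>x. \<phi> c x \<partial>\<mu>) * (\<integral>x. G x \<partial>\<mu>)\<bar>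
          \<le> 12 * C * (1 / \<rho>) ^ 3 * exp (- \<tau> * real k)"
    using order_trans[OF decorrelation[OF l\<phi>(1,2,4) \<phi>(1) pos(1) _ k k] prod[OF nI]] by simp
  show "\<bar>(\<integral>x. \<phi> c x * G ((T ^^ k) x) * H ((T ^^ (k + l)) x) \<partial>\<mu>)
          - (\<integral>x. \<phi> c x \<partial>\<mu>) * (\<integral>x. G x \<partial>\<mu>) * (\<integral>x. H x \<partial>\<mu>)\<bar>
          \<le> 12 * C * (1 / \<rho>) ^ 3 * exp (- \<tau> * real (min k l))"
    by (rule order_trans[OF decorrelation[OF l\<phi>(1-3) \<phi>(1) pos k l] prod[OF nH]])
  show "\<bar>(\<integral>x. \<phi> c x * G ((T ^^ k) x) * H ((T ^^ (k + l)) x) \<partial>\<mu>)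
          - (\<integral>x. \<phi> c x * G ((T ^^ k) x) \<partial>\<mu>) * (\<integral>x. H x \<partial>\<mu>)\<bar>
          \<le> 12 * C * (1 / \<rho>) ^ 3 * exp (- \<tau> * real l)" if "real k \<le> \<sigma> * real l"
    by (rule order_trans[OF decorrelation_far[OF l\<phi>(1-3) \<phi>(1) pos k l that] prod[OF nH]])
qed

lemma sum_error_le:
  assumes P: "partition_at \<rho> F \<phi>" and e: "\<And>c. c \<in> F \<Longrightarrow> e c \<le> 12 * C * (1 / \<rho>) ^ 3 * exp z"
  shows "(\<Sum>c\<in>F. e c) \<le> 12 * C * K * (1 / \<rho>) ^ (d + 3) * exp z"
proof -
  have \<rho>: "0 < \<rho>" and card: "real (card F) \<le> K * (1 / \<rho>) ^ d" using P by (auto simp: partition_at_def)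
  have "(\<Sum>c\<in>F. e c) \<le> real (card F) * (12 * C * (1 / \<rho>) ^ 3 * exp z)"
    using sum_bounded_above[of F e, OF e] by simp
  also have "\<dots> \<le> K * (1 / \<rho>) ^ d * (12 * C * (1 / \<rho>) ^ 3 * exp z)"
    using card \<rho> constants by (intro mult_right_mono) auto
  also have "\<dots> = 12 * C * K * (1 / \<rho>) ^ (d + 3) * exp z" by (simp add: power_add)
  finally show ?thesis .
qed

text \<open>
  The ramp around \<open>c\<close> lies below the indicator of a slightly larger ball around \<open>x\<close>, whose measure is
  controlled at almost every \<open>x\<close>.
\<close>

lemma ramp_integral_le:
  assumes r: "target r m" and P: "partition_at \<rho> F \<phi>" and u: "u + 5 * \<rho> = s" "0 < s" "s \<le> \<eta>0"
  shows "AE x in \<mu>. \<forall>c\<in>F. \<phi> c x \<noteq> 0 \<longrightarrow> (\<integral>y. ramp \<rho> c (r c + u) y \<partial>\<mu>) \<le> m + A * s powr \<beta>"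
proof -
  have \<rho>: "0 < \<rho>" using P by (simp add: partition_at_def)
  have r1: "lip1 r" and "AE x in \<mu>. \<forall>\<eta>. 0 < \<eta> \<and> \<eta> \<le> \<eta>0 \<longrightarrow>
        measure \<mu> (ball x (r x + \<eta>)) \<le> m + A * \<eta> powr \<beta> \<and>
        m - A * \<eta> powr \<beta> \<le> measure \<mu> (ball x (r x - \<eta>))" using r by (auto simp: target_def)
  from this(2) show ?thesis
  proof eventually_elim
    case (elim x)
    show ?case
    proof (intro ballI impI)
      fix c assume c: "c \<in> F" "\<phi> c x \<noteq> 0"
      then have "dist c x < 2 * \<rho>" using P by (auto simp: partition_at_def)
      note R = ramp_local(1)[OF r1 \<rho> this]
      have "(\<integral>y. ramp \<rho> c (r c + u) y \<partial>\<mu>) \<le> (\<integral>y. indicator (ball x (r x + s)) y \<partial>\<mu>)"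
      proof (rule integral_mono)
        show "integrable \<mu> (ramp \<rho> c (r c + u))" by (rule product_integrable(2)[OF P c(1)])
        fix y
        show "ramp \<rho> c (r c + u) y \<le> indicator (ball x (r x + s)) y"
          using R[of u y] ramp_bounds(2)[of \<rho> c "r c + u" y] u(1)
          by (cases "ramp \<rho> c (r c + u) y = 0") (auto simp: indicator_def)
      qed (simp add: indicator_integrable)
      also have "\<dots> = measure \<mu> (ball x (r x + s))" by simp
      also have "\<dots> \<le> m + A * s powr \<beta>" using elim u by blast
      finally show "(\<integral>y. ramp \<rho> c (r c + u) y \<partial>\<mu>) \<le> m + A * s powr \<beta>" .
    qed
  qed
qed

lemma ramp_integral_ge:
  assumes r: "target r m" and P: "partition_at \<rho> F \<phi>" and s: "9 * \<rho> \<le> \<eta>0"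
  shows "AE x in \<mu>. \<forall>c\<in>F. \<phi> c x \<noteq> 0 \<longrightarrow>
    - (\<integral>y. ramp \<rho> c (r c + (- 5 * \<rho>)) y \<partial>\<mu>) \<le> - (m - A * (9 * \<rho>) powr \<beta>)"
proof -
  have \<rho>: "0 < \<rho>" using P by (simp add: partition_at_def)
  have r1: "lip1 r" and "AE x in \<mu>. \<forall>\<eta>. 0 < \<eta> \<and> \<eta> \<le> \<eta>0 \<longrightarrow>
        measure \<mu> (ball x (r x + \<eta>)) \<le> m + A * \<eta> powr \<beta> \<and>
        m - A * \<eta> powr \<beta> \<le> measure \<mu> (ball x (r x - \<eta>))" using r by (auto simp: target_def)
  from this(2) show ?thesis
  proof eventually_elim
    case (elim x)
    show ?case
    proof (intro ballI impI)
      fix c assume c: "c \<in> F" "\<phi> c x \<noteq> 0"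
      then have "dist c x < 2 * \<rho>" using P by (auto simp: partition_at_def)
      note R = ramp_local(2)[OF r1 \<rho> this, of _ "- 5 * \<rho>"]
      have "m - A * (9 * \<rho>) powr \<beta> \<le> measure \<mu> (ball x (r x - 9 * \<rho>))" using elim s \<rho> by auto
      also have "\<dots> = (\<integral>y. indicator (ball x (r x - 9 * \<rho>)) y \<partial>\<mu>)" by simp
      also have "\<dots> \<le> (\<integral>y. ramp \<rho> c (r c + (- 5 * \<rho>)) y \<partial>\<mu>)"
      proof (rule integral_mono)
        show "integrable \<mu> (ramp \<rho> c (r c + (- 5 * \<rho>)))" by (rule product_integrable(2)[OF P c(1)])
        fix y
        show "indicator (ball x (r x - 9 * \<rho>)) y \<le> ramp \<rho> c (r c + (- 5 * \<rho>)) y"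
          using R[of y] ramp_bounds(1)[of \<rho> c "r c + (- 5 * \<rho>)" y]
          by (auto simp: indicator_def)
      qed (simp add: indicator_integrable)
      finally show "- (\<integral>y. ramp \<rho> c (r c + (- 5 * \<rho>)) y \<partial>\<mu>) \<le> - (m - A * (9 * \<rho>) powr \<beta>)" by simp
    qed
  qed
qed

text \<open>
  The enlargement of the radius by \<open>9\<rho>\<close> is what splitting off the last factor at scale \<open>\<rho>\<close> leaves
  behind in \<open>hit_pair_le_far\<close>.
\<close>

lemma hit_enlarged_le:
  assumes r: "target r m" and \<rho>: "0 < \<rho>" "18 * \<rho> \<le> \<eta>0" and k: "0 < k"
  shows "measure \<mu> (hit (\<lambda>x. r x + 9 * \<rho>) k)
    \<le> m + A * (18 * \<rho>) powr \<beta> + 12 * C * K * (1 / \<rho>) ^ (d + 3) * exp (- \<tau> * real k)"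
proof -
  have "\<rho> \<le> 1" using \<rho> constants by linarith
  then obtain F \<phi> where P: "partition_at \<rho> F \<phi>" using partition_exists[OF \<rho>(1)] by blast
  have \<phi>: "\<And>c x. c \<in> F \<Longrightarrow> 0 \<le> \<phi> c x" "\<And>c x. c \<in> F \<Longrightarrow> \<phi> c x \<noteq> 0 \<Longrightarrow> dist c x < 2 * \<rho>"
    and \<phi>1: "\<And>x. (\<Sum>c\<in>F. \<phi> c x) = 1" using P by (auto simp: partition_at_def)
  have r1: "lip1 r" using r by (simp add: target_def)
  define G where "G c = ramp \<rho> c (r c + 13 * \<rho>)" for c
  let ?S = "hit (\<lambda>x. r x + 9 * \<rho>) k"
  have pt: "indicator ?S x \<le> (\<Sum>c\<in>F. \<phi> c x * G c ((T ^^ k) x))" for x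
  proof (cases "x \<in> ?S")
    case True
    have "(\<Sum>c\<in>F. \<phi> c x * G c ((T ^^ k) x)) = (\<Sum>c\<in>F. \<phi> c x)"
    proof (rule sum.cong[OF refl])
      fix c assume c: "c \<in> F"
      show "\<phi> c x * G c ((T ^^ k) x) = \<phi> c x"
      proof (cases "\<phi> c x = 0")
        case False
        then have "G c ((T ^^ k) x) = 1" unfolding G_def
          using True \<phi>(2)[OF c] by (intro ramp_local(2)[OF r1 \<rho>(1)]) (auto simp: hit_def)
        then show ?thesis by simp
      qed simp
    qed
    then show ?thesis using \<phi>1 by (simp add: indicator_def)
  next
    case False
    then show ?thesis using \<phi>(1) ramp_bounds by (auto simp: G_def intro!: sum_nonneg mult_nonneg_nonneg)
  qed
  have "measure \<mu> ?S = (\<integral>x. indicator ?S x \<partial>\<mu>)"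
    using hit_measurable[OF lip1_add[OF r1]] by simp
  also have "\<dots> \<le> (\<integral>x. (\<Sum>c\<in>F. \<phi> c x * G c ((T ^^ k) x)) \<partial>\<mu>)"
    using pt hit_measurable[OF lip1_add[OF r1]]
    by (intro integral_mono Bochner_Integration.integrable_sum)
       (auto simp: G_def intro!: product_integrable(3)[OF P] indicator_integrable)
  also have "\<dots> = (\<Sum>c\<in>F. (\<integral>x. \<phi> c x * G c ((T ^^ k) x) \<partial>\<mu>))"
    by (intro Bochner_Integration.integral_sum) (auto simp: G_def intro!: product_integrable(3)[OF P])
  also have "\<dots> = (\<Sum>c\<in>F. (\<integral>x. \<phi> c x \<partial>\<mu>) * (\<integral>x. G c x \<partial>\<mu>))
      + (\<Sum>c\<in>F. (\<integral>x. \<phi> c x * G c ((T ^^ k) x) \<partial>\<mu>) - (\<integral>x. \<phi> c x \<partial>\<mu>) * (\<integral>x. G c x \<partial>\<mu>))"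
    by (simp add: sum_subtractf)
  also have "\<dots> \<le> (m + A * (18 * \<rho>) powr \<beta>) + 12 * C * K * (1 / \<rho>) ^ (d + 3) * exp (- \<tau> * real k)"
  proof (rule add_mono)
    show "(\<Sum>c\<in>F. (\<integral>x. \<phi> c x \<partial>\<mu>) * (\<integral>x. G c x \<partial>\<mu>)) \<le> m + A * (18 * \<rho>) powr \<beta>"
      unfolding G_def using \<rho> by (intro partition_average_le[OF P] ramp_integral_le[OF r P]) auto
    show "(\<Sum>c\<in>F. (\<integral>x. \<phi> c x * G c ((T ^^ k) x) \<partial>\<mu>) - (\<integral>x. \<phi> c x \<partial>\<mu>) * (\<integral>x. G c x \<partial>\<mu>))
      \<le> 12 * C * K * (1 / \<rho>) ^ (d + 3) * exp (- \<tau> * real k)"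
      by (intro sum_error_le[OF P])
         (use partition_decorrelation(1)[OF P _ k k refl refl] in \<open>auto simp: G_def abs_le_iff\<close>)
  qed
  finally show ?thesis .
qed

lemma hit_ge:
  assumes r: "target r m" and \<rho>: "0 < \<rho>" "18 * \<rho> \<le> \<eta>0" and k: "0 < k"
  shows "m - A * (18 * \<rho>) powr \<beta> - 12 * C * K * (1 / \<rho>) ^ (d + 3) * exp (- \<tau> * real k)
    \<le> measure \<mu> (hit r k)"
proof -
  have "\<rho> \<le> 1" using \<rho> constants by linarith
  then obtain F \<phi> where P: "partition_at \<rho> F \<phi>" using partition_exists[OF \<rho>(1)] by blast
  have \<phi>: "\<And>c x. c \<in> F \<Longrightarrow> 0 \<le> \<phi> c x" "\<And>c x. c \<in> F \<Longrightarrow> \<phi> c x \<noteq> 0 \<Longrightarrow> dist c x < 2 * \<rho>"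
    and \<phi>1: "\<And>x. (\<Sum>c\<in>F. \<phi> c x) = 1" using P by (auto simp: partition_at_def)
  have r1: "lip1 r" using r by (simp add: target_def)
  define G where "G c = ramp \<rho> c (r c + (- 5 * \<rho>))" for c
  have pt: "(\<Sum>c\<in>F. \<phi> c x * G c ((T ^^ k) x)) \<le> indicator (hit r k) x" for x
  proof (cases "x \<in> hit r k")
    case True
    have "(\<Sum>c\<in>F. \<phi> c x * G c ((T ^^ k) x)) \<le> (\<Sum>c\<in>F. \<phi> c x * 1)"
      using \<phi>(1) ramp_bounds(2) by (intro sum_mono mult_left_mono) (auto simp: G_def)
    then show ?thesis using True \<phi>1 by (simp add: indicator_def)
  next
    case False
    have "\<phi> c x * G c ((T ^^ k) x) = 0" if c: "c \<in> F" for c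
    proof (rule ccontr)
      assume "\<phi> c x * G c ((T ^^ k) x) \<noteq> 0"
      then have "dist x ((T ^^ k) x) < r x + (- 5 * \<rho>) + 5 * \<rho>"
        using \<phi>(2)[OF c, of x] by (intro ramp_local(1)[OF r1 \<rho>(1), of c]) (auto simp: G_def)
      then show False using False by (simp add: hit_def)
    qed
    then have "(\<Sum>c\<in>F. \<phi> c x * G c ((T ^^ k) x)) = 0" by (rule sum.neutral[rule_format])
    then show ?thesis by simp
  qed
  have "m - A * (9 * \<rho>) powr \<beta> - 12 * C * K * (1 / \<rho>) ^ (d + 3) * exp (- \<tau> * real k)
    \<le> - (\<Sum>c\<in>F. (\<integral>x. \<phi> c x \<partial>\<mu>) * - (\<integral>x. G c x \<partial>\<mu>))
      - (\<Sum>c\<in>F. (\<integral>x. \<phi> c x \<partial>\<mu>) * (\<integral>x. G c x \<partial>\<mu>) - (\<integral>x. \<phi> c x * G c ((T ^^ k) x) \<partial>\<mu>))"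
  proof -
    have "(\<Sum>c\<in>F. (\<integral>x. \<phi> c x \<partial>\<mu>) * - (\<integral>x. G c x \<partial>\<mu>)) \<le> - (m - A * (9 * \<rho>) powr \<beta>)"
      unfolding G_def using \<rho> by (intro partition_average_le[OF P] ramp_integral_ge[OF r P]) auto
    moreover have "(\<Sum>c\<in>F. (\<integral>x. \<phi> c x \<partial>\<mu>) * (\<integral>x. G c x \<partial>\<mu>) - (\<integral>x. \<phi> c x * G c ((T ^^ k) x) \<partial>\<mu>))
      \<le> 12 * C * K * (1 / \<rho>) ^ (d + 3) * exp (- \<tau> * real k)"
      by (intro sum_error_le[OF P])
         (use partition_decorrelation(1)[OF P _ k k refl refl] in \<open>auto simp: G_def abs_le_iff\<close>)
    ultimately show ?thesis by linarith
  qed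
  also have "\<dots> = (\<Sum>c\<in>F. (\<integral>x. \<phi> c x * G c ((T ^^ k) x) \<partial>\<mu>))"
    by (simp add: sum_subtractf sum_negf)
  also have "\<dots> = (\<integral>x. (\<Sum>c\<in>F. \<phi> c x * G c ((T ^^ k) x)) \<partial>\<mu>)"
    by (intro Bochner_Integration.integral_sum[symmetric]) (auto simp: G_def intro!: product_integrable(3)[OF P])
  also have "\<dots> \<le> (\<integral>x. indicator (hit r k) x \<partial>\<mu>)"
    using pt hit_measurable[OF r1]
    by (intro integral_mono Bochner_Integration.integrable_sum)
       (auto simp: G_def intro!: product_integrable(3)[OF P] indicator_integrable)
  also have "\<dots> = measure \<mu> (hit r k)" using hit_measurable[OF r1] by simp
  finally have *: "m - A * (9 * \<rho>) powr \<beta> - 12 * C * K * (1 / \<rho>) ^ (d + 3) * exp (- \<tau> * real k)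
    \<le> measure \<mu> (hit r k)" .
  have "A * (9 * \<rho>) powr \<beta> \<le> A * (18 * \<rho>) powr \<beta>"
    using constants \<rho> by (intro mult_left_mono powr_mono2) auto
  then show ?thesis using * by linarith
qed

text \<open>
  One partition serves both events, because both balls are centred at the same point \<open>x\<close>.
\<close>

lemma hit_pair_le_sum:
  assumes r: "lip1 r1" "lip1 r2" and P: "partition_at \<rho> F \<phi>"
  shows "measure \<mu> (hit r1 k \<inter> hit r2 n)
    \<le> (\<Sum>c\<in>F. (\<integral>x. \<phi> c x * ramp \<rho> c (r1 c + 4 * \<rho>) ((T ^^ k) x) * ramp \<rho> c (r2 c + 4 * \<rho>) ((T ^^ n) x) \<partial>\<mu>))"
proof -
  have \<rho>: "0 < \<rho>" and \<phi>: "\<And>c x. c \<in> F \<Longrightarrow> 0 \<le> \<phi> c x" "\<And>c x. c \<in> F \<Longrightarrow> \<phi> c x \<noteq> 0 \<Longrightarrow> dist c x < 2 * \<rho>"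
    and \<phi>1: "\<And>x. (\<Sum>c\<in>F. \<phi> c x) = 1" using P by (auto simp: partition_at_def)
  define G where "G c = ramp \<rho> c (r1 c + 4 * \<rho>)" for c
  define H where "H c = ramp \<rho> c (r2 c + 4 * \<rho>)" for c
  let ?S = "hit r1 k \<inter> hit r2 n"
  have pt: "indicator ?S x \<le> (\<Sum>c\<in>F. \<phi> c x * G c ((T ^^ k) x) * H c ((T ^^ n) x))" for x
  proof (cases "x \<in> ?S")
    case True
    have "(\<Sum>c\<in>F. \<phi> c x * G c ((T ^^ k) x) * H c ((T ^^ n) x)) = (\<Sum>c\<in>F. \<phi> c x)"
    proof (rule sum.cong[OF refl])
      fix c assume c: "c \<in> F"
      show "\<phi> c x * G c ((T ^^ k) x) * H c ((T ^^ n) x) = \<phi> c x"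
      proof (cases "\<phi> c x = 0")
        case False
        then have "G c ((T ^^ k) x) = 1" "H c ((T ^^ n) x) = 1" unfolding G_def H_def
          using True \<phi>(2)[OF c]
          by (auto simp: hit_def intro!: ramp_local(2)[OF r(1) \<rho>] ramp_local(2)[OF r(2) \<rho>])
        then show ?thesis by simp
      qed simp
    qed
    then show ?thesis using \<phi>1 by (simp add: indicator_def)
  next
    case False
    then show ?thesis using \<phi>(1) ramp_bounds by (auto simp: G_def H_def intro!: sum_nonneg mult_nonneg_nonneg)
  qed
  have S: "?S \<in> sets \<mu>" using hit_measurable r by blast
  then have "measure \<mu> ?S = (\<integral>x. indicator ?S x \<partial>\<mu>)" by simp
  also have "\<dots> \<le> (\<integral>x. (\<Sum>c\<in>F. \<phi> c x * G c ((T ^^ k) x) * H c ((T ^^ n) x)) \<partial>\<mu>)"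
    using pt S
    by (intro integral_mono Bochner_Integration.integrable_sum)
       (auto simp: G_def H_def intro!: product_integrable(4)[OF P] indicator_integrable)
  also have "\<dots> = (\<Sum>c\<in>F. (\<integral>x. \<phi> c x * G c ((T ^^ k) x) * H c ((T ^^ n) x) \<partial>\<mu>))"
    by (intro Bochner_Integration.integral_sum) (auto simp: G_def H_def intro!: product_integrable(4)[OF P])
  finally show ?thesis by (simp add: G_def H_def)
qed

lemma hit_pair_le_near:
  assumes r: "target r1 m1" "target r2 m2" and \<rho>: "0 < \<rho>" "9 * \<rho> \<le> \<eta>0" and kl: "0 < k" "0 < l"
  shows "measure \<mu> (hit r1 k \<inter> hit r2 (k + l))
    \<le> (m1 + A * (9 * \<rho>) powr \<beta>) * (m2 + A * (9 * \<rho>) powr \<beta>)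
      + 12 * C * K * (1 / \<rho>) ^ (d + 3) * exp (- \<tau> * real (min k l))"
proof -
  have "\<rho> \<le> 1" using \<rho> constants by linarith
  then obtain F \<phi> where P: "partition_at \<rho> F \<phi>" using partition_exists[OF \<rho>(1)] by blast
  define G where "G c = ramp \<rho> c (r1 c + 4 * \<rho>)" for c
  define H where "H c = ramp \<rho> c (r2 c + 4 * \<rho>)" for c
  have r1: "lip1 r1" "lip1 r2" using r by (simp_all add: target_def)
  have GH: "0 \<le> (\<integral>x. H c x \<partial>\<mu>)" for c
    unfolding H_def by (rule Bochner_Integration.integral_nonneg) (rule ramp_bounds)
  have G1: "AE x in \<mu>. \<forall>c\<in>F. \<phi> c x \<noteq> 0 \<longrightarrow> (\<integral>y. G c y \<partial>\<mu>) \<le> m1 + A * (9 * \<rho>) powr \<beta>"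
    unfolding G_def using \<rho> by (intro ramp_integral_le[OF r(1) P]) auto
  have H1: "AE x in \<mu>. \<forall>c\<in>F. \<phi> c x \<noteq> 0 \<longrightarrow> (\<integral>y. H c y \<partial>\<mu>) \<le> m2 + A * (9 * \<rho>) powr \<beta>"
    unfolding H_def using \<rho> by (intro ramp_integral_le[OF r(2) P]) auto
  have b1: "0 \<le> m1 + A * (9 * \<rho>) powr \<beta>" using r(1) constants by (simp add: target_def)
  have "AE x in \<mu>. \<forall>c\<in>F. \<phi> c x \<noteq> 0 \<longrightarrow> (\<integral>y. G c y \<partial>\<mu>) * (\<integral>y. H c y \<partial>\<mu>)
      \<le> (m1 + A * (9 * \<rho>) powr \<beta>) * (m2 + A * (9 * \<rho>) powr \<beta>)"
    using G1 H1
  proof eventually_elim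
    case (elim x)
    show ?case
    proof (intro ballI impI)
      fix c assume c: "c \<in> F" "\<phi> c x \<noteq> 0"
      show "(\<integral>y. G c y \<partial>\<mu>) * (\<integral>y. H c y \<partial>\<mu>)
        \<le> (m1 + A * (9 * \<rho>) powr \<beta>) * (m2 + A * (9 * \<rho>) powr \<beta>)"
        by (rule mult_mono[OF elim(1)[rule_format, OF c] elim(2)[rule_format, OF c] b1 GH])
    qed
  qed
  from partition_average_le[OF P this]
  have main: "(\<Sum>c\<in>F. (\<integral>x. \<phi> c x \<partial>\<mu>) * ((\<integral>y. G c y \<partial>\<mu>) * (\<integral>y. H c y \<partial>\<mu>)))
    \<le> (m1 + A * (9 * \<rho>) powr \<beta>) * (m2 + A * (9 * \<rho>) powr \<beta>)" .
  have err: "(\<Sum>c\<in>F. (\<integral>x. \<phi> c x * G c ((T ^^ k) x) * H c ((T ^^ (k + l)) x) \<partial>\<mu>)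
       - (\<integral>x. \<phi> c x \<partial>\<mu>) * (\<integral>y. G c y \<partial>\<mu>) * (\<integral>y. H c y \<partial>\<mu>))
    \<le> 12 * C * K * (1 / \<rho>) ^ (d + 3) * exp (- \<tau> * real (min k l))"
    unfolding G_def H_def
    by (rule sum_error_le[OF P], rule order_trans[OF abs_ge_self], rule partition_decorrelation(2)[OF P _ kl refl refl])
  show ?thesis
    using hit_pair_le_sum[OF r1 P, of k "k + l", folded G_def H_def] main err
    by (simp add: sum_subtractf mult.assoc)
qed

text \<open>
  Only the factor at time \<open>k + l\<close> is split off. The sum of the first two factors over the partition is
  at most the indicator of the enlarged event at time \<open>k\<close>.
\<close>

lemma hit_pair_le_far:
  assumes r: "target r1 m1" "target r2 m2" and \<rho>: "0 < \<rho>" "9 * \<rho> \<le> \<eta>0" and kl: "0 < k" "0 < l"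
    and far: "real k \<le> \<sigma> * real l"
  shows "measure \<mu> (hit r1 k \<inter> hit r2 (k + l))
    \<le> measure \<mu> (hit (\<lambda>x. r1 x + 9 * \<rho>) k) * (m2 + A * (9 * \<rho>) powr \<beta>)
      + 12 * C * K * (1 / \<rho>) ^ (d + 3) * exp (- \<tau> * real l)"
proof -
  have "\<rho> \<le> 1" using \<rho> constants by linarith
  then obtain F \<phi> where P: "partition_at \<rho> F \<phi>" using partition_exists[OF \<rho>(1)] by blast
  have \<phi>: "\<And>c x. c \<in> F \<Longrightarrow> 0 \<le> \<phi> c x" "\<And>c x. c \<in> F \<Longrightarrow> \<phi> c x \<noteq> 0 \<Longrightarrow> dist c x < 2 * \<rho>"
    and \<phi>1: "\<And>x. (\<Sum>c\<in>F. \<phi> c x) = 1" using P by (auto simp: partition_at_def)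
  define G where "G c = ramp \<rho> c (r1 c + 4 * \<rho>)" for c
  define H where "H c = ramp \<rho> c (r2 c + 4 * \<rho>)" for c
  define b where "b = m2 + A * (9 * \<rho>) powr \<beta>"
  have b0: "0 \<le> b" using r(2) constants by (simp add: b_def target_def)
  have r1: "lip1 r1" "lip1 r2" using r by (simp_all add: target_def)
  let ?S = "hit (\<lambda>x. r1 x + 9 * \<rho>) k"
  have S: "?S \<in> sets \<mu>" by (rule hit_measurable[OF lip1_add[OF r1(1)]])
  have AEH: "AE x in \<mu>. \<forall>c\<in>F. \<phi> c x \<noteq> 0 \<longrightarrow> (\<integral>y. H c y \<partial>\<mu>) \<le> b"
    unfolding H_def b_def using \<rho> by (intro ramp_integral_le[OF r(2) P]) auto
  have pt: "AE x in \<mu>. (\<Sum>c\<in>F. \<phi> c x * G c ((T ^^ k) x) * (\<integral>y. H c y \<partial>\<mu>)) \<le> b * indicator ?S x"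
    using AEH
  proof eventually_elim
    case (elim x)
    have "(\<Sum>c\<in>F. \<phi> c x * G c ((T ^^ k) x) * (\<integral>y. H c y \<partial>\<mu>)) \<le> (\<Sum>c\<in>F. \<phi> c x * (b * indicator ?S x))"
    proof (rule sum_mono)
      fix c assume c: "c \<in> F"
      show "\<phi> c x * G c ((T ^^ k) x) * (\<integral>y. H c y \<partial>\<mu>) \<le> \<phi> c x * (b * indicator ?S x)"
      proof (cases "\<phi> c x = 0 \<or> G c ((T ^^ k) x) = 0")
        case True
        then show ?thesis using b0 \<phi>(1)[OF c] by (auto simp: indicator_def)
      next
        case False
        then have "dist x ((T ^^ k) x) < r1 x + 4 * \<rho> + 5 * \<rho>"
          using \<phi>(2)[OF c, of x] by (intro ramp_local(1)[OF r1(1) \<rho>(1), of c]) (auto simp: G_def)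
        then have "x \<in> ?S" by (simp add: hit_def)
        moreover have "G c ((T ^^ k) x) * (\<integral>y. H c y \<partial>\<mu>) \<le> 1 * b"
          using elim c False b0 ramp_bounds
          by (intro mult_mono) (auto simp: G_def H_def intro!: Bochner_Integration.integral_nonneg)
        ultimately show ?thesis using \<phi>(1)[OF c, of x]
          by (auto simp: mult.assoc intro!: mult_left_mono)
      qed
    qed
    also have "\<dots> = b * indicator ?S x" using \<phi>1 by (simp add: sum_distrib_right[symmetric])
    finally show ?case .
  qed
  have "(\<Sum>c\<in>F. (\<integral>x. \<phi> c x * G c ((T ^^ k) x) \<partial>\<mu>) * (\<integral>y. H c y \<partial>\<mu>))
      = (\<integral>x. (\<Sum>c\<in>F. \<phi> c x * G c ((T ^^ k) x) * (\<integral>y. H c y \<partial>\<mu>)) \<partial>\<mu>)"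
    by (subst Bochner_Integration.integral_sum)
       (auto simp: G_def intro!: integrable_mult_left product_integrable(3)[OF P])
  also have "\<dots> \<le> (\<integral>x. b * indicator ?S x \<partial>\<mu>)"
    using pt S by (intro integral_mono_AE Bochner_Integration.integrable_sum integrable_mult_left integrable_mult_right)
      (auto simp: G_def intro!: product_integrable(3)[OF P] indicator_integrable)
  also have "\<dots> = measure \<mu> ?S * b" using S by simp
  finally have main: "(\<Sum>c\<in>F. (\<integral>x. \<phi> c x * G c ((T ^^ k) x) \<partial>\<mu>) * (\<integral>y. H c y \<partial>\<mu>)) \<le> measure \<mu> ?S * b" .
  have err: "(\<Sum>c\<in>F. (\<integral>x. \<phi> c x * G c ((T ^^ k) x) * H c ((T ^^ (k + l)) x) \<partial>\<mu>)
       - (\<integral>x. \<phi> c x * G c ((T ^^ k) x) \<partial>\<mu>) * (\<integral>y. H c y \<partial>\<mu>))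
    \<le> 12 * C * K * (1 / \<rho>) ^ (d + 3) * exp (- \<tau> * real l)"
    unfolding G_def H_def
    by (rule sum_error_le[OF P], rule order_trans[OF abs_ge_self], rule partition_decorrelation(3)[OF P _ kl refl refl far])
  show ?thesis
    using hit_pair_le_sum[OF r1 P, of k "k + l", folded G_def H_def] main err
    unfolding b_def by (simp add: sum_subtractf)
qed

text \<open>
  The exponent is chosen such that \<open>(1 / scale t) ^ (d + 3)\<close> is a multiple of \<open>exp (\<tau> * t / 2)\<close>: half of the
  decorrelation rate pays for covering numbers and Lipschitz norms.
\<close>

definition scale :: "real \<Rightarrow> real" where
  "scale t = \<eta>0 / 18 * exp (- (\<tau> / (2 * real (d + 3))) * t)"

definition rate :: real where
  "rate = min (\<tau> / (2 * real (d + 3)) * \<beta>) (\<tau> / 2)"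

definition factor :: real where
  "factor = A + 12 * C * K * (18 / \<eta>0) ^ (d + 3)"

lemma rate_factor_pos: "0 < rate" "0 < factor"
  using constants by (auto simp: rate_def factor_def intro!: add_pos_nonneg)

lemma scale_bounds:
  assumes "0 \<le> t"
  shows "0 < scale t" "18 * scale t \<le> \<eta>0"
proof -
  show "0 < scale t" using constants by (simp add: scale_def)
  have "exp (- (\<tau> / (2 * real (d + 3))) * t) \<le> 1" using assms constants by simp
  then show "18 * scale t \<le> \<eta>0" using constants by (simp add: scale_def mult_left_le)
qed

lemma scale_antimono: "s \<le> t \<Longrightarrow> scale t \<le> scale s"
  using constants by (auto simp: scale_def intro!: mult_left_mono divide_right_mono)

lemma scale_error:
  assumes t: "0 \<le> t"
  shows "A * (18 * scale t) powr \<beta> + 12 * C * K * (1 / scale t) ^ (d + 3) * exp (- \<tau> * t)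
      \<le> factor * exp (- rate * t)"
    and "A * (9 * scale t) powr \<beta> \<le> factor * exp (- rate * t)"
proof -
  define \<theta> where "\<theta> = \<tau> / (2 * real (d + 3))"
  have \<theta>: "0 < \<theta>" using constants by (simp add: \<theta>_def)
  have s: "scale t = \<eta>0 / 18 * exp (- \<theta> * t)" by (simp add: scale_def \<theta>_def)
  have r: "exp (- (\<theta> * \<beta>) * t) \<le> exp (- rate * t)" "exp (- (\<tau> / 2) * t) \<le> exp (- rate * t)"
  proof -
    have "rate \<le> \<theta> * \<beta>" "rate \<le> \<tau> / 2" unfolding rate_def \<theta>_def by (rule min.cobounded1, rule min.cobounded2)
    from this[THEN mult_right_mono[OF _ t]]
    show "exp (- (\<theta> * \<beta>) * t) \<le> exp (- rate * t)" "exp (- (\<tau> / 2) * t) \<le> exp (- rate * t)"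
      by simp_all
  qed
  have "(18 * scale t) powr \<beta> \<le> exp (- \<theta> * t) powr \<beta>"
    using constants by (intro powr_mono2) (auto simp: s mult_left_le_one_le)
  also have "\<dots> = exp (- (\<theta> * \<beta>) * t)" by (simp add: powr_def mult_ac)
  finally have "(18 * scale t) powr \<beta> \<le> exp (- rate * t)" using r(1) by linarith
  then have a: "A * (18 * scale t) powr \<beta> \<le> A * exp (- rate * t)"
    using constants by (intro mult_left_mono) auto
  have "(1 / scale t) ^ (d + 3) = (18 / \<eta>0) ^ (d + 3) * exp (\<theta> * t) ^ (d + 3)"
    using constants by (simp add: s exp_minus field_simps power_divide power_mult_distrib)
  also have "exp (\<theta> * t) ^ (d + 3) = exp (\<tau> / 2 * t)"
    unfolding exp_of_nat_mult[symmetric] by (rule arg_cong[of _ _ exp]) (simp add: \<theta>_def field_simps)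
  finally have "(1 / scale t) ^ (d + 3) * exp (- \<tau> * t) = (18 / \<eta>0) ^ (d + 3) * exp (- (\<tau> / 2) * t)"
    by (simp add: mult.assoc exp_add[symmetric])
  also have "\<dots> \<le> (18 / \<eta>0) ^ (d + 3) * exp (- rate * t)"
    using r(2) constants by (intro mult_left_mono) auto
  finally have "12 * C * K * ((1 / scale t) ^ (d + 3) * exp (- \<tau> * t))
      \<le> 12 * C * K * ((18 / \<eta>0) ^ (d + 3) * exp (- rate * t))"
    using constants by (intro mult_left_mono) auto
  then show main: "A * (18 * scale t) powr \<beta> + 12 * C * K * (1 / scale t) ^ (d + 3) * exp (- \<tau> * t)
      \<le> factor * exp (- rate * t)"
    using a by (simp add: factor_def algebra_simps)
  have "A * (9 * scale t) powr \<beta> \<le> A * (18 * scale t) powr \<beta>"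
    using constants scale_bounds[OF t] by (intro mult_left_mono powr_mono2) auto
  moreover have "0 \<le> 12 * C * K * (1 / scale t) ^ (d + 3) * exp (- \<tau> * t)"
    using constants scale_bounds[OF t] by (intro mult_nonneg_nonneg) auto
  ultimately show "A * (9 * scale t) powr \<beta> \<le> factor * exp (- rate * t)" using main by linarith
qed

lemma hit_enlarged_decay:
  assumes r: "target r m" and k: "0 < k" and \<rho>: "\<rho> \<le> scale (real k)"
  shows "measure \<mu> (hit (\<lambda>x. r x + 9 * \<rho>) k) \<le> m + factor * exp (- rate * real k)"
proof -
  have r1: "lip1 r" using r by (simp add: target_def)
  have "measure \<mu> (hit (\<lambda>x. r x + 9 * \<rho>) k) \<le> measure \<mu> (hit (\<lambda>x. r x + 9 * scale (real k)) k)"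
    using \<rho> by (intro finite_measure_mono hit_measurable lip1_add r1) (auto simp: hit_def)
  also have "\<dots> \<le> m + A * (18 * scale (real k)) powr \<beta>
      + 12 * C * K * (1 / scale (real k)) ^ (d + 3) * exp (- \<tau> * real k)"
    using scale_bounds[of "real k"] by (intro hit_enlarged_le r k) auto
  also have "\<dots> \<le> m + factor * exp (- rate * real k)"
    using scale_error(1)[of "real k"] by simp
  finally show ?thesis .
qed

lemma hit_measure_decay:
  assumes r: "target r m" and k: "0 < k"
  shows "\<bar>measure \<mu> (hit r k) - m\<bar> \<le> factor * exp (- rate * real k)"
proof -
  have "measure \<mu> (hit r k) \<le> m + factor * exp (- rate * real k)"
    using hit_enlarged_decay[OF r k, of 0] scale_bounds(1)[of "real k"] by simp
  moreover have "m - factor * exp (- rate * real k) \<le> measure \<mu> (hit r k)"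
    using hit_ge[OF r _ _ k, of "scale (real k)"] scale_bounds[of "real k"] scale_error(1)[of "real k"] by simp
  ultimately show ?thesis by (simp add: abs_le_iff)
qed

text \<open>
  For \<open>k \<le> \<sigma> l\<close> the last factor is split off at scale \<open>l\<close>, and the enlarged event at time \<open>k\<close> is
  estimated at the coarser scale \<open>k\<close>, which is possible because \<open>scale\<close> decreases. Otherwise
  \<open>min k l \<ge> \<sigma> l\<close>, so that full decorrelation already gives exponential decay in \<open>l\<close>.
\<close>

lemma hit_pair_decay:
  assumes r: "target r1 m1" "target r2 m2" and kl: "0 < k" "0 < l"
  shows "measure \<mu> (hit r1 k \<inter> hit r2 (k + l)) \<le> m1 * m2
    + (3 * factor + factor\<^sup>2) * exp (- (rate * \<sigma>) * real k) * m2
    + (3 * factor + factor\<^sup>2) * exp (- (rate * \<sigma>) * real l)"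
proof -
  have m: "0 \<le> m1" "m1 \<le> 1" "0 \<le> m2" "m2 \<le> 1" using r by (auto simp: target_def)
  note pos = rate_factor_pos
  define D where "D = 3 * factor + factor\<^sup>2"
  have D: "0 \<le> D" "factor \<le> D" using pos by (auto simp: D_def)
  have \<sigma>: "exp (- rate * t) \<le> exp (- (rate * \<sigma>) * t)" if "0 \<le> t" for t
    using that pos constants by (simp add: mult_left_le mult_right_mono)
  have last: "0 \<le> D * exp (- (rate * \<sigma>) * real k) * m2"
    using D m by (intro mult_nonneg_nonneg) auto
  show ?thesis
  proof (cases "real k \<le> \<sigma> * real l")
    case far: True
    have "\<sigma> * real l \<le> 1 * real l" using constants by (intro mult_right_mono) auto
    then have "k \<le> l" using far by linarith
    define e where "e = exp (- rate * real l)"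
    define f where "f = exp (- rate * real k)"
    have ef: "0 \<le> e" "0 \<le> f" "f \<le> 1" using pos by (auto simp: e_def f_def)
    have 1: "measure \<mu> (hit (\<lambda>x. r1 x + 9 * scale (real l)) k) \<le> m1 + factor * f"
      unfolding f_def using \<open>k \<le> l\<close> by (intro hit_enlarged_decay r kl scale_antimono) simp
    have 2: "m2 + A * (9 * scale (real l)) powr \<beta> \<le> m2 + factor * e"
      using scale_error(2)[of "real l"] by (simp add: e_def)
    have "12 * C * K * (1 / scale (real l)) ^ (d + 3) * exp (- \<tau> * real l) \<le> factor * e"
      using scale_error(1)[of "real l"] constants scale_bounds[of "real l"]
      by (simp add: e_def) (smt (verit) mult_nonneg_nonneg powr_ge_zero)
    then have "measure \<mu> (hit r1 k \<inter> hit r2 (k + l)) \<le> (m1 + factor * f) * (m2 + factor * e) + factor * e"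
      using hit_pair_le_far[OF r _ _ kl far, of "scale (real l)"] scale_bounds[of "real l"]
        mult_mono[OF 1 2] m ef pos constants by simp
    also have "\<dots> = m1 * m2 + factor * f * m2 + (m1 + factor * f + 1) * factor * e"
      by (simp add: algebra_simps)
    also have "\<dots> \<le> m1 * m2 + D * exp (- (rate * \<sigma>) * real k) * m2 + D * exp (- (rate * \<sigma>) * real l)"
    proof (intro add_mono order_refl)
      show "factor * f * m2 \<le> D * exp (- (rate * \<sigma>) * real k) * m2"
        using D m ef \<sigma>[of "real k"] pos by (intro mult_mono) (auto simp: f_def)
      have "factor * f \<le> factor * 1" using ef pos by (intro mult_left_mono) auto
      then have "m1 + factor * f + 1 \<le> 3 + factor" using m by linarith
      then have "(m1 + factor * f + 1) * factor \<le> (3 + factor) * factor"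
        using pos by (intro mult_right_mono) auto
      then have "(m1 + factor * f + 1) * factor \<le> D" by (simp add: D_def algebra_simps power2_eq_square)
      then show "(m1 + factor * f + 1) * factor * e \<le> D * exp (- (rate * \<sigma>) * real l)"
        using D ef \<sigma>[of "real l"] by (intro mult_mono) (auto simp: e_def)
    qed
    finally show ?thesis by (simp add: D_def)
  next
    case near: False
    define t where "t = real (min k l)"
    have "\<sigma> * real l \<le> 1 * real l" using constants by (intro mult_right_mono) auto
    then have t: "0 \<le> t" "\<sigma> * real l \<le> t" using near by (auto simp: t_def min_def)
    define e where "e = exp (- rate * t)"
    have e: "0 \<le> e" "e \<le> 1" "e \<le> exp (- (rate * \<sigma>) * real l)"
      using pos t by (auto simp: e_def mult.assoc)
    have 1: "m1 + A * (9 * scale t) powr \<beta> \<le> m1 + factor * e" "m2 + A * (9 * scale t) powr \<beta> \<le> m2 + factor * e"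
      using scale_error(2)[OF t(1)] by (simp_all add: e_def)
    have "12 * C * K * (1 / scale t) ^ (d + 3) * exp (- \<tau> * t) \<le> factor * e"
      using scale_error(1)[OF t(1)] constants scale_bounds[OF t(1)]
      by (simp add: e_def) (smt (verit) mult_nonneg_nonneg powr_ge_zero)
    then have "measure \<mu> (hit r1 k \<inter> hit r2 (k + l)) \<le> (m1 + factor * e) * (m2 + factor * e) + factor * e"
      using hit_pair_le_near[OF r _ _ kl, of "scale t"] scale_bounds[OF t(1)]
        mult_mono[OF 1] m e pos constants by (simp add: t_def)
    also have "\<dots> = m1 * m2 + (m1 + m2 + 1 + factor * e) * factor * e"
      by (simp add: algebra_simps)
    also have "\<dots> \<le> m1 * m2 + D * exp (- (rate * \<sigma>) * real l)"
    proof (intro add_mono order_refl)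
      have "factor * e \<le> factor * 1" using e pos by (intro mult_left_mono) auto
      then have "m1 + m2 + 1 + factor * e \<le> 3 + factor" using m by linarith
      then have "(m1 + m2 + 1 + factor * e) * factor \<le> (3 + factor) * factor"
        using pos by (intro mult_right_mono) auto
      then have "(m1 + m2 + 1 + factor * e) * factor \<le> D" by (simp add: D_def algebra_simps power2_eq_square)
      then show "(m1 + m2 + 1 + factor * e) * factor * e \<le> D * exp (- (rate * \<sigma>) * real l)"
        using D e by (intro mult_mono) auto
    qed
    finally show ?thesis using last by (simp add: D_def)
  qed
qed

lemma exponential_recurrence:
  "\<exists>B>0. \<exists>\<eta>>0. (\<forall>r m k. target r m \<longrightarrow> 0 < k \<longrightarrow> \<bar>measure \<mu> (hit r k) - m\<bar> \<le> B * exp (- \<eta> * real k)) \<and>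
    (\<forall>r1 r2 m1 m2 k l. target r1 m1 \<longrightarrow> target r2 m2 \<longrightarrow> 0 < k \<longrightarrow> 0 < l \<longrightarrow>
      measure \<mu> (hit r1 k \<inter> hit r2 (k + l))
        \<le> m1 * m2 + B * exp (- \<eta> * real k) * m2 + B * exp (- \<eta> * real l))"
proof (intro exI conjI allI impI)
  note pos = rate_factor_pos
  show "0 < 3 * factor + factor\<^sup>2" "0 < rate * \<sigma>" using pos constants by (auto intro!: add_pos_nonneg)
  show "\<bar>measure \<mu> (hit r k) - m\<bar> \<le> (3 * factor + factor\<^sup>2) * exp (- (rate * \<sigma>) * real k)"
    if "target r m" "0 < k" for r m k
  proof -
    have "factor * exp (- rate * real k) \<le> (3 * factor + factor\<^sup>2) * exp (- (rate * \<sigma>) * real k)"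
      using pos constants by (intro mult_mono) (auto simp: mult_left_le mult_right_mono)
    then show ?thesis using hit_measure_decay[OF that] by linarith
  qed
  show "measure \<mu> (hit r1 k \<inter> hit r2 (k + l)) \<le> m1 * m2
    + (3 * factor + factor\<^sup>2) * exp (- (rate * \<sigma>) * real k) * m2
    + (3 * factor + factor\<^sup>2) * exp (- (rate * \<sigma>) * real l)"
    if "target r1 m1" "target r2 m2" "0 < k" "0 < l" for r1 r2 m1 m2 k l
    using hit_pair_decay[OF that] .
qed

end

section \<open>Balls of prescribed measure\<close>

text \<open>
  Thin annuli handle \<open>\<eta> \<le> t\<close>. For smaller or negative \<open>t\<close> the outer ball lies in \<open>ball x (2 * \<eta>)\<close>, and the
  Frostman property applies.
\<close>

lemma annulus_measure_le:
  fixes \<mu> :: "'a::metric_space measure"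
  assumes "finite_measure \<mu>" and borel: "sets \<mu> = sets borel"
    and "frostman \<mu>" and "thin_annuli \<mu>"
  shows "\<exists>A>0. \<exists>\<beta>>0. \<exists>\<eta>0>0. \<exists>t0>0. \<eta>0 \<le> 1 \<and> (\<forall>x t \<eta>. t \<le> t0 \<and> 0 < \<eta> \<and> \<eta> \<le> \<eta>0 \<longrightarrow>
    measure \<mu> (ball x (t + \<eta>)) \<le> measure \<mu> (ball x t) + A * \<eta> powr \<beta>)"
proof -
  interpret finite_measure \<mu> by fact
  obtain C1 s \<rho> where F: "C1 > 0" "s > 0" "\<rho> > 0"
    "\<And>x r. 0 < r \<Longrightarrow> r < \<rho> \<Longrightarrow> measure \<mu> (ball x r) \<le> C1 * r powr s"
    using assms(3) unfolding frostman_def by blast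
  obtain C2 \<alpha> r0 where Th: "C2 > 0" "\<alpha> > 0" "r0 > 0"
    "\<And>x r \<epsilon>. 0 < \<epsilon> \<Longrightarrow> \<epsilon> \<le> r \<Longrightarrow> r \<le> r0 \<Longrightarrow> measure \<mu> (ball x (r + \<epsilon>) - ball x r) \<le> C2 * \<epsilon> powr \<alpha>"
    using assms(4) unfolding thin_annuli_def by blast
  define \<beta> where "\<beta> = min \<alpha> s"
  define A where "A = C2 + C1 * 2 powr s"
  define \<eta>0 where "\<eta>0 = min 1 (\<rho> / 3)"
  have main: "measure \<mu> (ball x (t + \<eta>)) \<le> measure \<mu> (ball x t) + A * \<eta> powr \<beta>"
    if t: "t \<le> r0" "0 < \<eta>" "\<eta> \<le> \<eta>0" for x t \<eta>
  proof -
    have \<eta>: "\<eta> \<le> 1" "2 * \<eta> < \<rho>" using t by (auto simp: \<eta>0_def)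
    have "\<eta> powr \<alpha> \<le> \<eta> powr \<beta>" "\<eta> powr s \<le> \<eta> powr \<beta>"
      using \<eta> t by (auto simp: \<beta>_def intro!: powr_mono')
    then have p: "C2 * \<eta> powr \<alpha> \<le> C2 * \<eta> powr \<beta>" "C1 * 2 powr s * \<eta> powr s \<le> C1 * 2 powr s * \<eta> powr \<beta>"
      using F Th by (auto intro!: mult_left_mono)
    show ?thesis
    proof (cases "\<eta> \<le> t")
      case True
      have "ball x t \<subseteq> ball x (t + \<eta>)" using t by (intro subset_ball) simp
      then have "measure \<mu> (ball x (t + \<eta>)) = measure \<mu> (ball x t) + measure \<mu> (ball x (t + \<eta>) - ball x t)"
        using finite_measure_Diff[of "ball x (t + \<eta>)" "ball x t"] by (simp add: borel)
      also have "\<dots> \<le> measure \<mu> (ball x t) + C2 * \<eta> powr \<alpha>" using Th(4)[OF t(2) True t(1)] by simp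
      also have "C2 * \<eta> powr \<alpha> \<le> A * \<eta> powr \<beta>"
      proof -
        have "C2 * \<eta> powr \<beta> \<le> A * \<eta> powr \<beta>" using F by (intro mult_right_mono) (auto simp: A_def)
        then show ?thesis using p(1) by linarith
      qed
      finally show ?thesis by simp
    next
      case False
      have "measure \<mu> (ball x (t + \<eta>)) \<le> measure \<mu> (ball x (2 * \<eta>))"
        using False by (intro finite_measure_mono subset_ball) (auto simp: borel)
      also have "\<dots> \<le> C1 * (2 * \<eta>) powr s" using t \<eta> by (intro F(4)) auto
      also have "\<dots> = C1 * 2 powr s * \<eta> powr s" using t by (simp add: powr_mult)
      also have "\<dots> \<le> C1 * 2 powr s * \<eta> powr \<beta>" by (rule p(2))
      also have "\<dots> \<le> A * \<eta> powr \<beta>" using Th by (intro mult_right_mono) (auto simp: A_def)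
      also have "\<dots> \<le> measure \<mu> (ball x t) + A * \<eta> powr \<beta>" by simp
      finally show ?thesis .
    qed
  qed
  have "A > 0" using F(1) Th(1) by (simp add: A_def add_pos_pos)
  moreover have "\<beta> > 0" "\<eta>0 > 0" "\<eta>0 \<le> 1" using F Th by (simp_all add: \<beta>_def \<eta>0_def)
  ultimately show ?thesis using Th(3) main
    by (intro exI[of _ A] exI[of _ \<beta>] exI[of _ \<eta>0] exI[of _ r0] conjI allI impI) simp_all
qed

text \<open>
  Among finitely many balls of radius \<open>t / 2\<close> that cover the space, those of measure zero can be
  discarded, and the others have measures bounded below.
\<close>

lemma compact_ball_measure_pos:
  fixes \<mu> :: "'a::metric_space measure"
  assumes "finite_measure \<mu>" and borel: "sets \<mu> = sets borel" and cpt: "compact (UNIV :: 'a set)" and t: "0 < t"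
  shows "\<exists>m>0. AE x in \<mu>. m \<le> measure \<mu> (ball x t)"
proof -
  interpret finite_measure \<mu> by fact
  have "x \<in> (\<Union>p\<in>UNIV. ball p (t / 2))" for x :: 'a by (rule UN_I[of x]) (use t in simp_all)
  then have "(UNIV :: 'a set) \<subseteq> (\<Union>p\<in>UNIV. ball p (t / 2))" by blast
  then obtain P :: "'a set" where P: "finite P" "UNIV \<subseteq> (\<Union>p\<in>P. ball p (t / 2))"
    by (rule compactE_image[OF cpt open_ball]) blast
  define P' where "P' = {p \<in> P. measure \<mu> (ball p (t / 2)) \<noteq> 0}"
  define m where "m = Min (insert 1 ((\<lambda>p. measure \<mu> (ball p (t / 2))) ` P'))"
  have fin: "finite P'" using P by (simp add: P'_def)
  have "0 < measure \<mu> (ball p (t / 2))" if "p \<in> P'" for p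
    using that measure_nonneg[of \<mu> "ball p (t / 2)"] unfolding P'_def less_le by auto
  then have "m > 0" using fin by (simp add: m_def)
  moreover have "AE x in \<mu>. m \<le> measure \<mu> (ball x t)"
  proof -
    have "(\<Union>p\<in>P - P'. ball p (t / 2)) \<in> null_sets \<mu>"
    proof (rule null_sets_UN')
      show "countable (P - P')" using P(1) by (intro countable_finite) simp
      show "ball p (t / 2) \<in> null_sets \<mu>" if "p \<in> P - P'" for p
        using that by (simp add: P'_def null_sets_def borel emeasure_eq_measure)
    qed
    then have "AE x in \<mu>. x \<notin> (\<Union>p\<in>P - P'. ball p (t / 2))" by (rule AE_not_in)
    then show ?thesis
    proof eventually_elim
      case (elim x)
      obtain p where p: "p \<in> P" "x \<in> ball p (t / 2)" using P(2) by blast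
      then have p': "p \<in> P'" using elim by blast
      have "m \<le> measure \<mu> (ball p (t / 2))" using fin p' unfolding m_def by (intro Min_le) auto
      also have "\<dots> \<le> measure \<mu> (ball x t)"
      proof (intro finite_measure_mono subsetI)
        fix y assume "y \<in> ball p (t / 2)"
        then show "y \<in> ball x t" using p(2) dist_triangle3[of x y p] by simp
      qed (simp add: borel)
      finally show ?case .
    qed
  qed
  ultimately show ?thesis by blast
qed

context decorrelated_system
begin

lemma return_set_eq_hit: "return_set \<mu> T M k = hit (hit_radius \<mu> M k) k"
  by (simp add: return_set_def hit_def)

text \<open>
  Once \<open>M k\<close> is below the measure of \<open>ball x t0\<close>, the radius is at most \<open>t0\<close>. There the annulus estimate
  makes the measure of balls around \<open>x\<close> continuous in the radius, so that the infimum in the definition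
  of the radius is attained with equality.
\<close>

lemma hit_radius_target:
  assumes annulus: "\<And>x t \<eta>. t \<le> t0 \<Longrightarrow> 0 < \<eta> \<Longrightarrow> \<eta> \<le> \<eta>0 \<Longrightarrow>
      measure \<mu> (ball x (t + \<eta>)) \<le> measure \<mu> (ball x t) + A * \<eta> powr \<beta>"
    and bdd: "bounded (UNIV :: 'a set)" and t0: "0 < t0"
    and Mk: "0 \<le> M k" "M k \<le> 1" and ball_pos: "AE x in \<mu>. M k \<le> measure \<mu> (ball x t0)"
  shows "target (hit_radius \<mu> M k) (M k)"
    and "AE x in \<mu>. measure \<mu> (ball x (hit_radius \<mu> M k x)) = M k"
proof -
  define R where "R x = {r. 0 \<le> r \<and> M k \<le> measure \<mu> (ball x r)}" for x
  have r: "hit_radius \<mu> M k x = Inf (R x)" for x by (simp add: hit_radius_def R_def)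
  obtain b where b: "\<And>x y::'a. dist x y \<le> b" using bdd unfolding bounded_two_points by blast
  have bR: "b + 1 \<in> R x" for x
  proof -
    have "ball x (b + 1) = UNIV" using le_less_trans[OF b[of x], of "b + 1"] by auto
    moreover have "0 \<le> b" using b[of x x] by simp
    ultimately show ?thesis using Mk by (simp add: R_def)
  qed
  have bddR: "bdd_below (R x)" for x by (auto simp: R_def intro!: bdd_belowI[of _ 0])
  have lip: "lip1 (hit_radius \<mu> M k)"
    unfolding lip1_def
  proof (intro allI)
    fix x y
    have "Inf (R x) - dist x y \<le> Inf (R y)"
    proof (rule cInf_greatest)
      show "R y \<noteq> {}" using bR by blast
      fix s assume s: "s \<in> R y"
      have "measure \<mu> (ball y s) \<le> measure \<mu> (ball x (s + dist x y))"
      proof (intro finite_measure_mono subsetI)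
        fix z assume "z \<in> ball y s"
        then show "z \<in> ball x (s + dist x y)" using dist_triangle[of x z y] by simp
      qed simp
      then have "s + dist x y \<in> R x" using s by (simp add: R_def)
      then have "Inf (R x) \<le> s + dist x y" by (rule cInf_lower[OF _ bddR])
      then show "Inf (R x) - dist x y \<le> s" by simp
    qed
    then show "hit_radius \<mu> M k x \<le> hit_radius \<mu> M k y + dist x y" by (simp add: r)
  qed
  \<comment> \<open>removes an error term that is at most \<open>A * \<eta> powr \<beta>\<close> for all small \<open>\<eta>\<close>\<close>
  have lim: "c \<le> b" if "\<And>\<eta>. 0 < \<eta> \<Longrightarrow> \<eta> \<le> \<eta>0 \<Longrightarrow> c \<le> b + A * \<eta> powr \<beta>" for b c :: real
  proof (rule tendsto_lowerbound)
    have "((\<lambda>\<eta>::real. \<eta> powr \<beta>) \<longlongrightarrow> 0) (at_right 0)"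
      using constants by real_asymp
    from tendsto_add[OF tendsto_const tendsto_mult[OF tendsto_const this]]
    show "((\<lambda>\<eta>. b + A * \<eta> powr \<beta>) \<longlongrightarrow> b) (at_right 0)" by simp
    show "\<forall>\<^sub>F \<eta> in at_right 0. c \<le> b + A * \<eta> powr \<beta>"
      unfolding eventually_at_right_field using that constants by (intro exI[of _ \<eta>0]) auto
  qed simp
  have props: "measure \<mu> (ball x (hit_radius \<mu> M k x)) = M k \<and> hit_radius \<mu> M k x \<le> t0"
    if x: "M k \<le> measure \<mu> (ball x t0)" for x
  proof
    let ?r = "hit_radius \<mu> M k x"
    have "t0 \<in> R x" using x t0 by (simp add: R_def)
    then show rt: "?r \<le> t0" unfolding r by (rule cInf_lower[OF _ bddR])
    have "M k \<le> measure \<mu> (ball x ?r)"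
    proof (rule lim)
      fix \<eta> assume \<eta>: "0 < \<eta>" "\<eta> \<le> \<eta>0"
      have "Inf (R x) < ?r + \<eta>" using \<eta> by (simp add: r)
      then obtain s where s: "s \<in> R x" "s < ?r + \<eta>" using cInf_lessD[of "R x"] bR by blast
      have "M k \<le> measure \<mu> (ball x s)" using s by (simp add: R_def)
      also have "\<dots> \<le> measure \<mu> (ball x (?r + \<eta>))"
        using s by (intro finite_measure_mono subset_ball) auto
      also have "\<dots> \<le> measure \<mu> (ball x ?r) + A * \<eta> powr \<beta>" by (rule annulus[OF rt \<eta>])
      finally show "M k \<le> measure \<mu> (ball x ?r) + A * \<eta> powr \<beta>" .
    qed
    moreover have "measure \<mu> (ball x ?r) \<le> M k"
    proof (rule lim)
      fix \<eta> assume \<eta>: "0 < \<eta>" "\<eta> \<le> \<eta>0"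
      have "measure \<mu> (ball x (?r - \<eta>)) \<le> M k"
      proof (cases "0 \<le> ?r - \<eta>")
        case True
        have "?r - \<eta> \<notin> R x"
        proof
          assume "?r - \<eta> \<in> R x"
          then have "?r \<le> ?r - \<eta>" unfolding r by (rule cInf_lower[OF _ bddR])
          then show False using \<eta> by simp
        qed
        then show ?thesis using True by (simp add: R_def)
      next
        case False
        then have "measure \<mu> (ball x (?r - \<eta>)) = 0" by (metis ball_empty less_le measure_empty not_le)
        then show ?thesis using Mk by simp
      qed
      moreover have "measure \<mu> (ball x ?r) \<le> measure \<mu> (ball x (?r - \<eta>)) + A * \<eta> powr \<beta>"
        using annulus[of "?r - \<eta>" \<eta> x] rt \<eta> by simp
      ultimately show "measure \<mu> (ball x ?r) \<le> M k + A * \<eta> powr \<beta>" by simp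
    qed
    ultimately show "measure \<mu> (ball x ?r) = M k" by simp
  qed
  show "AE x in \<mu>. measure \<mu> (ball x (hit_radius \<mu> M k x)) = M k"
    using ball_pos by eventually_elim (use props in blast)
  have "AE x in \<mu>. \<forall>\<eta>. 0 < \<eta> \<and> \<eta> \<le> \<eta>0 \<longrightarrow>
        measure \<mu> (ball x (hit_radius \<mu> M k x + \<eta>)) \<le> M k + A * \<eta> powr \<beta> \<and>
        M k - A * \<eta> powr \<beta> \<le> measure \<mu> (ball x (hit_radius \<mu> M k x - \<eta>))"
    using ball_pos
  proof eventually_elim
    case (elim x)
    let ?r = "hit_radius \<mu> M k x"
    note p = props[OF elim]
    show ?case
    proof (intro allI impI, elim conjE)
      fix \<eta> assume \<eta>: "0 < \<eta>" "\<eta> \<le> \<eta>0"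
      show "measure \<mu> (ball x (?r + \<eta>)) \<le> M k + A * \<eta> powr \<beta> \<and> M k - A * \<eta> powr \<beta> \<le> measure \<mu> (ball x (?r - \<eta>))"
        using annulus[of ?r \<eta> x] annulus[of "?r - \<eta>" \<eta> x] p \<eta> by simp
    qed
  qed
  then show "target (hit_radius \<mu> M k) (M k)" unfolding target_def using Mk lip by blast
qed

end

section \<open>Summing covariances\<close>

text \<open>
  Each of the three off-diagonal terms is summed first over the index that occurs in \<open>w\<close> or \<open>b\<close>, which
  leaves a multiple of the sum of \<open>\<phi>\<close>.
\<close>

lemma sum_pairs_le:
  fixes v :: "nat \<Rightarrow> nat \<Rightarrow> real"
  assumes S: "finite S"
    and \<phi>: "\<And>i. 0 \<le> \<phi> i" and w: "\<And>l. 0 \<le> w l" "summable w" and b: "\<And>i. 0 \<le> b i" "summable b"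
    and sym: "\<And>i j. v i j = v j i" and diag: "\<And>i. v i i \<le> B * \<phi> i"
    and off: "\<And>i l. 0 < l \<Longrightarrow> v i (i + l) \<le> \<phi> i * w l + \<phi> i * b (i + l) + \<phi> (i + l) * b i"
  shows "(\<Sum>i\<in>S. \<Sum>j\<in>S. v i j) \<le> (B + 2 * (suminf w + 2 * suminf b)) * (\<Sum>i\<in>S. \<phi> i)"
proof -
  define t where "t i j = (if i < j then \<phi> i * w (j - i) + \<phi> i * b j + \<phi> j * b i else 0)" for i j
  have v: "v i j \<le> (if j = i then B * \<phi> i else 0) + t i j + t j i" for i j
  proof -
    consider "i = j" | "i < j" | "j < i" by linarith
    then show ?thesis
    proof cases
      case 2
      then show ?thesis using off[of "j - i" i] by (simp add: t_def)
    next
      case 3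
      then show ?thesis using off[of "i - j" j] by (simp add: t_def sym[of i j])
    qed (simp add: t_def diag)
  qed
  have tb: "(\<Sum>i\<in>S. \<Sum>j\<in>S. t i j) \<le> (suminf w + 2 * suminf b) * (\<Sum>i\<in>S. \<phi> i)"
  proof -
    have bS: "(\<Sum>i\<in>S. b i) \<le> suminf b" by (rule sum_le_suminf[OF b(2) S]) (rule b(1))
    have wS: "(\<Sum>j\<in>S. if i < j then w (j - i) else 0) \<le> suminf w" for i
    proof -
      have "(\<Sum>j\<in>S. if i < j then w (j - i) else 0) = (\<Sum>j\<in>{j\<in>S. i < j}. w (j - i))"
        using S by (simp add: sum.inter_filter)
      also have "\<dots> = (\<Sum>l\<in>(\<lambda>j. j - i) ` {j\<in>S. i < j}. w l)"
        by (subst sum.reindex) (auto intro!: inj_onI)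
      also have "\<dots> \<le> suminf w" using S by (intro sum_le_suminf w) auto
      finally show ?thesis .
    qed
    have "(\<Sum>i\<in>S. \<Sum>j\<in>S. t i j) \<le> (\<Sum>i\<in>S. \<Sum>j\<in>S. \<phi> i * (if i < j then w (j - i) else 0) + \<phi> i * b j + \<phi> j * b i)"
      using \<phi> b by (intro sum_mono) (auto simp: t_def intro!: add_nonneg_nonneg mult_nonneg_nonneg)
    also have "\<dots> = (\<Sum>i\<in>S. \<phi> i * (\<Sum>j\<in>S. if i < j then w (j - i) else 0))
        + (\<Sum>i\<in>S. \<phi> i) * (\<Sum>j\<in>S. b j) + (\<Sum>j\<in>S. \<phi> j) * (\<Sum>i\<in>S. b i)"
      by (simp add: sum.distrib sum_distrib_left[symmetric] sum_distrib_right[symmetric])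
    also have "\<dots> \<le> (\<Sum>i\<in>S. \<phi> i * suminf w) + (\<Sum>i\<in>S. \<phi> i) * suminf b + (\<Sum>i\<in>S. \<phi> i) * suminf b"
      using wS bS \<phi> by (intro add_mono sum_mono mult_left_mono sum_nonneg) auto
    also have "\<dots> = (suminf w + 2 * suminf b) * (\<Sum>i\<in>S. \<phi> i)"
      unfolding sum_distrib_right[symmetric] by (simp add: algebra_simps)
    finally show ?thesis .
  qed
  have "(\<Sum>i\<in>S. \<Sum>j\<in>S. v i j) \<le> (\<Sum>i\<in>S. \<Sum>j\<in>S. (if j = i then B * \<phi> i else 0) + t i j + t j i)"
    using v by (intro sum_mono)
  also have "\<dots> = B * (\<Sum>i\<in>S. \<phi> i) + (\<Sum>i\<in>S. \<Sum>j\<in>S. t i j) + (\<Sum>i\<in>S. \<Sum>j\<in>S. t j i)"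
    using S by (simp add: sum.distrib sum_distrib_left)
  also have "(\<Sum>i\<in>S. \<Sum>j\<in>S. t j i) = (\<Sum>i\<in>S. \<Sum>j\<in>S. t i j)" by (rule sum.swap)
  finally show ?thesis using tb by (simp add: algebra_simps)
qed

text \<open>
  Here \<open>p k\<close> and \<open>Q j k\<close> stand for the measures of a return set and of an intersection of two. The two
  regimes are separated by \<open>l = (4 / \<eta>) ln k\<close>. Below it \<open>(ln k)\<^sup>-\<^sup>2\<close> is at most a multiple of \<open>l\<^sup>-\<^sup>2\<close>, and
  above it half of \<open>exp(-\<eta> l)\<close> is at most \<open>k\<^sup>-\<^sup>2\<close>. The numbers \<open>b\<close> collect the errors from centring at \<open>M k\<close>
  instead of \<open>p k\<close>.
\<close>

lemma recurrence_covariance_bound: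
  fixes p M :: "nat \<Rightarrow> real" and Q :: "nat \<Rightarrow> nat \<Rightarrow> real"
  assumes pos: "0 < B" "0 < \<eta>" "0 < C1" "0 < C2" "0 < \<delta>" "0 < N"
    and \<psi>: "\<And>l. 0 \<le> \<psi> l" "summable \<psi>"
    and p: "\<And>k. 0 \<le> p k" and M0: "\<And>k. k0 \<le> k \<Longrightarrow> 0 \<le> M k"
    and pM: "\<And>k. k0 \<le> k \<Longrightarrow> 0 < k \<Longrightarrow> \<bar>p k - M k\<bar> \<le> B * exp (- \<eta> * real k)"
    and mix: "\<And>k l. k0 \<le> k \<Longrightarrow> 0 < k \<Longrightarrow> 0 < l \<Longrightarrow>
      Q k (k + l) \<le> M k * M (k + l) + B * exp (- \<eta> * real k) * M (k + l) + B * exp (- \<eta> * real l)"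
    and short: "\<And>k l. 0 < k \<Longrightarrow> 0 < l \<Longrightarrow>
      Q k (k + l) \<le> C1 * p k powr (1 + \<delta>) * ln (real k) powr N + p k * \<psi> l"
    and M: "\<And>k. 2 \<le> k \<Longrightarrow> M k \<le> C2 * ln (real k) powr (- (2 + N) / \<delta>)"
  shows "\<exists>k1 w b. k0 \<le> k1 \<and> 0 < k1 \<and> (\<forall>l. 0 \<le> w l) \<and> summable w \<and> (\<forall>k. 0 \<le> b k) \<and> summable b \<and>
    (\<forall>k\<ge>k1. p k \<le> M k + 1 / (real k)\<^sup>2 \<and> (\<forall>l>0.
      Q k (k + l) - M k * p (k + l) - M (k + l) * p k + M k * M (k + l)
      \<le> (M k + 1 / (real k)\<^sup>2) * w l + (M k + 1 / (real k)\<^sup>2) * b (k + l)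
        + (M (k + l) + 1 / (real (k + l))\<^sup>2) * b k))"
proof -
  define q where "q = (2 + N) / \<delta>"
  have q: "0 < q" using pos by (simp add: q_def)
  have "\<forall>\<^sub>F k in sequentially. B * exp (- \<eta> * real k) \<le> 1 / (real k)\<^sup>2"
    using pos by real_asymp
  moreover have "\<forall>\<^sub>F k in sequentially. 1 / (real k)\<^sup>2 \<le> ln (real k) powr (- q)"
    using q by real_asymp
  moreover have "\<forall>\<^sub>F k in sequentially. max k0 3 \<le> k" by (rule eventually_ge_at_top)
  ultimately have "\<forall>\<^sub>F k in sequentially. B * exp (- \<eta> * real k) \<le> 1 / (real k)\<^sup>2 \<and>
      1 / (real k)\<^sup>2 \<le> ln (real k) powr (- q) \<and> max k0 3 \<le> k"
    by eventually_elim auto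
  then obtain k1 where k1: "\<And>k. k1 \<le> k \<Longrightarrow> B * exp (- \<eta> * real k) \<le> 1 / (real k)\<^sup>2"
      "\<And>k. k1 \<le> k \<Longrightarrow> 1 / (real k)\<^sup>2 \<le> ln (real k) powr (- q)" "\<And>k. k1 \<le> k \<Longrightarrow> max k0 3 \<le> k"
    unfolding eventually_sequentially by blast
  define \<phi> where "\<phi> k = M k + 1 / (real k)\<^sup>2" for k
  define C3 where "C3 = C1 * (C2 + 1) powr \<delta>"
  define C4 where "C4 = C3 * (4 / \<eta>)\<^sup>2"
  have C34: "0 < C3" "0 < C4" using pos by (simp_all add: C3_def C4_def)
  define w where "w l = C4 * (1 / (real l)\<^sup>2) + \<psi> l + B * exp (- (\<eta> / 2)) ^ l" for l
  define b where "b k = 2 * (1 / (real k)\<^sup>2)" for k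
  have sq: "summable (\<lambda>k. 1 / (real k)\<^sup>2)" using inverse_power_summable[of 2, where ?'a = real] by (simp add: inverse_eq_divide)
  have b: "\<And>k. 0 \<le> b k" "summable b" unfolding b_def by (simp, intro summable_mult sq)
  have w: "\<And>l. 0 \<le> w l" "summable w"
    unfolding w_def using C34 \<psi> pos by (simp, intro summable_add summable_mult sq \<psi> summable_geometric) auto
  have main: "p k \<le> \<phi> k \<and> (\<forall>l>0. Q k (k + l) - M k * p (k + l) - M (k + l) * p k + M k * M (k + l)
      \<le> \<phi> k * w l + \<phi> k * b (k + l) + \<phi> (k + l) * b k)" if k: "k1 \<le> k" for k
  proof -
    have k3: "3 \<le> k" "k0 \<le> k" using k1(3)[OF k] by auto
    have "(exp 1 :: real) \<le> 3" using exp_le by simp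
    then have ln1: "1 \<le> ln (real k)" using k3(1) by (subst ln_ge_iff) auto
    define e where "e j = B * exp (- \<eta> * real j)" for j :: nat
    have e0: "0 \<le> e j" for j using pos by (simp add: e_def)
    have e2: "e j \<le> 1 / (real j)\<^sup>2" if "k \<le> j" for j
      using k1(1)[of j] k that by (simp add: e_def)
    have pk: "\<bar>p j - M j\<bar> \<le> e j" if "k \<le> j" for j
      using pM[of j] k3 that by (simp add: e_def)
    have p1: "p k \<le> \<phi> k" using pk[of k] e2[of k] by (simp add: \<phi>_def)
    have Mk: "0 \<le> M j" "0 \<le> \<phi> j" if "k \<le> j" for j
      using M0[of j] k3 that by (auto simp: \<phi>_def)
    have off: "Q k (k + l) - M k * p (k + l) - M (k + l) * p k + M k * M (k + l)
      \<le> \<phi> k * w l + \<phi> k * b (k + l) + \<phi> (k + l) * b k" if l: "0 < l" for l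
    proof -
      let ?j = "k + l"
      have j: "k \<le> ?j" by simp
      have x1: "M k * (M ?j - p ?j) \<le> M k * e ?j"
        using pk[OF j] Mk(1)[of k] by (intro mult_left_mono) auto
      have x2: "M k * e ?j \<le> \<phi> k * (1 / (real ?j)\<^sup>2)"
        using e2[OF j] e0 Mk[of k] by (intro mult_mono) (auto simp: \<phi>_def)
      have x3: "M ?j * (M k - p k) \<le> M ?j * e k"
        using pk[of k] Mk(1)[OF j] by (intro mult_left_mono) auto
      have x4: "M ?j * e k \<le> \<phi> ?j * (1 / (real k)\<^sup>2)"
        using e2[of k] e0 Mk[OF j] by (intro mult_mono) (auto simp: \<phi>_def)
      have \<phi>k: "0 \<le> \<phi> k" "0 \<le> \<phi> ?j" using Mk by auto
      have n: "0 \<le> \<phi> k * (1 / (real ?j)\<^sup>2)" "0 \<le> \<phi> ?j * (1 / (real k)\<^sup>2)" using \<phi>k by auto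
      have x5: "\<phi> k * b ?j = 2 * (\<phi> k * (1 / (real ?j)\<^sup>2))" "\<phi> ?j * b k = 2 * (\<phi> ?j * (1 / (real k)\<^sup>2))"
        by (simp_all add: b_def)
      show ?thesis
      proof (cases "real l \<le> 4 / \<eta> * ln (real k)")
        case True
        have "p k \<le> C2 * ln (real k) powr (- q) + ln (real k) powr (- q)"
        proof -
          have "M k \<le> C2 * ln (real k) powr (- q)" using M[of k] k3(1) by (simp add: q_def minus_divide_left)
          then show ?thesis using pk[of k] e2[of k] k1(2)[OF k] by linarith
        qed
        then have "p k \<le> (C2 + 1) * ln (real k) powr (- q)" by (simp add: distrib_right)
        then have "p k powr \<delta> \<le> ((C2 + 1) * ln (real k) powr (- q)) powr \<delta>"
          using pos p by (intro powr_mono2) auto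
        also have "\<dots> = (C2 + 1) powr \<delta> * ln (real k) powr (- (2 + N))"
        proof -
          have "- q * \<delta> = - (2 + N)" using pos by (simp add: q_def)
          then show ?thesis using pos by (simp add: powr_mult powr_powr)
        qed
        finally have "p k powr \<delta> * ln (real k) powr N \<le> (C2 + 1) powr \<delta> * ln (real k) powr (- (2 + N)) * ln (real k) powr N"
          by (intro mult_right_mono) auto
        also have "\<dots> = (C2 + 1) powr \<delta> * (ln (real k) powr (- (2 + N)) * ln (real k) powr N)" by simp
        also have "ln (real k) powr (- (2 + N)) * ln (real k) powr N = ln (real k) powr (- 2)"
          by (simp add: powr_add[symmetric])
        also have "\<dots> = 1 / (ln (real k))\<^sup>2" using ln1 by (simp add: powr_minus powr_numeral inverse_eq_divide)
        also have "\<dots> \<le> (4 / \<eta>)\<^sup>2 * (1 / (real l)\<^sup>2)"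
        proof -
          have "(real l)\<^sup>2 \<le> (4 / \<eta> * ln (real k))\<^sup>2" using True by (intro power_mono) auto
          then show ?thesis using l ln1 pos by (simp add: power_mult_distrib field_simps)
        qed
        finally have "p k powr \<delta> * ln (real k) powr N \<le> (C2 + 1) powr \<delta> * ((4 / \<eta>)\<^sup>2 * (1 / (real l)\<^sup>2))"
          by (simp add: mult_left_mono)
        then have "C1 * p k * (p k powr \<delta> * ln (real k) powr N) \<le> C1 * p k * ((C2 + 1) powr \<delta> * ((4 / \<eta>)\<^sup>2 * (1 / (real l)\<^sup>2)))"
          using pos p by (intro mult_left_mono) auto
        also have "\<dots> = p k * (C4 * (1 / (real l)\<^sup>2))" by (simp add: C4_def C3_def)
        finally have "C1 * p k powr (1 + \<delta>) * ln (real k) powr N \<le> p k * (C4 * (1 / (real l)\<^sup>2))"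
          using p[of k] by (simp add: powr_add mult.assoc)
        then have "Q k ?j \<le> p k * (C4 * (1 / (real l)\<^sup>2) + \<psi> l)"
          using short[of k l] k3 l by (simp add: distrib_left)
        also have "\<dots> \<le> \<phi> k * w l"
          using p1 C34 \<psi>(1) pos \<phi>k by (intro mult_mono) (auto simp: w_def)
        finally have Q: "Q k ?j \<le> \<phi> k * w l" .
        have "0 \<le> M ?j * p k" using Mk(1)[OF j] p by simp
        moreover have "M k * (M ?j - p ?j) = M k * M ?j - M k * p ?j" by (rule right_diff_distrib)
        ultimately show ?thesis using Q x1 x2 x5 n by linarith
      next
        case False
        have "B * exp (- \<eta> * real l) = B * (exp (- (\<eta> / 2) * real l) * exp (- (\<eta> / 2) * real l))"
          by (simp add: exp_add[symmetric])
        also have "\<dots> \<le> B * (exp (- (2 * ln (real k))) * exp (- (\<eta> / 2)) ^ l)"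
        proof -
          have "2 * ln (real k) \<le> \<eta> / 2 * real l" using False pos by (simp add: field_simps)
          then have g: "exp (- (\<eta> / 2) * real l) \<le> exp (- (2 * ln (real k)))" by simp
          have eq: "exp (- (\<eta> / 2) * real l) = exp (- (\<eta> / 2)) ^ l"
            by (simp add: exp_of_nat_mult[symmetric] mult.commute)
          show ?thesis unfolding eq[symmetric]
            by (rule mult_left_mono[OF mult_right_mono[OF g]]) (use pos in auto)
        qed
        also have "exp (- (2 * ln (real k))) = 1 / (real k)\<^sup>2"
          using k3 by (simp add: exp_minus exp_double power2_eq_square inverse_eq_divide)
        also have "B * (1 / (real k)\<^sup>2 * exp (- (\<eta> / 2)) ^ l) = 1 / (real k)\<^sup>2 * (B * exp (- (\<eta> / 2)) ^ l)" by simp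
        also have "\<dots> \<le> \<phi> k * w l"
          using C34 \<psi>(1) pos Mk(1)[of k] by (intro mult_mono) (auto simp: \<phi>_def w_def)
        finally have y: "B * exp (- \<eta> * real l) \<le> \<phi> k * w l" .
        have "Q k ?j \<le> M k * M ?j + e k * M ?j + B * exp (- \<eta> * real l)"
          using mix[of k l] k3 l by (simp add: e_def)
        then have "Q k ?j - M k * p ?j - M ?j * p k + M k * M ?j
          \<le> M k * (M ?j - p ?j) + M ?j * (M k - p k) + M ?j * e k + B * exp (- \<eta> * real l)"
          by (simp add: algebra_simps)
        then show ?thesis using x1 x2 x3 x4 x5 n y by linarith
      qed
    qed
    show ?thesis using p1 off by blast
  qed
  have k01: "k0 \<le> k1" "0 < k1" using k1(3)[of k1] by auto
  have all: "\<forall>k\<ge>k1. p k \<le> \<phi> k \<and> (\<forall>l>0. Q k (k + l) - M k * p (k + l) - M (k + l) * p k + M k * M (k + l)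
      \<le> \<phi> k * w l + \<phi> k * b (k + l) + \<phi> (k + l) * b k)"
    using main by simp
  show ?thesis
  proof (rule exI[of _ k1], rule exI[of _ w], rule exI[of _ b], fold \<phi>_def, intro conjI)
    show "\<forall>l. 0 \<le> w l" "\<forall>k. 0 \<le> b k" using w(1) b(1) by simp_all
  qed (rule k01 w(2) b(2) all)+
qed

text \<open>
  The finitely many indices below \<open>k1\<close> are removed by setting their terms to zero, so that the bound
  holds for every block of times.
\<close>

lemma (in prob_space) centered_indicator_second_moment:
  fixes G :: "nat \<Rightarrow> 'a set" and m \<phi> w b :: "nat \<Rightarrow> real" and k1 :: nat
  assumes G: "\<And>k. k1 \<le> k \<Longrightarrow> G k \<in> events"
    and m: "\<And>k. k1 \<le> k \<Longrightarrow> 0 \<le> m k" "\<And>k. k1 \<le> k \<Longrightarrow> m k \<le> 1"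
    and \<phi>: "\<And>k. k1 \<le> k \<Longrightarrow> m k \<le> \<phi> k" "\<And>k. k1 \<le> k \<Longrightarrow> prob (G k) \<le> \<phi> k"
    and w: "\<And>l. 0 \<le> w l" "summable w" and b: "\<And>i. 0 \<le> b i" "summable b"
    and cov: "\<And>k l. k1 \<le> k \<Longrightarrow> 0 < l \<Longrightarrow>
      prob (G k \<inter> G (k + l)) - m k * prob (G (k + l)) - m (k + l) * prob (G k) + m k * m (k + l)
        \<le> \<phi> k * w l + \<phi> k * b (k + l) + \<phi> (k + l) * b k"
  shows "(\<integral>x. (\<Sum>k\<in>{i<..n}. (if k1 \<le> k then indicator (G k) x else 0) - (if k1 \<le> k then m k else 0))\<^sup>2 \<partial>M)
    \<le> (2 + 2 * (suminf w + 2 * suminf b)) * (\<Sum>k\<in>{i<..n}. if k1 \<le> k then \<phi> k else 0)"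
proof -
  define a where "a k x = (if k1 \<le> k then indicator (G k) x else 0) - (if k1 \<le> k then m k else 0)" for k x
  have int: "integrable M (\<lambda>x. a j x * a k x)" for j k
  proof (rule integrable_const_bound[of _ 1])
    have "\<bar>a k x\<bar> \<le> 1" for k x using m[of k] by (auto simp: a_def indicator_def)
    then show "AE x in M. norm (a j x * a k x) \<le> 1" by (simp add: abs_mult mult_le_one)
    have "a k \<in> borel_measurable M" for k
      unfolding a_def using G[of k] by (cases "k1 \<le> k") auto
    then show "(\<lambda>x. a j x * a k x) \<in> borel_measurable M" by measurable
  qed
  have formula: "(\<integral>x. a j x * a k x \<partial>M) = prob (G j \<inter> G k) - m j * prob (G k) - m k * prob (G j) + m j * m k"
    if "k1 \<le> j" "k1 \<le> k" for j k
  proof -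
    have s: "G j \<in> events" "G k \<in> events" using G that by auto
    have "(\<integral>x. a j x * a k x \<partial>M) = (\<integral>x. indicator (G j \<inter> G k) x - m j * indicator (G k) x - m k * indicator (G j) x + m j * m k \<partial>M)"
      using that by (intro Bochner_Integration.integral_cong) (auto simp: a_def indicator_def algebra_simps)
    also have "\<dots> = prob (G j \<inter> G k) - m j * prob (G k) - m k * prob (G j) + m j * m k"
    proof -
      have i: "integrable M (indicator H :: 'a \<Rightarrow> real)" if "H \<in> events" for H
        using that by (simp add: integrable_indicator_iff emeasure_eq_measure)
      show ?thesis using s i[of "G j \<inter> G k"] i[OF s(1)] i[OF s(2)]
        by (simp add: prob_space sets.Int)
    qed
    finally show ?thesis .
  qed
  have zero: "(\<integral>x. a j x * a k x \<partial>M) = 0" if "j < k1 \<or> k < k1" for j k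
    using that by (auto simp: a_def)
  let ?\<phi> = "\<lambda>k. if k1 \<le> k then \<phi> k else 0"
  have \<phi>0: "0 \<le> ?\<phi> k" for k using m(1)[of k] \<phi>(1)[of k] by auto
  have "(\<integral>x. (\<Sum>k\<in>{i<..n}. a k x)\<^sup>2 \<partial>M) = (\<Sum>j\<in>{i<..n}. \<Sum>k\<in>{i<..n}. (\<integral>x. a j x * a k x \<partial>M))"
    by (simp add: power2_eq_square sum_product int)
  also have "\<dots> \<le> (2 + 2 * (suminf w + 2 * suminf b)) * (\<Sum>k\<in>{i<..n}. ?\<phi> k)"
  proof (rule sum_pairs_le[OF _ \<phi>0 w b])
    show "(\<integral>x. a j x * a k x \<partial>M) = (\<integral>x. a k x * a j x \<partial>M)" for j k by (simp add: mult.commute)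
    show "(\<integral>x. a k x * a k x \<partial>M) \<le> 2 * ?\<phi> k" for k
    proof (cases "k1 \<le> k")
      case True
      have "m k * m k \<le> m k * 1" using m[OF True] by (intro mult_left_mono) auto
      moreover have "0 \<le> m k * prob (G k)" using m[OF True] by simp
      ultimately show ?thesis using True formula[OF True True] \<phi>[OF True] by simp
    qed (simp add: zero)
    show "(\<integral>x. a k x * a (k + l) x \<partial>M) \<le> ?\<phi> k * w l + ?\<phi> k * b (k + l) + ?\<phi> (k + l) * b k" if l: "0 < l" for k l
    proof (cases "k1 \<le> k")
      case True
      then show ?thesis using formula[of k "k + l"] cov[OF True l] by simp
    next
      case False
      have "0 \<le> ?\<phi> k * w l + ?\<phi> k * b (k + l) + ?\<phi> (k + l) * b k"
        using \<phi>0 w(1) b(1) by (intro add_nonneg_nonneg mult_nonneg_nonneg)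
      then show ?thesis using False zero[of k "k + l"] by simp
    qed
  qed simp
  finally show ?thesis by (simp add: a_def)
qed

section \<open>From second moments to almost sure asymptotics\<close>

text \<open>
  The series of the \<open>X r / c r\<close> has finite integral, so it converges almost everywhere, and its sum
  bounds every term.
\<close>

lemma AE_le_of_summable_integrals:
  fixes X :: "nat \<Rightarrow> 'a \<Rightarrow> real"
  assumes X: "\<And>r. integrable M (X r)" "\<And>r x. 0 \<le> X r x" and c: "\<And>r. 0 < c r"
    and sum: "summable (\<lambda>r. (\<integral>x. X r x \<partial>M) / c r)"
  shows "AE x in M. \<exists>b\<ge>0. \<forall>r. X r x \<le> b * c r"
proof -
  have [measurable]: "X r \<in> borel_measurable M" for r using X(1) by (rule borel_measurable_integrable)
  have nn: "0 \<le> X r x / c r" for r x using X(2) c[of r] by (simp add: less_imp_le)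
  have "(\<integral>\<^sup>+x. (\<Sum>r. ennreal (X r x / c r)) \<partial>M) = (\<Sum>r. \<integral>\<^sup>+x. ennreal (X r x / c r) \<partial>M)"
    by (rule nn_integral_suminf) measurable
  also have "\<dots> = (\<Sum>r. ennreal ((\<integral>x. X r x \<partial>M) / c r))"
    by (intro suminf_cong) (subst nn_integral_eq_integral, auto intro!: X(1) nn)
  also have "\<dots> = ennreal (\<Sum>r. (\<integral>x. X r x \<partial>M) / c r)"
    using X c by (intro suminf_ennreal2 sum divide_nonneg_pos Bochner_Integration.integral_nonneg) auto
  finally have "(\<integral>\<^sup>+x. (\<Sum>r. ennreal (X r x / c r)) \<partial>M) \<noteq> \<infinity>" by simp
  then have "AE x in M. (\<Sum>r. ennreal (X r x / c r)) \<noteq> \<infinity>"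
    by (intro nn_integral_PInf_AE) measurable
  then show ?thesis
  proof eventually_elim
    case (elim x)
    let ?b = "enn2real (\<Sum>r. ennreal (X r x / c r))"
    have "X r x \<le> ?b * c r" for r
    proof -
      have "ennreal (X r x / c r) \<le> (\<Sum>r. ennreal (X r x / c r))"
        using sum_le_suminf[OF summableI, of "{r}" "\<lambda>r. ennreal (X r x / c r)"] by simp
      also have "\<dots> = ennreal ?b" using elim by (simp add: less_top)
      finally have "X r x / c r \<le> ?b" by (simp add: ennreal_le_iff)
      then show ?thesis using c[of r] by (simp add: pos_divide_le_eq)
    qed
    then show ?case by (intro exI[of _ ?b]) simp
  qed
qed

text \<open>
  The binary expansion of \<open>v\<close> writes \<open>a v\<close> as a sum of at most one increment over a dyadic interval of
  each length \<open>2 ^ s\<close>. The Cauchy-Schwarz inequality over the \<open>r\<close> levels then gives the bound, uniformly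
  in \<open>v\<close>.
\<close>

lemma dyadic_chaining:
  fixes a :: "nat \<Rightarrow> real"
  assumes a0: "a 0 = 0" and v: "v < 2 ^ r"
  shows "(a v)\<^sup>2 \<le> real r * (\<Sum>s<r. \<Sum>i<2 ^ (r - s). (a (Suc i * 2 ^ s) - a (i * 2 ^ s))\<^sup>2)"
proof -
  define R where "R s = (\<Sum>i<2 ^ (r - s). (a (Suc i * 2 ^ s) - a (i * 2 ^ s))\<^sup>2)" for s :: nat
  have step: "\<bar>a (v div 2 ^ s * 2 ^ s) - a (v div 2 ^ Suc s * 2 ^ Suc s)\<bar> \<le> sqrt (R s)" if s: "s < r" for s
  proof -
    define u where "u = v div 2 ^ Suc s"
    have half: "u = v div 2 ^ s div 2" unfolding u_def power_Suc2 by (rule div_mult2_eq)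
    show ?thesis
    proof (cases "even (v div 2 ^ s)")
      case True
      then have ev: "v div 2 ^ s = u * 2" using half by simp
      have "0 \<le> R s" unfolding R_def by (intro sum_nonneg) simp
      then show ?thesis unfolding u_def[symmetric] ev by (simp add: mult.assoc)
    next
      case False
      then have odd: "v div 2 ^ s = Suc (u * 2)" using odd_two_times_div_two_succ[OF False] unfolding half by linarith
      have "v < 2 ^ (r - s) * 2 ^ s" using v s by (simp add: power_add[symmetric])
      then have "v div 2 ^ s < 2 ^ (r - s)" by (simp add: less_mult_imp_div_less)
      then have "u * 2 < 2 ^ (r - s)" using odd by simp
      then have "(a (Suc (u * 2) * 2 ^ s) - a (u * 2 * 2 ^ s))\<^sup>2 \<le> R s"
        unfolding R_def by (intro member_le_sum) auto
      then have "\<bar>a (Suc (u * 2) * 2 ^ s) - a (u * 2 * 2 ^ s)\<bar> \<le> sqrt (R s)"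
        by (metis real_sqrt_abs real_sqrt_le_iff)
      then show ?thesis unfolding u_def[symmetric] odd by (simp add: mult.assoc)
    qed
  qed
  have "\<bar>a v - a (v div 2 ^ s * 2 ^ s)\<bar> \<le> (\<Sum>t<s. sqrt (R t))" if "s \<le> r" for s
    using that
  proof (induction s)
    case (Suc s)
    then show ?case using step[of s] by simp
  qed simp
  from this[of r] have "\<bar>a v\<bar> \<le> (\<Sum>t<r. sqrt (R t))" using v a0 by simp
  then have "(a v)\<^sup>2 \<le> (\<Sum>t<r. sqrt (R t))\<^sup>2"
    by (metis abs_ge_zero power2_abs power_mono)
  also have "\<dots> \<le> (\<Sum>t<r. (sqrt (R t))\<^sup>2) * real (card {..<r})"
    by (rule sum_squared_le_sum_of_squares)
  also have "(\<Sum>t<r. (sqrt (R t))\<^sup>2) = (\<Sum>t<r. R t)"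
    unfolding R_def by (intro sum.cong refl real_sqrt_pow2 sum_nonneg) auto
  finally show ?thesis by (simp add: R_def mult.commute)
qed

text \<open>
  Times at which the normalisation \<open>\<Sum> \<phi>\<close> passes the integers. They make the dyadic argument one in
  terms of the value of the normalisation rather than the number of summands.
\<close>

lemma first_passage:
  fixes \<phi> :: "nat \<Rightarrow> real"
  assumes \<phi>: "\<And>k. 0 \<le> \<phi> k" "\<And>k. \<phi> k \<le> 2"
    and div: "filterlim (\<lambda>n. \<Sum>k=1..n. \<phi> k) at_top sequentially"
  obtains n :: "nat \<Rightarrow> nat" where "n 0 = 0" "mono n" "\<And>v. real v \<le> (\<Sum>k=1..n v. \<phi> k)"
    "\<And>v. (\<Sum>k=1..n v. \<phi> k) \<le> real v + 2" "\<And>v m. real v \<le> (\<Sum>k=1..m. \<phi> k) \<Longrightarrow> n v \<le> m"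
proof
  define \<Phi> where "\<Phi> m = (\<Sum>k=1..m. \<phi> k)" for m :: nat
  define n where "n v = (LEAST m. real v \<le> \<Phi> m)" for v :: nat
  have "\<exists>m. real v \<le> \<Phi> m" for v
    using div[unfolded filterlim_at_top, rule_format, of "real v"] eventually_sequentially
    unfolding \<Phi>_def by (auto simp: eventually_sequentially)
  then have n: "real v \<le> \<Phi> (n v)" for v unfolding n_def by (rule LeastI_ex)
  have le: "n v \<le> m" if "real v \<le> \<Phi> m" for v m unfolding n_def using that by (rule Least_le)
  show "n 0 = 0" using le[of 0 0] by (simp add: \<Phi>_def)
  show "mono n"
  proof (rule monoI)
    fix u v :: nat assume "u \<le> v"
    then have "real u \<le> \<Phi> (n v)" using n[of v] by linarith
    then show "n u \<le> n v" by (rule le)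
  qed
  show "real v \<le> (\<Sum>k=1..n v. \<phi> k)" for v using n by (simp add: \<Phi>_def)
  show "n v \<le> m" if "real v \<le> (\<Sum>k=1..m. \<phi> k)" for v m using le that by (simp add: \<Phi>_def)
  show "(\<Sum>k=1..n v. \<phi> k) \<le> real v + 2" for v
  proof (cases "n v")
    case (Suc m)
    then have "\<not> real v \<le> \<Phi> m" using le[of v m] by auto
    then show ?thesis using Suc \<phi>(2)[of "Suc m"] by (simp add: \<Phi>_def)
  qed simp
qed

lemma sum_Icc_diff:
  fixes f :: "nat \<Rightarrow> real"
  assumes "m \<le> n"
  shows "(\<Sum>k=1..n. f k) - (\<Sum>k=1..m. f k) = (\<Sum>k\<in>{m<..n}. f k)"
proof -
  have "{1..n} = {1..m} \<union> {m<..n}" using assms by auto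
  then have "(\<Sum>k=1..n. f k) = (\<Sum>k=1..m. f k) + (\<Sum>k\<in>{m<..n}. f k)"
    by (simp only:) (rule sum.union_disjoint, auto)
  then show ?thesis by simp
qed

text \<open>
  On each of the \<open>r\<close> levels the second moment bounds of the blocks telescope to \<open>K\<close> times the total
  normalisation, which is about \<open>2 ^ r\<close>.
\<close>

lemma (in prob_space) dyadic_second_moment:
  fixes f :: "nat \<Rightarrow> 'a \<Rightarrow> real" and g \<phi> :: "nat \<Rightarrow> real"
  assumes f: "\<And>k. f k \<in> borel_measurable M" "\<And>k x. 0 \<le> f k x" "\<And>k x. f k x \<le> 1"
    and K: "0 \<le> K"
    and moment: "\<And>m n. m \<le> n \<Longrightarrow>
      (\<integral>x. (\<Sum>k\<in>{m<..n}. f k x - g k)\<^sup>2 \<partial>M) \<le> K * (\<Sum>k\<in>{m<..n}. \<phi> k)"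
    and n: "n 0 = 0" "mono n" "\<And>v. (\<Sum>k=1..n v. \<phi> k) \<le> real v + 2"
  defines "a \<equiv> \<lambda>v x. \<Sum>k=1..n v. f k x - g k"
  defines "X \<equiv> \<lambda>r x. \<Sum>s<r. \<Sum>i<2 ^ (r - s). (a (Suc i * 2 ^ s) x - a (i * 2 ^ s) x)\<^sup>2"
  shows "integrable M (X r)" and "(\<integral>x. X r x \<partial>M) \<le> 3 * K * real r * 2 ^ r"
proof -
  have a: "a u x - a v x = (\<Sum>k\<in>{n v<..n u}. f k x - g k)" if "v \<le> u" for u v x
    unfolding a_def using sum_Icc_diff[OF monoD[OF n(2) that]] by simp
  have int: "integrable M (\<lambda>x. (a u x - a v x)\<^sup>2)" for u v
  proof (rule integrable_const_bound)
    have bd: "\<bar>a v x\<bar> \<le> (\<Sum>k=1..n v. 1 + \<bar>g k\<bar>)" for v x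
    proof -
      have "\<bar>f k x - g k\<bar> \<le> 1 + \<bar>g k\<bar>" for k using f(2)[of k x] f(3)[of k x] by linarith
      then have "(\<Sum>k=1..n v. \<bar>f k x - g k\<bar>) \<le> (\<Sum>k=1..n v. 1 + \<bar>g k\<bar>)" by (rule sum_mono)
      then show ?thesis unfolding a_def by (rule order_trans[OF sum_abs])
    qed
    have "\<bar>a u x - a v x\<bar> \<le> (\<Sum>k=1..n u. 1 + \<bar>g k\<bar>) + (\<Sum>k=1..n v. 1 + \<bar>g k\<bar>)" for x
      using abs_triangle_ineq4[of "a u x" "a v x"] bd[of u x] bd[of v x] by linarith
    then have "(a u x - a v x)\<^sup>2 \<le> ((\<Sum>k=1..n u. 1 + \<bar>g k\<bar>) + (\<Sum>k=1..n v. 1 + \<bar>g k\<bar>))\<^sup>2" for x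
      by (metis abs_ge_zero power2_abs power_mono)
    then show "AE x in M. norm ((a u x - a v x)\<^sup>2) \<le> ((\<Sum>k=1..n u. 1 + \<bar>g k\<bar>) + (\<Sum>k=1..n v. 1 + \<bar>g k\<bar>))\<^sup>2"
      by simp
    show "(\<lambda>x. (a u x - a v x)\<^sup>2) \<in> borel_measurable M"
      unfolding a_def using f(1) by measurable
  qed
  show "integrable M (X r)" unfolding X_def by (intro Bochner_Integration.integrable_sum int)
  define \<Phi> where "\<Phi> v = (\<Sum>k=1..n v. \<phi> k)" for v
  have "(\<integral>x. X r x \<partial>M) = (\<Sum>s<r. \<Sum>i<2 ^ (r - s). (\<integral>x. (a (Suc i * 2 ^ s) x - a (i * 2 ^ s) x)\<^sup>2 \<partial>M))"
    unfolding X_def by (simp add: int)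
  also have "\<dots> \<le> (\<Sum>s<r. \<Sum>i<2 ^ (r - s). K * (\<Phi> (Suc i * 2 ^ s) - \<Phi> (i * 2 ^ s)))"
  proof (intro sum_mono)
    fix s i
    have le: "i * 2 ^ s \<le> Suc i * 2 ^ s" by simp
    have "(\<integral>x. (a (Suc i * 2 ^ s) x - a (i * 2 ^ s) x)\<^sup>2 \<partial>M)
       = (\<integral>x. (\<Sum>k\<in>{n (i * 2 ^ s)<..n (Suc i * 2 ^ s)}. f k x - g k)\<^sup>2 \<partial>M)"
      using a[OF le] by simp
    also have "\<dots> \<le> K * (\<Sum>k\<in>{n (i * 2 ^ s)<..n (Suc i * 2 ^ s)}. \<phi> k)"
      by (rule moment[OF monoD[OF n(2) le]])
    also have "\<dots> = K * (\<Phi> (Suc i * 2 ^ s) - \<Phi> (i * 2 ^ s))"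
      unfolding \<Phi>_def using sum_Icc_diff[OF monoD[OF n(2) le], of \<phi>] by simp
    finally show "(\<integral>x. (a (Suc i * 2 ^ s) x - a (i * 2 ^ s) x)\<^sup>2 \<partial>M)
       \<le> K * (\<Phi> (Suc i * 2 ^ s) - \<Phi> (i * 2 ^ s))" .
  qed
  also have "\<dots> = (\<Sum>s<r. K * \<Phi> (2 ^ r))"
  proof (rule sum.cong[OF refl])
    fix s assume "s \<in> {..<r}"
    then have "(2::nat) ^ (r - s) * 2 ^ s = 2 ^ r" by (simp add: power_add[symmetric])
    moreover have "\<Phi> 0 = 0" by (simp add: \<Phi>_def n(1))
    ultimately show "(\<Sum>i<2 ^ (r - s). K * (\<Phi> (Suc i * 2 ^ s) - \<Phi> (i * 2 ^ s))) = K * \<Phi> (2 ^ r)"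
      using sum_lessThan_telescope[of "\<lambda>i. \<Phi> (i * 2 ^ s)" "2 ^ (r - s)"]
      by (simp add: sum_distrib_left[symmetric])
  qed
  also have "\<dots> = real r * (K * \<Phi> (2 ^ r))" by simp
  also have "\<dots> \<le> real r * (K * (3 * 2 ^ r))"
  proof (intro mult_left_mono)
    have "(1::real) \<le> 2 ^ r" by simp
    moreover have "\<Phi> (2 ^ r) \<le> 2 ^ r + 2" using n(3)[of "2 ^ r"] by (simp add: \<Phi>_def)
    ultimately show "\<Phi> (2 ^ r) \<le> 3 * 2 ^ r" by linarith
  qed (use K in auto)
  finally show "(\<integral>x. X r x \<partial>M) \<le> 3 * K * real r * 2 ^ r" by (simp add: mult_ac)
qed

lemma dyadic_level_bound:
  fixes v r :: nat and \<Phi> q :: real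
  assumes \<Phi>: "exp 1 \<le> \<Phi>" and v: "real v \<le> \<Phi>" and r: "2 ^ r \<le> v + 1" and q: "0 < q"
  shows "sqrt (2 ^ Suc r) * (real (Suc r) + 1) powr q \<le> 2 * 5 powr q * (sqrt \<Phi> * ln \<Phi> powr q)"
proof -
  have e: "(2::real) \<le> exp 1" using exp_ge_add_one_self[of 1] by simp
  then have \<Phi>2: "2 \<le> \<Phi>" using \<Phi> by simp
  have ln: "1 \<le> ln \<Phi>" using \<Phi> \<Phi>2 by (simp add: ln_ge_iff)
  have "(2::real) ^ r \<le> real (v + 1)" using r by (metis of_nat_le_iff of_nat_numeral of_nat_power)
  then have 2: "(2::real) ^ r \<le> 2 * \<Phi>" using v \<Phi>2 by simp
  then have "sqrt (2 ^ Suc r) \<le> sqrt (2\<^sup>2 * \<Phi>)" by (intro real_sqrt_le_mono) simp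
  then have 1: "sqrt (2 ^ Suc r) \<le> 2 * sqrt \<Phi>" by (simp add: real_sqrt_mult)
  have "ln (2 ^ r) \<le> ln (2 * \<Phi>)" using 2 by (subst ln_le_cancel_iff) (use \<Phi>2 in auto)
  then have "real r * ln 2 \<le> ln 2 + ln \<Phi>" using \<Phi>2 by (simp add: ln_realpow ln_mult)
  moreover have "1/2 \<le> ln (2::real)" using ln2_ge_two_thirds by simp
  ultimately have "(real r - 1) * (1/2) \<le> ln \<Phi>"
  proof (cases "1 \<le> real r")
    case True
    then have "(real r - 1) * (1/2) \<le> (real r - 1) * ln 2" using \<open>1/2 \<le> ln 2\<close> by (intro mult_left_mono) auto
    moreover have "(real r - 1) * ln 2 = real r * ln 2 - ln 2" by (simp add: left_diff_distrib)
    ultimately show ?thesis using \<open>real r * ln 2 \<le> _\<close> by linarith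
  qed (use ln in auto)
  then have "real (Suc r) + 1 \<le> 5 * ln \<Phi>" using ln by simp
  then have "(real (Suc r) + 1) powr q \<le> (5 * ln \<Phi>) powr q" using q by (intro powr_mono2) auto
  also have "\<dots> = 5 powr q * ln \<Phi> powr q" using ln by (simp add: powr_mult)
  finally have "sqrt (2 ^ Suc r) * (real (Suc r) + 1) powr q \<le> (2 * sqrt \<Phi>) * (5 powr q * ln \<Phi> powr q)"
    using 1 \<Phi>2 by (intro mult_mono) auto
  then show ?thesis by (simp add: mult_ac)
qed

text \<open>
  By Markov's inequality in summed form, the dyadic square sums up to level \<open>r\<close> are
  \<open>O(2 ^ r (r + 1) powr (2 + 2\<epsilon>))\<close> almost surely. Chaining costs another factor \<open>r\<close>, and the square root
  gives the exponent \<open>3/2 + \<epsilon>\<close> of the logarithm at the first passage times. In between, monotonicity of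
  both sums costs at most \<open>3\<close>.
\<close>

lemma (in prob_space) quantitative_borel_cantelli:
  fixes f :: "nat \<Rightarrow> 'a \<Rightarrow> real" and g \<phi> :: "nat \<Rightarrow> real"
  assumes f: "\<And>k. f k \<in> borel_measurable M" "\<And>k x. 0 \<le> f k x" "\<And>k x. f k x \<le> 1"
    and g: "\<And>k. 0 \<le> g k" "\<And>k. g k \<le> \<phi> k" and \<phi>: "\<And>k. \<phi> k \<le> 2"
    and K: "0 \<le> K"
    and moment: "\<And>m n. m \<le> n \<Longrightarrow>
      (\<integral>x. (\<Sum>k\<in>{m<..n}. f k x - g k)\<^sup>2 \<partial>M) \<le> K * (\<Sum>k\<in>{m<..n}. \<phi> k)"
    and div: "filterlim (\<lambda>n. \<Sum>k=1..n. \<phi> k) at_top sequentially"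
    and \<epsilon>: "0 < \<epsilon>"
  shows "AE x in M. (\<lambda>n. \<Sum>k=1..n. f k x - g k)
    \<in> O(\<lambda>n. sqrt (\<Sum>k=1..n. \<phi> k) * ln (\<Sum>k=1..n. \<phi> k) powr (3 / 2 + \<epsilon>))"
proof -
  have \<phi>0: "0 \<le> \<phi> k" for k using g order_trans by blast
  obtain n where n: "n 0 = 0" "mono n" "\<And>v. real v \<le> (\<Sum>k=1..n v. \<phi> k)"
    "\<And>v. (\<Sum>k=1..n v. \<phi> k) \<le> real v + 2" "\<And>v m. real v \<le> (\<Sum>k=1..m. \<phi> k) \<Longrightarrow> n v \<le> m"
    using first_passage[OF \<phi>0 \<phi> div] by blast
  define \<Phi> where "\<Phi> m = (\<Sum>k=1..m. \<phi> k)" for m :: nat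
  define S where "S m x = (\<Sum>k=1..m. f k x - g k)" for m x
  define X where "X r x = (\<Sum>s<r. \<Sum>i<2 ^ (r - s). (S (n (Suc i * 2 ^ s)) x - S (n (i * 2 ^ s)) x)\<^sup>2)" for r :: nat and x
  note X = dyadic_second_moment[OF f K moment n(1,2,4), folded S_def, folded X_def]
  define q where "q = 3 / 2 + \<epsilon>"
  define c where "c r = 2 ^ r * (real r + 1) powr (2 + 2 * \<epsilon>)" for r :: nat
  have "AE x in M. \<exists>b\<ge>0. \<forall>r. X r x \<le> b * c r"
  proof (rule AE_le_of_summable_integrals)
    show "integrable M (X r)" for r by (rule X(1))
    show "0 \<le> X r x" for r x unfolding X_def by (intro sum_nonneg) simp
    show "0 < c r" for r by (simp add: c_def)
    show "summable (\<lambda>r. (\<integral>x. X r x \<partial>M) / c r)"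
    proof (rule summable_comparison_test)
      have "summable (\<lambda>r. real (Suc r) powr (- 1 - 2 * \<epsilon>))"
        using \<epsilon> by (subst summable_Suc_iff) (simp add: summable_real_powr_iff)
      then show "summable (\<lambda>r. 3 * K * real (Suc r) powr (- 1 - 2 * \<epsilon>))" by (rule summable_mult)
      have "norm ((\<integral>x. X r x \<partial>M) / c r) \<le> 3 * K * real (Suc r) powr (- 1 - 2 * \<epsilon>)" for r
      proof -
        have "0 \<le> (\<integral>x. X r x \<partial>M)" by (intro Bochner_Integration.integral_nonneg) (auto simp: X_def intro!: sum_nonneg)
        then have "norm ((\<integral>x. X r x \<partial>M) / c r) = (\<integral>x. X r x \<partial>M) / c r" by (simp add: c_def)
        also have "\<dots> \<le> (3 * K * (real r + 1) * 2 ^ r) / c r"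
          using X(2)[of r] K by (intro divide_right_mono order_trans[OF X(2)] mult_right_mono mult_left_mono) (auto simp: c_def)
        also have "\<dots> = 3 * K * ((real r + 1) powr 1 / (real r + 1) powr (2 + 2 * \<epsilon>))"
          by (simp add: c_def)
        also have "(real r + 1) powr 1 / (real r + 1) powr (2 + 2 * \<epsilon>) = (real r + 1) powr (- 1 - 2 * \<epsilon>)"
          by (subst powr_diff[symmetric]) simp
        finally show ?thesis by (simp add: add.commute)
      qed
      then show "\<exists>N. \<forall>r\<ge>N. norm ((\<integral>x. X r x \<partial>M) / c r) \<le> 3 * K * real (Suc r) powr (- 1 - 2 * \<epsilon>)"
        by blast
    qed
  qed
  then show ?thesis
  proof eventually_elim
    case (elim x)
    then obtain b where b: "0 \<le> b" "\<And>r. X r x \<le> b * c r" by blast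
    have a: "\<bar>S (n v) x\<bar> \<le> sqrt b * (sqrt (2 ^ r) * (real r + 1) powr q)" if "v < 2 ^ r" for v r
    proof -
      have "(S (n v) x)\<^sup>2 \<le> real r * X r x"
        unfolding X_def using dyadic_chaining[of "\<lambda>v. S (n v) x", OF _ that] by (simp add: n(1) S_def)
      also have "\<dots> \<le> (real r + 1) * (b * c r)"
        using b c_def by (intro mult_mono b(2)) (auto simp: X_def intro!: sum_nonneg)
      also have "\<dots> = b * (2 ^ r * ((real r + 1) powr 1 * (real r + 1) powr (2 + 2 * \<epsilon>)))"
        by (simp add: c_def)
      also have "(real r + 1) powr 1 * (real r + 1) powr (2 + 2 * \<epsilon>) = ((real r + 1) powr q)\<^sup>2"
        unfolding power2_eq_square powr_add[symmetric] q_def by simp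
      finally have "\<bar>S (n v) x\<bar> \<le> sqrt (b * (2 ^ r * ((real r + 1) powr q)\<^sup>2))"
        by (simp add: real_le_rsqrt)
      then show ?thesis by (simp add: real_sqrt_mult)
    qed
    have sandwich: "\<bar>S m x\<bar> \<le> \<bar>S (n v) x\<bar> + \<bar>S (n (Suc v)) x\<bar> + 3" if v: "real v \<le> \<Phi> m" "\<Phi> m < real (Suc v)" for m v
    proof -
      have lo: "n v \<le> m" using v(1) n(5) by (simp add: \<Phi>_def)
      have hi: "m \<le> n (Suc v)"
      proof (rule ccontr)
        assume "\<not> m \<le> n (Suc v)"
        then have "(\<Sum>k=1..n (Suc v). \<phi> k) \<le> \<Phi> m" unfolding \<Phi>_def using \<phi>0 by (intro sum_mono2) auto
        then show False using n(3)[of "Suc v"] v(2) by linarith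
      qed
      have F: "(\<Sum>k=1..n v. f k x) \<le> (\<Sum>k=1..m. f k x)" "(\<Sum>k=1..m. f k x) \<le> (\<Sum>k=1..n (Suc v). f k x)"
        using lo hi f(2) by (auto intro!: sum_mono2)
      have G: "(\<Sum>k=1..n v. g k) \<le> (\<Sum>k=1..m. g k)" "(\<Sum>k=1..m. g k) \<le> (\<Sum>k=1..n (Suc v). g k)"
        using lo hi g(1) by (auto intro!: sum_mono2)
      have "(\<Sum>k=1..n (Suc v). g k) - (\<Sum>k=1..n v. g k) \<le> (\<Sum>k=1..n (Suc v). \<phi> k) - (\<Sum>k=1..n v. \<phi> k)"
        using sum_Icc_diff[OF order_trans[OF lo hi], of g] sum_Icc_diff[OF order_trans[OF lo hi], of \<phi>] g(2)
        by (simp add: sum_mono)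
      also have "\<dots> \<le> 3" using n(3)[of v] n(4)[of "Suc v"] by simp
      finally show ?thesis using F G unfolding S_def sum_subtractf by linarith
    qed
    have "\<forall>\<^sub>F m in sequentially. exp 1 \<le> \<Phi> m"
      using div unfolding filterlim_at_top \<Phi>_def by blast
    then have "\<forall>\<^sub>F m in sequentially. norm (S m x) \<le>
        (4 * sqrt b * 5 powr q + 3) * norm (sqrt (\<Phi> m) * ln (\<Phi> m) powr q)"
    proof eventually_elim
      case (elim m)
      define v where "v = nat \<lfloor>\<Phi> m\<rfloor>"
      have e: "(2::real) \<le> exp 1" using exp_ge_add_one_self[of 1] by simp
      then have \<Phi>: "2 \<le> \<Phi> m" using elim by linarith
      have v: "real v \<le> \<Phi> m" "\<Phi> m < real (Suc v)" unfolding v_def using \<Phi> by linarith+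
      \<comment> \<open>\<open>r + 1\<close> is the least level that contains both \<open>v\<close> and \<open>v + 1\<close>\<close>
      obtain r where r: "2 ^ r \<le> v + 1" "v + 1 < 2 ^ (r + 1)" using ex_power_ivl1[of 2 "v + 1"] by auto
      define Z where "Z = sqrt (\<Phi> m) * ln (\<Phi> m) powr q"
      have q: "0 < q" using \<epsilon> by (simp add: q_def)
      have ln: "1 \<le> ln (\<Phi> m)" using elim \<Phi> by (simp add: ln_ge_iff)
      have "1 \<le> sqrt (\<Phi> m)" using \<Phi> by simp
      moreover have "1 \<le> ln (\<Phi> m) powr q" using ln q by (simp add: ge_one_powr_ge_zero)
      ultimately have Z: "1 \<le> Z" unfolding Z_def using mult_mono[of 1 "sqrt (\<Phi> m)" 1 "ln (\<Phi> m) powr q"] by simp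
      have lev: "sqrt (2 ^ Suc r) * (real (Suc r) + 1) powr q \<le> 2 * 5 powr q * Z"
        unfolding Z_def by (rule dyadic_level_bound[OF elim v(1) r(1) q])
      have A: "\<bar>S (n u) x\<bar> \<le> sqrt b * (2 * 5 powr q * Z)" if "u < 2 ^ Suc r" for u
        using a[OF that] mult_left_mono[OF lev, of "sqrt b"] b(1) by simp
      have "\<bar>S m x\<bar> \<le> sqrt b * (2 * 5 powr q * Z) + sqrt b * (2 * 5 powr q * Z) + 3"
      proof -
        have "v < 2 ^ Suc r" "Suc v < 2 ^ Suc r" using r(2) by simp_all
        then show ?thesis using sandwich[OF v] A[of v] A[of "Suc v"] by linarith
      qed
      also have "\<dots> \<le> (4 * sqrt b * 5 powr q + 3) * Z" using Z by (simp add: algebra_simps)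
      finally show ?case using Z by (simp add: Z_def)
    qed
    then show ?case unfolding S_def \<Phi>_def q_def by (rule bigoI)
  qed
qed

section \<open>Counting returns\<close>

text \<open>
  Bounded changes of the sum and of its normalisation are absorbed, because the normalisation tends to
  infinity.
\<close>

lemma bigo_bounded_perturbation:
  fixes R S \<Phi> E :: "nat \<Rightarrow> real"
  assumes S: "S \<in> O(\<lambda>n. sqrt (\<Phi> n) * ln (\<Phi> n) powr q)" and q: "0 < q"
    and \<Phi>E: "\<And>n. \<bar>\<Phi> n - E n\<bar> \<le> L" and RS: "\<And>n. \<bar>R n - S n\<bar> \<le> L"
    and E: "filterlim E at_top sequentially"
  shows "R \<in> O(\<lambda>n. sqrt (E n) * ln (E n) powr q)"
proof -
  have L: "0 \<le> L" using \<Phi>E[of 0] by simp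
  obtain c where c: "0 < c" "\<forall>\<^sub>F n in sequentially. norm (S n) \<le> c * norm (sqrt (\<Phi> n) * ln (\<Phi> n) powr q)"
    using landau_o.bigE[OF S] by blast
  have "\<forall>\<^sub>F n in sequentially. max (exp 1) (2 * L + 2) \<le> E n"
    using E unfolding filterlim_at_top by blast
  then have "\<forall>\<^sub>F n in sequentially. norm (R n) \<le> (c * (2 * 2 powr q) + L) * norm (sqrt (E n) * ln (E n) powr q)"
    using c(2)
  proof eventually_elim
    case (elim n)
    have e: "exp 1 \<le> E n" "2 * L + 2 \<le> E n" using elim(1) by auto
    define Z where "Z = sqrt (E n) * ln (E n) powr q"
    have E2: "2 \<le> E n" using e L by linarith
    have \<Phi>: "1 \<le> \<Phi> n" "\<Phi> n \<le> 2 * E n" using \<Phi>E[of n] e L by linarith+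
    have ln: "1 \<le> ln (E n)" using e E2 by (simp add: ln_ge_iff)
    have "1 \<le> sqrt (E n)" using E2 by simp
    moreover have "1 \<le> ln (E n) powr q" using ln q by (simp add: ge_one_powr_ge_zero)
    ultimately have Z: "1 \<le> Z" unfolding Z_def using mult_mono[of 1 "sqrt (E n)" 1 "ln (E n) powr q"] by simp
    have "ln (\<Phi> n) \<le> ln (2 * E n)" using \<Phi> E2 by (subst ln_le_cancel_iff) auto
    also have "\<dots> = ln 2 + ln (E n)" using E2 by (simp add: ln_mult)
    also have "ln (2::real) \<le> ln (E n)" using E2 by (subst ln_le_cancel_iff) auto
    finally have "ln (\<Phi> n) powr q \<le> (2 * ln (E n)) powr q" using \<Phi> q by (intro powr_mono2) auto
    also have "\<dots> = 2 powr q * ln (E n) powr q" using ln by (simp add: powr_mult)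
    finally have l: "ln (\<Phi> n) powr q \<le> 2 powr q * ln (E n) powr q" .
    have "sqrt (\<Phi> n) \<le> sqrt (2\<^sup>2 * E n)" using \<Phi> E2 by (intro real_sqrt_le_mono) auto
    then have s: "sqrt (\<Phi> n) \<le> 2 * sqrt (E n)" by (simp add: real_sqrt_mult)
    have "sqrt (\<Phi> n) * ln (\<Phi> n) powr q \<le> (2 * sqrt (E n)) * (2 powr q * ln (E n) powr q)"
      using s l E2 by (intro mult_mono) auto
    also have "\<dots> = (2 * 2 powr q) * Z" by (simp add: Z_def)
    finally have "c * (sqrt (\<Phi> n) * ln (\<Phi> n) powr q) \<le> c * ((2 * 2 powr q) * Z)"
      using c(1) by (intro mult_left_mono) auto
    moreover have "norm (sqrt (\<Phi> n) * ln (\<Phi> n) powr q) = sqrt (\<Phi> n) * ln (\<Phi> n) powr q"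
      using \<Phi> by (simp add: abs_mult)
    ultimately have "\<bar>S n\<bar> \<le> c * ((2 * 2 powr q) * Z)" using elim(2) by simp
    moreover have "L * 1 \<le> L * Z" using Z L by (intro mult_left_mono)
    ultimately have "\<bar>R n\<bar> \<le> c * ((2 * 2 powr q) * Z) + L * Z" using RS[of n] by linarith
    also have "\<dots> = (c * (2 * 2 powr q) + L) * Z" by (simp add: algebra_simps)
    finally show ?case using Z by (simp add: Z_def)
  qed
  then show ?thesis by (rule bigoI)
qed

lemma mono_unbounded_at_top:
  fixes \<Phi> :: "nat \<Rightarrow> real"
  assumes "mono \<Phi>" "\<not> bdd_above (range \<Phi>)"
  shows "filterlim \<Phi> at_top sequentially"
  unfolding filterlim_at_top
proof
  fix Z
  have "\<exists>n. Z \<le> \<Phi> n"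
  proof (rule ccontr)
    assume "\<nexists>n. Z \<le> \<Phi> n"
    then have "\<Phi> n \<le> Z" for n by (meson linear)
    then have "bdd_above (range \<Phi>)" by (intro bdd_aboveI2)
    then show False using assms(2) by contradiction
  qed
  then obtain n where n: "Z \<le> \<Phi> n" by blast
  then show "\<forall>\<^sub>F n in sequentially. Z \<le> \<Phi> n"
    unfolding eventually_sequentially using assms(1) by (meson monoD order_trans)
qed

text \<open>
  From some time \<open>k1\<close> on the balls have measure exactly \<open>M k\<close>, and earlier times change both counts
  by a bounded amount. Hence both cases can be distinguished by the deterministic sum of the
  \<open>M k + 1/k\<^sup>2\<close>.
\<close>

lemma return_count_asymptotics:
  fixes \<mu> :: "'a::metric_space measure" and w b :: "nat \<Rightarrow> real"
  assumes prob: "prob_space \<mu>" and \<epsilon>: "0 < \<epsilon>" and k1: "0 < k1"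
    and Mk: "\<And>k. k1 \<le> k \<Longrightarrow> 0 \<le> M k" "\<And>k. k1 \<le> k \<Longrightarrow> M k \<le> 1"
    and Ek: "\<And>k. k1 \<le> k \<Longrightarrow> return_set \<mu> T M k \<in> sets \<mu>"
    and ball: "\<And>k. k1 \<le> k \<Longrightarrow> AE x in \<mu>. measure \<mu> (ball x (hit_radius \<mu> M k x)) = M k"
    and w: "\<And>l. 0 \<le> w l" "summable w" and b: "\<And>k. 0 \<le> b k" "summable b"
    and pE: "\<And>k. k1 \<le> k \<Longrightarrow> measure \<mu> (return_set \<mu> T M k) \<le> M k + 1 / (real k)\<^sup>2"
    and cov: "\<And>k l. k1 \<le> k \<Longrightarrow> 0 < l \<Longrightarrow>
      measure \<mu> (return_set \<mu> T M k \<inter> return_set \<mu> T M (k + l)) - M k * measure \<mu> (return_set \<mu> T M (k + l))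
        - M (k + l) * measure \<mu> (return_set \<mu> T M k) + M k * M (k + l)
      \<le> (M k + 1 / (real k)\<^sup>2) * w l + (M k + 1 / (real k)\<^sup>2) * b (k + l)
        + (M (k + l) + 1 / (real (k + l))\<^sup>2) * b k"
  shows "AE x in \<mu>.
    (if bdd_above (range (expected_count \<mu> M x))
     then (\<lambda>n. return_count \<mu> T M x n - expected_count \<mu> M x n) \<in> O(\<lambda>n. 1)
     else (\<lambda>n. return_count \<mu> T M x n - expected_count \<mu> M x n)
            \<in> O(\<lambda>n. sqrt (expected_count \<mu> M x n)
                     * ln (expected_count \<mu> M x n) powr (3 / 2 + \<epsilon>)))"
proof -
  interpret prob_space \<mu> by (rule prob)
  let ?r = "hit_radius \<mu> M"
  let ?E = "return_set \<mu> T M"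
  define f where "f k x = (if k1 \<le> k then indicator (?E k) x else (0::real))" for k x
  define h where "h k = (if k1 \<le> k then M k else 0)" for k
  define \<phi> where "\<phi> k = (if k1 \<le> k then M k + 1 / (real k)\<^sup>2 else 0)" for k
  \<comment> \<open>a summable bound for each term of the two differences \<open>cmp\<Phi>\<close> and \<open>cmpS\<close> below\<close>
  define err where "err k = (if k1 \<le> k then 1 / (real k)\<^sup>2 else 1)" for k
  have f: "f k \<in> borel_measurable \<mu>" "0 \<le> f k x" "f k x \<le> 1" for k x
  proof -
    show "f k \<in> borel_measurable \<mu>"
    proof (cases "k1 \<le> k")
      case True
      then have "f k = indicator (?E k)" by (simp add: f_def fun_eq_iff)
      then show ?thesis using Ek[OF True] by simp
    next
      case False
      then have "f k = (\<lambda>x. 0)" by (simp add: f_def fun_eq_iff)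
      then show ?thesis by simp
    qed
    show "0 \<le> f k x" "f k x \<le> 1" by (simp_all add: f_def indicator_def)
  qed
  have h: "0 \<le> h k" "h k \<le> \<phi> k" for k using Mk[of k] by (auto simp: h_def \<phi>_def)
  have \<phi>: "0 \<le> \<phi> k" "\<phi> k \<le> 2" for k
  proof -
    show "0 \<le> \<phi> k" using h[of k] by linarith
    show "\<phi> k \<le> 2" 
    proof (cases "k1 \<le> k")
      case True
      then have "1 \<le> real k" using k1 by simp
      then have "1 / (real k)\<^sup>2 \<le> 1" by (simp add: one_le_power)
      then show ?thesis using True Mk[OF True] by (simp add: \<phi>_def)
    qed (simp add: \<phi>_def)
  qed
  have err: "0 \<le> err k" for k by (simp add: err_def)
  have "summable (\<lambda>k. 1 / (real k)\<^sup>2)"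
    using inverse_power_summable[of 2, where ?'a = real] by (simp add: inverse_eq_divide)
  then have errs: "summable err"
    by (rule summable_comparison_test_ev[rotated]) (auto simp: err_def eventually_sequentially)
  have sum_err: "(\<Sum>k=1..n. err k) \<le> suminf err" for n
    by (rule sum_le_suminf[OF errs]) (simp_all add: err)
  define L where "L = suminf err"
  define \<Phi> where "\<Phi> n = (\<Sum>k=1..n. \<phi> k)" for n
  have mono\<Phi>: "mono \<Phi>" unfolding \<Phi>_def using \<phi> by (intro monoI sum_mono2) auto
  have "AE x in \<mu>. \<forall>k\<in>{k1..}. measure \<mu> (ball x (?r k x)) = M k"
    using ball by (subst AE_ball_countable) auto
  then have balls: "AE x in \<mu>. \<forall>k\<ge>k1. measure \<mu> (ball x (?r k x)) = M k"
    by (simp only: Ball_def atLeast_iff)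
  have ret: "return_count \<mu> T M x n = (\<Sum>k=1..n. indicator (?E k) x)" for x n
    unfolding return_count_def return_set_def by (intro sum.cong) (auto simp: indicator_def)
  have cmp\<Phi>: "\<bar>\<Phi> n - expected_count \<mu> M x n\<bar> \<le> L"
    if x: "\<forall>k\<ge>k1. measure \<mu> (ball x (?r k x)) = M k" for x n
  proof -
    have "\<bar>\<Phi> n - expected_count \<mu> M x n\<bar> \<le> (\<Sum>k=1..n. \<bar>\<phi> k - measure \<mu> (ball x (?r k x))\<bar>)"
      unfolding \<Phi>_def expected_count_def sum_subtractf[symmetric] by (rule sum_abs)
    also have "\<dots> \<le> (\<Sum>k=1..n. err k)"
      using x by (intro sum_mono) (auto simp: \<phi>_def err_def)
    finally show ?thesis using sum_err[of n] by (simp add: L_def)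
  qed
  have cmpS: "\<bar>(return_count \<mu> T M x n - expected_count \<mu> M x n) - (\<Sum>k=1..n. f k x - h k)\<bar> \<le> L"
    if x: "\<forall>k\<ge>k1. measure \<mu> (ball x (?r k x)) = M k" for x n
  proof -
    have "\<bar>(return_count \<mu> T M x n - expected_count \<mu> M x n) - (\<Sum>k=1..n. f k x - h k)\<bar>
       \<le> (\<Sum>k=1..n. \<bar>(indicator (?E k) x - measure \<mu> (ball x (?r k x))) - (f k x - h k)\<bar>)"
      unfolding ret expected_count_def sum_subtractf[symmetric] by (rule sum_abs)
    also have "\<dots> \<le> (\<Sum>k=1..n. err k)"
      using x by (intro sum_mono) (auto simp: f_def h_def err_def indicator_def)
    finally show ?thesis using sum_err[of n] by (simp add: L_def)
  qed
  show ?thesis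
  proof (cases "bdd_above (range \<Phi>)")
    case True
    then obtain c where c: "\<And>n. \<Phi> n \<le> c" by (auto simp: bdd_above_def)
    have "summable \<phi>"
    proof (rule bounded_imp_summable)
      show "0 \<le> \<phi> n" for n by (rule \<phi>(1))
      show "(\<Sum>k\<le>n. \<phi> k) \<le> c" for n
      proof -
        have "(\<Sum>k\<le>n. \<phi> k) = \<Phi> n"
          unfolding \<Phi>_def using k1 by (intro sum.mono_neutral_right) (auto simp: \<phi>_def)
        then show ?thesis using c by simp
      qed
    qed
    then have sumE: "summable (\<lambda>k. prob (if k1 \<le> k then ?E k else {}))"
      by (rule summable_comparison_test'[of _ 0]) (use pE in \<open>auto simp: \<phi>_def\<close>)
    have "AE x in \<mu>. \<forall>\<^sub>F k in sequentially. x \<in> space \<mu> - (if k1 \<le> k then ?E k else {})"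
      using Ek sumE by (intro borel_cantelli_AE1) (auto simp: less_top[symmetric])
    then show ?thesis using balls
    proof eventually_elim
      case (elim x)
      obtain n0 where n0: "\<And>k. n0 \<le> k \<Longrightarrow> x \<notin> (if k1 \<le> k then ?E k else {})"
        using elim(1) unfolding eventually_sequentially by auto
      have fin: "\<bar>\<Sum>k=1..n. f k x - h k\<bar> \<le> real n0 + \<bar>c\<bar>" for n
      proof -
        have "f k x = 0" if "n0 \<le> k" for k using n0[OF that] by (cases "k1 \<le> k") (simp_all add: f_def)
        then have "(\<Sum>k=1..n. f k x) \<le> (\<Sum>k=1..n. if k < n0 then 1 else 0)"
          using f(3) by (intro sum_mono) (auto simp: not_less)
        also have "\<dots> = real (card ({1..n} \<inter> {k. k < n0}))" by (simp add: sum.If_cases)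
        also have "\<dots> \<le> real (card {..<n0})" by (intro of_nat_mono card_mono) auto
        finally have 1: "(\<Sum>k=1..n. f k x) \<le> real n0" by simp
        have 2: "0 \<le> (\<Sum>k=1..n. f k x)" "0 \<le> (\<Sum>k=1..n. h k)" using f h by (auto intro!: sum_nonneg)
        have "(\<Sum>k=1..n. h k) \<le> \<Phi> n" unfolding \<Phi>_def using h by (intro sum_mono)
        then show ?thesis using 1 2 c[of n] by (simp add: sum_subtractf)
      qed
      have "\<bar>return_count \<mu> T M x n - expected_count \<mu> M x n\<bar> \<le> L + (real n0 + \<bar>c\<bar>)" for n
        using cmpS[OF elim(2), of n] fin[of n] by linarith
      then have "(\<lambda>n. return_count \<mu> T M x n - expected_count \<mu> M x n) \<in> O(\<lambda>n. 1)"
        by (intro bigoI[of _ "L + (real n0 + \<bar>c\<bar>)"]) simp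
      moreover have "bdd_above (range (expected_count \<mu> M x))"
        using cmp\<Phi>[OF elim(2)] c by (intro bdd_aboveI2[of _ _ "c + L"]) (smt (verit))
      ultimately show ?case by simp
    qed
  next
    case False
    have lim: "filterlim \<Phi> at_top sequentially" by (rule mono_unbounded_at_top[OF mono\<Phi> False])
    have "AE x in \<mu>. (\<lambda>n. \<Sum>k=1..n. f k x - h k) \<in> O(\<lambda>n. sqrt (\<Sum>k=1..n. \<phi> k) * ln (\<Sum>k=1..n. \<phi> k) powr (3 / 2 + \<epsilon>))"
    proof (rule quantitative_borel_cantelli[OF f h \<phi>(2) _ _ lim[unfolded \<Phi>_def] \<epsilon>])
      show "(\<integral>x. (\<Sum>k\<in>{i<..n}. f k x - h k)\<^sup>2 \<partial>\<mu>)
         \<le> (2 + 2 * (suminf w + 2 * suminf b)) * (\<Sum>k\<in>{i<..n}. \<phi> k)" for i n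
        unfolding f_def h_def \<phi>_def
        by (rule centered_indicator_second_moment[OF Ek Mk _ pE w b cov]) auto
      show "0 \<le> 2 + 2 * (suminf w + 2 * suminf b)"
        using suminf_nonneg[OF w(2,1)] suminf_nonneg[OF b(2,1)] by simp
    qed
    then show ?thesis using balls
    proof eventually_elim
      case (elim x)
      have E: "filterlim (expected_count \<mu> M x) at_top sequentially"
        unfolding filterlim_at_top
      proof
        fix Z
        have "\<forall>\<^sub>F n in sequentially. Z + L \<le> \<Phi> n" using lim unfolding filterlim_at_top by blast
        then show "\<forall>\<^sub>F n in sequentially. Z \<le> expected_count \<mu> M x n"
        proof eventually_elim
          case (elim n)
          then show ?case using cmp\<Phi>[OF \<open>\<forall>k\<ge>k1. _ k = M k\<close>, of n] by linarith
        qed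
      qed
      have "\<not> bdd_above (range (expected_count \<mu> M x))"
      proof
        assume "bdd_above (range (expected_count \<mu> M x))"
        then obtain c where c: "\<And>n. expected_count \<mu> M x n \<le> c" by (auto simp: bdd_above_def)
        have "\<forall>\<^sub>F n in sequentially. c + 1 \<le> expected_count \<mu> M x n" using E unfolding filterlim_at_top by blast
        then obtain n where "c + 1 \<le> expected_count \<mu> M x n" unfolding eventually_sequentially by blast
        then show False using c[of n] by linarith
      qed
      moreover have "(\<lambda>n. return_count \<mu> T M x n - expected_count \<mu> M x n)
            \<in> O(\<lambda>n. sqrt (expected_count \<mu> M x n) * ln (expected_count \<mu> M x n) powr (3 / 2 + \<epsilon>))"
        using \<epsilon>
        by (intro bigo_bounded_perturbation[OF elim(1)[folded \<Phi>_def] _ cmp\<Phi>[OF elim(2)] cmpS[OF elim(2)] E]) simp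
      ultimately show ?case by simp
    qed
  qed
qed

lemma riemannian_decorrelated_system:
  fixes \<A> :: "('a::metric_space, 'e::euclidean_space) chart set" and \<mu> :: "'a measure"
  assumes M: "compact_riemannian_manifold \<A> g" and \<mu>: "metric_mps \<mu> T"
    and dec: "threefold_decorrelation \<mu> T"
    and A: "0 < A" "0 < \<beta>" "0 < \<eta>0" "\<eta>0 \<le> 1"
  shows "\<exists>C \<tau> \<sigma> K. decorrelated_system \<mu> T C \<tau> \<sigma> K A \<beta> \<eta>0 DIM('e)"
proof -
  have prob: "prob_space \<mu>" and borel: "sets \<mu> = sets borel" and T: "T \<in> measurable \<mu> \<mu>"
    using \<mu> by (simp_all add: metric_mps_def)
  obtain K where K: "K > 0" "\<forall>\<rho>\<in>{0<..1}. \<exists>F::'a set. finite F \<and> (\<Union>c\<in>F. ball c \<rho>) = UNIV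
      \<and> real (card F) \<le> K * (1 / \<rho>) ^ DIM('e)"
    using compact_riemannian_manifold_covering[OF M] by blast
  obtain C \<tau> \<sigma> where C: "C > 0" "\<tau> > 0" "\<sigma> \<in> {0<..1}" and
    D: "\<forall>\<phi>1 \<phi>2 \<phi>3.
        (\<forall>\<phi>\<in>{\<phi>1, \<phi>2, \<phi>3}. lipschitz_fun \<phi> \<and> (\<forall>x. 0 \<le> \<phi> x)) \<longrightarrow>
        (\<forall>k>0. \<forall>l>0.
           \<bar>(\<integral>x. \<phi>1 x * \<phi>2 ((T ^^ k) x) * \<phi>3 ((T ^^ (k + l)) x) \<partial>\<mu>)
              - (\<integral>x. \<phi>1 x \<partial>\<mu>) * (\<integral>x. \<phi>2 x \<partial>\<mu>) * (\<integral>x. \<phi>3 x \<partial>\<mu>)\<bar>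
           \<le> C * lip_norm \<phi>1 * lip_norm \<phi>2 * lip_norm \<phi>3 * exp (- \<tau> * real (min k l))) \<and>
        (\<forall>k>0. \<forall>l>0. real k \<le> \<sigma> * real l \<longrightarrow>
           \<bar>(\<integral>x. \<phi>1 x * \<phi>2 ((T ^^ k) x) * \<phi>3 ((T ^^ (k + l)) x) \<partial>\<mu>)
              - (\<integral>x. \<phi>1 x * \<phi>2 ((T ^^ k) x) \<partial>\<mu>) * (\<integral>x. \<phi>3 x \<partial>\<mu>)\<bar>
           \<le> C * lip_norm \<phi>1 * lip_norm \<phi>2 * lip_norm \<phi>3 * exp (- \<tau> * real l))"
    using dec unfolding threefold_decorrelation_def by (elim exE conjE bexE) (rule that)
  have "decorrelated_system \<mu> T C \<tau> \<sigma> K A \<beta> \<eta>0 DIM('e)"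
  proof (rule decorrelated_system.intro[OF prob], unfold_locales)
    fix \<phi>1 \<phi>2 \<phi>3 :: "'a \<Rightarrow> real" and k l :: nat
    assume L: "lipschitz_fun \<phi>1" "lipschitz_fun \<phi>2" "lipschitz_fun \<phi>3"
      "\<And>x. 0 \<le> \<phi>1 x" "\<And>x. 0 \<le> \<phi>2 x" "\<And>x. 0 \<le> \<phi>3 x" and kl: "0 < k" "0 < l"
    have "\<forall>\<phi>\<in>{\<phi>1, \<phi>2, \<phi>3}. lipschitz_fun \<phi> \<and> (\<forall>x. 0 \<le> \<phi> x)" using L by simp
    note D' = D[THEN spec, THEN spec, THEN spec, THEN mp, OF this]
    show "\<bar>(\<integral>x. \<phi>1 x * \<phi>2 ((T ^^ k) x) * \<phi>3 ((T ^^ (k + l)) x) \<partial>\<mu>)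
              - (\<integral>x. \<phi>1 x \<partial>\<mu>) * (\<integral>x. \<phi>2 x \<partial>\<mu>) * (\<integral>x. \<phi>3 x \<partial>\<mu>)\<bar>
           \<le> C * lip_norm \<phi>1 * lip_norm \<phi>2 * lip_norm \<phi>3 * exp (- \<tau> * real (min k l))"
      using conjunct1[OF D'] kl by blast
    show "\<bar>(\<integral>x. \<phi>1 x * \<phi>2 ((T ^^ k) x) * \<phi>3 ((T ^^ (k + l)) x) \<partial>\<mu>)
              - (\<integral>x. \<phi>1 x * \<phi>2 ((T ^^ k) x) \<partial>\<mu>) * (\<integral>x. \<phi>3 x \<partial>\<mu>)\<bar>
           \<le> C * lip_norm \<phi>1 * lip_norm \<phi>2 * lip_norm \<phi>3 * exp (- \<tau> * real l)"
      if "real k \<le> \<sigma> * real l"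
      using conjunct2[OF D'] kl that by blast
  next
    show "\<exists>F::'a set. finite F \<and> (\<Union>c\<in>F. ball c \<rho>) = UNIV \<and> real (card F) \<le> K * (1 / \<rho>) ^ DIM('e)"
      if "0 < \<rho>" "\<rho> \<le> 1" for \<rho>
      using K(2) that by simp
  qed (use borel T C A K(1) in auto)
  then show ?thesis by blast
qed

lemma return_set_estimates:
  fixes \<A> :: "('a::metric_space, 'e::euclidean_space) chart set"
    and g :: "('a, 'e) chart \<Rightarrow> 'a \<Rightarrow> 'e \<Rightarrow> 'e \<Rightarrow> real"
    and \<mu> :: "'a measure"
    and T :: "'a \<Rightarrow> 'a"
    and M :: "nat \<Rightarrow> real"
    and \<delta> N :: real
  assumes "compact_riemannian_manifold \<A> g"
    and "metric_mps \<mu> T"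
    and "\<forall>k\<ge>1. M k \<in> {0..1}"
    and "threefold_decorrelation \<mu> T"
    and "short_return_times \<mu> T M \<delta> N"
    and "frostman \<mu>"
    and "thin_annuli \<mu>"
    and "\<exists>C>0. \<forall>k\<ge>2. M k \<le> C * ln (real k) powr (- (2 + N) / \<delta>)"
  obtains k1 :: nat and w b :: "nat \<Rightarrow> real" where "0 < k1"
    "\<And>k. k1 \<le> k \<Longrightarrow> return_set \<mu> T M k \<in> sets \<mu>"
    "\<And>k. k1 \<le> k \<Longrightarrow> AE x in \<mu>. measure \<mu> (ball x (hit_radius \<mu> M k x)) = M k"
    "\<And>l. 0 \<le> w l" "summable w" "\<And>k. 0 \<le> b k" "summable b"
    "\<And>k. k1 \<le> k \<Longrightarrow> measure \<mu> (return_set \<mu> T M k) \<le> M k + 1 / (real k)\<^sup>2"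
    "\<And>k l. k1 \<le> k \<Longrightarrow> 0 < l \<Longrightarrow>
      measure \<mu> (return_set \<mu> T M k \<inter> return_set \<mu> T M (k + l)) - M k * measure \<mu> (return_set \<mu> T M (k + l))
        - M (k + l) * measure \<mu> (return_set \<mu> T M k) + M k * M (k + l)
      \<le> (M k + 1 / (real k)\<^sup>2) * w l + (M k + 1 / (real k)\<^sup>2) * b (k + l)
        + (M (k + l) + 1 / (real (k + l))\<^sup>2) * b k"
proof -
  have cpt: "compact (UNIV :: 'a set)"
    using assms(1) by (simp add: compact_riemannian_manifold_def)
  have prob: "prob_space \<mu>" and borel: "sets \<mu> = sets borel"
    using assms(2) by (simp_all add: metric_mps_def)
  have fin: "finite_measure \<mu>" using prob by (simp add: prob_space_def)
  obtain A \<beta> \<eta>0 t0 where A: "A > 0" "\<beta> > 0" "\<eta>0 > 0" "t0 > 0" "\<eta>0 \<le> 1" and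
    annulus': "\<forall>x t \<eta>. t \<le> t0 \<and> 0 < \<eta> \<and> \<eta> \<le> \<eta>0 \<longrightarrow>
      measure \<mu> (ball x (t + \<eta>)) \<le> measure \<mu> (ball x t) + A * \<eta> powr \<beta>"
    using annulus_measure_le[OF fin borel assms(6,7)] by (elim exE conjE) (rule that)
  have annulus: "measure \<mu> (ball x (t + \<eta>)) \<le> measure \<mu> (ball x t) + A * \<eta> powr \<beta>"
    if "t \<le> t0" "0 < \<eta>" "\<eta> \<le> \<eta>0" for x t \<eta> using annulus' that by simp
  obtain C \<tau> \<sigma> K where sys: "decorrelated_system \<mu> T C \<tau> \<sigma> K A \<beta> \<eta>0 DIM('e)"
    using riemannian_decorrelated_system[OF assms(1,2,4) A(1-3,5)] by blast
  interpret decorrelated_system \<mu> T C \<tau> \<sigma> K A \<beta> \<eta>0 "DIM('e)" by (rule sys)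
  obtain m where m: "m > 0" "AE x in \<mu>. m \<le> measure \<mu> (ball x t0)"
    using compact_ball_measure_pos[OF fin borel cpt A(4)] by blast
  obtain C2 where C2: "C2 > 0" "\<And>k. 2 \<le> k \<Longrightarrow> M k \<le> C2 * ln (real k) powr (- (2 + N) / \<delta>)"
    using assms(8) by blast
  have M01: "0 \<le> M k" "M k \<le> 1" if "1 \<le> k" for k using assms(3) that by auto
  obtain C1 \<psi> where srt: "\<delta> > 0" "N > 0" "C1 > 0" "\<forall>l. 0 \<le> \<psi> l" "summable \<psi>"
    "\<forall>k>0. \<forall>l>0.
           measure \<mu> (return_set \<mu> T M k \<inter> return_set \<mu> T M (k + l))
           \<le> C1 * measure \<mu> (return_set \<mu> T M k) powr (1 + \<delta>) * ln (real k) powr N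
              + measure \<mu> (return_set \<mu> T M k) * \<psi> l"
    using assms(5) unfolding short_return_times_def by (elim exE conjE) (rule that)
  have "\<exists>k0. \<forall>k\<ge>k0. 2 \<le> k \<and> M k \<le> m"
  proof -
    have "0 < (2 + N) / \<delta>" using srt by simp
    then have "\<forall>\<^sub>F k in sequentially. C2 * ln (real k) powr (- ((2 + N) / \<delta>)) \<le> m"
      using m(1) by real_asymp
    then obtain k0 where "\<And>k. k0 \<le> k \<Longrightarrow> C2 * ln (real k) powr (- (2 + N) / \<delta>) \<le> m"
      unfolding eventually_sequentially minus_divide_left by blast
    then show ?thesis using C2(2) by (intro exI[of _ "max k0 2"]) force
  qed
  then obtain k0 where k0: "\<And>k. k0 \<le> k \<Longrightarrow> 2 \<le> k" "\<And>k. k0 \<le> k \<Longrightarrow> M k \<le> m" by blast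
  let ?r = "hit_radius \<mu> M"
  let ?E = "return_set \<mu> T M"
  have tgt: "target (?r k) (M k)" "AE x in \<mu>. measure \<mu> (ball x (?r k x)) = M k" if k: "k0 \<le> k" for k
  proof -
    have "AE x in \<mu>. M k \<le> measure \<mu> (ball x t0)"
      using m(2) by eventually_elim (use k0(2)[OF k] in linarith)
    note t = hit_radius_target[where M = M and k = k and ?t0.0 = t0, OF annulus compact_imp_bounded[OF cpt] A(4) _ _ this]
    show "target (?r k) (M k)" "AE x in \<mu>. measure \<mu> (ball x (?r k x)) = M k"
      using M01[of k] k0(1)[OF k] by (intro t; simp)+
  qed
  obtain B \<eta> where B: "B > 0" "\<eta> > 0"
    and single: "\<forall>r m k. target r m \<longrightarrow> 0 < k \<longrightarrow> \<bar>measure \<mu> (hit r k) - m\<bar> \<le> B * exp (- \<eta> * real k)"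
    and pair: "\<forall>r1 r2 m1 m2 k l. target r1 m1 \<longrightarrow> target r2 m2 \<longrightarrow> 0 < k \<longrightarrow> 0 < l \<longrightarrow>
      measure \<mu> (hit r1 k \<inter> hit r2 (k + l))
        \<le> m1 * m2 + B * exp (- \<eta> * real k) * m2 + B * exp (- \<eta> * real l)"
    using exponential_recurrence by (elim exE conjE) (rule that)
  have "\<exists>k1 w b. k0 \<le> k1 \<and> 0 < k1 \<and> (\<forall>l. 0 \<le> w l) \<and> summable w \<and> (\<forall>k. 0 \<le> b k) \<and> summable b \<and>
    (\<forall>k\<ge>k1. prob (?E k) \<le> M k + 1 / (real k)\<^sup>2 \<and> (\<forall>l>0.
      prob (?E k \<inter> ?E (k + l)) - M k * prob (?E (k + l)) - M (k + l) * prob (?E k) + M k * M (k + l)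
      \<le> (M k + 1 / (real k)\<^sup>2) * w l + (M k + 1 / (real k)\<^sup>2) * b (k + l)
        + (M (k + l) + 1 / (real (k + l))\<^sup>2) * b k))"
  proof (rule recurrence_covariance_bound[OF B srt(3) C2(1) srt(1,2) srt(4)[rule_format] srt(5)])
    show "0 \<le> M k" if "k0 \<le> k" for k using M01(1)[of k] k0(1)[OF that] by simp
    show "\<bar>prob (?E k) - M k\<bar> \<le> B * exp (- \<eta> * real k)" if "k0 \<le> k" "0 < k" for k
      using single[rule_format, OF tgt(1)[OF that(1)] that(2)] by (simp add: return_set_eq_hit)
    show "prob (?E k \<inter> ?E (k + l)) \<le> M k * M (k + l) + B * exp (- \<eta> * real k) * M (k + l) + B * exp (- \<eta> * real l)"
      if "k0 \<le> k" "0 < k" "0 < l" for k l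
      using pair[rule_format, OF tgt(1)[OF that(1)] tgt(1)[of "k + l"] that(2,3)] that(1) by (simp add: return_set_eq_hit)
    show "0 \<le> prob (?E k)" for k by simp
    show "prob (?E k \<inter> ?E (k + l)) \<le> C1 * prob (?E k) powr (1 + \<delta>) * ln (real k) powr N + prob (?E k) * \<psi> l"
      if "0 < k" "0 < l" for k l using srt(6) that by blast
    show "M k \<le> C2 * ln (real k) powr (- (2 + N) / \<delta>)" if "2 \<le> k" for k by (rule C2(2)[OF that])
  qed
  then obtain k1 w b where k1: "k0 \<le> k1" "0 < k1" and w: "\<And>l. 0 \<le> w l" "summable w"
    and b: "\<And>k. 0 \<le> b k" "summable b" and pc: "\<forall>k\<ge>k1. prob (?E k) \<le> M k + 1 / (real k)\<^sup>2 \<and> (\<forall>l>0.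
      prob (?E k \<inter> ?E (k + l)) - M k * prob (?E (k + l)) - M (k + l) * prob (?E k) + M k * M (k + l)
      \<le> (M k + 1 / (real k)\<^sup>2) * w l + (M k + 1 / (real k)\<^sup>2) * b (k + l)
        + (M (k + l) + 1 / (real (k + l))\<^sup>2) * b k)"
    by (elim exE conjE) (rule that, simp_all)
  have "?E k \<in> events" if "k1 \<le> k" for k
    using hit_measurable[of "?r k" k] tgt(1)[of k] that k1 by (simp add: return_set_eq_hit target_def)
  moreover have "AE x in \<mu>. measure \<mu> (ball x (?r k x)) = M k" if "k1 \<le> k" for k
    using tgt(2)[of k] that k1 by simp
  ultimately show thesis
  proof (rule that[OF k1(2) _ _ w b])
    show "prob (?E k) \<le> M k + 1 / (real k)\<^sup>2" if "k1 \<le> k" for k using pc that by blast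
    show "prob (?E k \<inter> ?E (k + l)) - M k * prob (?E (k + l)) - M (k + l) * prob (?E k) + M k * M (k + l)
      \<le> (M k + 1 / (real k)\<^sup>2) * w l + (M k + 1 / (real k)\<^sup>2) * b (k + l)
        + (M (k + l) + 1 / (real (k + l))\<^sup>2) * b k" if "k1 \<le> k" "0 < l" for k l
      using pc that by blast
  qed
qed

theorem theorem3:
  fixes \<A> :: "('a::metric_space, 'e::euclidean_space) chart set"
    and g :: "('a, 'e) chart \<Rightarrow> 'a \<Rightarrow> 'e \<Rightarrow> 'e \<Rightarrow> real"
    and \<mu> :: "'a measure"
    and T :: "'a \<Rightarrow> 'a"
    and M :: "nat \<Rightarrow> real"
    and \<delta> N \<epsilon> :: real
  assumes "compact_riemannian_manifold \<A> g"
    and "metric_mps \<mu> T"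
    and "\<forall>k\<ge>1. M k \<in> {0..1}"
    and "threefold_decorrelation \<mu> T"
    and "short_return_times \<mu> T M \<delta> N"
    and "frostman \<mu>"
    and "thin_annuli \<mu>"
    and "\<exists>C>0. \<forall>k\<ge>2. M k \<le> C * ln (real k) powr (- (2 + N) / \<delta>)"
    and "\<epsilon> > 0"
  shows "AE x in \<mu>.
    (if bdd_above (range (expected_count \<mu> M x))
     then (\<lambda>n. return_count \<mu> T M x n - expected_count \<mu> M x n) \<in> O(\<lambda>n. 1)
     else (\<lambda>n. return_count \<mu> T M x n - expected_count \<mu> M x n)
            \<in> O(\<lambda>n. sqrt (expected_count \<mu> M x n)
                     * ln (expected_count \<mu> M x n) powr (3 / 2 + \<epsilon>)))"
proof -
  have prob: "prob_space \<mu>" using assms(2) by (simp add: metric_mps_def)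
  show ?thesis
  proof (rule return_set_estimates[OF assms(1-8)], goal_cases)
    case est: (1 k1 w b)
    have "\<And>k. k1 \<le> k \<Longrightarrow> 0 \<le> M k" "\<And>k. k1 \<le> k \<Longrightarrow> M k \<le> 1"
      using assms(3) est(1) by auto
    then show ?thesis
      by (rule return_count_asymptotics[OF prob assms(9) est(1) _ _ est(2-)])
  qed
qed


end
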